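(* Suppose $f$ belongs to the closure of $A\,\mathcal{D}_T$ in $L^2(D,F)$. Then the family $\{u_\varepsilon(f)\}_{\varepsilon>0}$ is bounded in $\mathcal{D}_T$ if and only if the Cauchy problem of finding $u\in\mathcal{D}_T$ such that $Au=f$ in $D$ is solvable. Moreover, $$\lim_{\varepsilon\to0+}\|Au_\varepsilon(f)-f\|_{L^2(D,F)}=0,$$ and even $\{u_\varepsilon(f)\}_{\varepsilon>0}$ converges weakly, when $\varepsilon\to0+$, to the solution $u\in\mathcal{D}_T$ of this Cauchy problem which is $L^2(D,E)$-orthogonal to $\mathcal{D}_T\cap\mathcal{S}_A(D)$.
   Context: Setting. $X$ is a $C^\infty$ manifold of dimension $n$ with smooth boundary, embedded in a smooth closed manifold of the same dimension; $X^\circ$ is its interior; $dx$ is a fixed volume form. $E, F$ are smooth complex vector bundles over $X$ with Hermitian metrics $(\cdot,\cdot)_x$. $A$ is a linear partial differential operator of order $m$ (with smooth coefficients) from sections of $E$ to sections of $F$ whose principal symbol is injective away from the zero section of $T^*X$. $D \subset X^\circ$ is a relatively compact domain with smooth boundary $\partial D$, and $\Gamma \subset \partial D$ is a closed subset ($\Gamma=\emptyset$ and $\Gamma=\partial D$ allowed). $\mathcal{S}_A(D)$ is the space of weak solutions of $Au=0$ in $D$. Fix a Dirichlet system $B_0,\dots,B_{m-1}$ of order $m-1$ on $\partial D$: each $B_j$ is a differential operator of type $E\to F_j$ and order $m_j\le m-1$ in a neighbourhood of $\partial D$, $m_i\ne m_j$ for $i\neq j$, and the principal symbols of $B_j$ restricted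 to the conormal bundle of $\partial D$ have rank equal to the dimension of $F_j$. Put $t(u)=\oplus_{j=0}^{m-1}B_ju$. For sections $u,v$ put $D(u,v)=(u,v)_{L^2(D,E)}+(Au,Av)_{L^2(D,F)}$, $D(u)=\sqrt{D(u,u)}$. $\mathcal{D}_T$ is the completion, with respect to the norm $D(\cdot)$, of the space of all $u\in C^\infty(\overline D,E)$ with $t(u)=0$ on $\Gamma$; it is a Hilbert space with scalar product $D(\cdot,\cdot)$. For $\varepsilon>0$ and $f\in L^2(D,F)$, $u_\varepsilon(f)$ denotes the unique element $u_\varepsilon\in\mathcal{D}_T$ such that $(Au_\varepsilon,Av)_{L^2(D,F)}+\varepsilon\,(u_\varepsilon,v)_{L^2(D,E)}=(f,Av)_{L^2(D,F)}$ for all $v\in\mathcal{D}_T$. *)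

theory Defs
  imports "HOL-Analysis.Analysis" "Jordan_Normal_Form.DL_Rank"
begin

text \<open>
  Vectors and matrices of fixed type-level dimension (charts, covectors) are those of HOL-Analysis;
  fibre coordinates, whose dimension varies from bundle to bundle, are the \<open>complex vec\<close> and
  \<open>complex mat\<close> of Jordan_Normal_Form. The infix \<open>$\<close> below always belongs to the latter.
\<close>

unbundle no vec_syntax
unbundle no inner_syntax

section \<open>Smooth functions on open subsets of Euclidean space\<close>

definition pderiv_dir ::
  "'n::finite \<Rightarrow> (real^'n \<Rightarrow> 'b::real_normed_vector) \<Rightarrow> real^'n \<Rightarrow> 'b" where
  "pderiv_dir i f = (\<lambda>x. frechet_derivative f (at x) (axis i 1))"

primrec Ck_on ::
  "nat \<Rightarrow> (real^'n::finite) set \<Rightarrow> (real^'n \<Rightarrow> 'b::real_normed_vector) \<Rightarrow> bool" where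
  "Ck_on 0 S f \<longleftrightarrow> continuous_on S f"
| "Ck_on (Suc k) S f \<longleftrightarrow> (\<forall>x\<in>S. f differentiable (at x)) \<and> (\<forall>i. Ck_on k S (pderiv_dir i f))"

definition Cinf_on ::
  "(real^'n::finite) set \<Rightarrow> (real^'n \<Rightarrow> 'b::real_normed_vector) \<Rightarrow> bool" where
  "Cinf_on S f \<longleftrightarrow> (\<forall>k. Ck_on k S f)"

text \<open>
  A multi-index is a function \<open>\<alpha> :: 'n \<Rightarrow> nat\<close>. The partial derivatives of \<open>mderiv\<close> are taken along
  some enumeration of the coordinates; on smooth functions they commute, so the choice is immaterial.
\<close>

definition mdeg :: "('n::finite \<Rightarrow> nat) \<Rightarrow> nat" where
  "mdeg \<alpha> = (\<Sum>i\<in>UNIV. \<alpha> i)"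

definition mderiv ::
  "('n::finite \<Rightarrow> nat) \<Rightarrow> (real^'n \<Rightarrow> 'b::real_normed_vector) \<Rightarrow> real^'n \<Rightarrow> 'b" where
  "mderiv \<alpha> f =
     foldr (\<lambda>i g. (pderiv_dir i ^^ \<alpha> i) g) (SOME xs. distinct xs \<and> set xs = UNIV) f"


section \<open>Manifolds\<close>

type_synonym ('m, 'n) chart = "'m set \<times> ('m \<Rightarrow> real^'n)"

definition is_chart :: "('m::topological_space, 'n::finite) chart \<Rightarrow> bool" where
  "is_chart c \<longleftrightarrow> (case c of (U, \<phi>) \<Rightarrow>
     open U \<and> open (\<phi> ` U) \<and> homeomorphism U (\<phi> ` U) \<phi> (inv_into U \<phi>))"

definition transition :: "('m, 'n::finite) chart \<Rightarrow> ('m, 'n) chart \<Rightarrow> real^'n \<Rightarrow> real^'n" where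
  "transition c c' = snd c' \<circ> inv_into (fst c) (snd c)"

definition compatible :: "('m, 'n::finite) chart \<Rightarrow> ('m, 'n) chart \<Rightarrow> bool" where
  "compatible c c' \<longleftrightarrow>
     Cinf_on (snd c ` (fst c \<inter> fst c')) (transition c c') \<and>
     Cinf_on (snd c' ` (fst c \<inter> fst c')) (transition c' c)"

definition closed_manifold :: "('m::t2_space, 'n::finite) chart set \<Rightarrow> bool" where
  "closed_manifold \<A> \<longleftrightarrow>
     compact (UNIV :: 'm set) \<and>
     (\<forall>c\<in>\<A>. is_chart c) \<and>
     \<Union> (fst ` \<A>) = UNIV \<and>
     (\<forall>c\<in>\<A>. \<forall>c'\<in>\<A>. compatible c c') \<and>
     \<comment> \<open>maximality of the atlas\<close>
     (\<forall>c. is_chart c \<and> (\<forall>c'\<in>\<A>. compatible c c') \<longrightarrow> c \<in> \<A>)"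

definition smooth_on_open ::
  "('m::topological_space, 'n::finite) chart set \<Rightarrow> 'm set \<Rightarrow> ('m \<Rightarrow> 'b::real_normed_vector) \<Rightarrow> bool"
  where
  "smooth_on_open \<A> V f \<longleftrightarrow>
     open V \<and> (\<forall>(U, \<phi>)\<in>\<A>. Cinf_on (\<phi> ` (U \<inter> V)) (f \<circ> inv_into U \<phi>))"

text \<open>On an arbitrary subset (in particular up to the boundary of \<open>X\<close>): local smooth extendability.\<close>

definition smooth_on ::
  "('m::topological_space, 'n::finite) chart set \<Rightarrow> 'm set \<Rightarrow> ('m \<Rightarrow> 'b::real_normed_vector) \<Rightarrow> bool"
  where
  "smooth_on \<A> S f \<longleftrightarrow>
     (\<forall>p\<in>S. \<exists>V g. p \<in> V \<and> smooth_on_open \<A> V g \<and> (\<forall>q\<in>V \<inter> S. g q = f q))"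

text \<open>Submanifold with smooth boundary, of full dimension; its interior is the topological \<open>interior\<close>.\<close>

definition submanifold_with_boundary ::
  "('m::topological_space, 'n::finite) chart set \<Rightarrow> 'm set \<Rightarrow> bool" where
  "submanifold_with_boundary \<A> X \<longleftrightarrow>
     (\<forall>p\<in>X. \<exists>(U, \<phi>)\<in>\<A>. p \<in> U \<and>
        (U \<subseteq> X \<or> (\<exists>i. vec_nth (\<phi> p) i = 0 \<and> (\<forall>q\<in>U. q \<in> X \<longleftrightarrow> 0 \<le> vec_nth (\<phi> q) i))))"

definition smooth_domain ::
  "('m::topological_space, 'n::finite) chart set \<Rightarrow> 'm set \<Rightarrow> 'm set \<Rightarrow> bool" where
  "smooth_domain \<A> X D \<longleftrightarrow>
     open D \<and> connected D \<and> D \<noteq> {} \<and> compact (closure D) \<and> closure D \<subseteq> interior X \<and>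
     (\<forall>p\<in>frontier D. \<exists>(U, \<phi>)\<in>\<A>. p \<in> U \<and>
        (\<exists>i. vec_nth (\<phi> p) i = 0 \<and> (\<forall>q\<in>U. q \<in> D \<longleftrightarrow> 0 < vec_nth (\<phi> q) i)))"

text \<open>
  A volume form, given by its coefficient \<open>\<omega> c\<close> with respect to the coordinates of each chart \<open>c\<close>,
  and the measure \<open>dx\<close> which it induces on \<open>X\<close> (nothing is said about \<open>dx\<close> outside \<open>X\<close>).
\<close>

definition volume_form ::
  "('m::topological_space, 'n::finite) chart set \<Rightarrow> 'm set \<Rightarrow> (('m, 'n) chart \<Rightarrow> 'm \<Rightarrow> real) \<Rightarrow> bool"
  where
  "volume_form \<A> X \<omega> \<longleftrightarrow>
     (\<forall>c\<in>\<A>. smooth_on \<A> (fst c \<inter> X) (\<omega> c) \<and> (\<forall>x\<in>fst c \<inter> X. \<omega> c x \<noteq> 0)) \<and>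
     (\<forall>c\<in>\<A>. \<forall>c'\<in>\<A>. \<forall>x\<in>fst c \<inter> fst c' \<inter> X.
        \<omega> c x = Determinants.det (matrix (frechet_derivative (transition c c') (at (snd c x)))) * \<omega> c' x)"

definition volume_measure ::
  "('m::topological_space, 'n::finite) chart set \<Rightarrow> 'm set \<Rightarrow> (('m, 'n) chart \<Rightarrow> 'm \<Rightarrow> real) \<Rightarrow>
     'm measure \<Rightarrow> bool" where
  "volume_measure \<A> X \<omega> dx \<longleftrightarrow>
     space dx = UNIV \<and> sets dx = sets borel \<and>
     (\<forall>(U, \<phi>)\<in>\<A>. \<forall>S\<in>sets borel. S \<subseteq> U \<inter> X \<longrightarrow>
        emeasure dx S = (\<integral>\<^sup>+z\<in>\<phi> ` S. ennreal \<bar>\<omega> (U, \<phi>) (inv_into U \<phi> z)\<bar> \<partial>lborel))"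


section \<open>Vector bundles\<close>

text \<open>
  A complex vector bundle is given by its fibres and its local trivialisations; a trivialisation
  \<open>(V, \<tau>)\<close> consists of bijections \<open>\<tau> x\<close> of the fibres over \<open>x \<in> V\<close> onto \<open>\<complex>\<^sup>r\<close>, and the change of
  trivialisation is smooth with values in the invertible matrices. The fibres carry the vector
  space structure transported by any of the \<open>\<tau> x\<close>.
\<close>

type_synonym ('m, 'e) triv = "'m set \<times> ('m \<Rightarrow> 'e \<Rightarrow> complex vec)"

record ('m, 'e) vbundle =
  fib :: "'m \<Rightarrow> 'e set"
  rnk :: nat
  trv :: "('m, 'e) triv set"

record ('m, 'e) hbundle = "('m, 'e) vbundle" +
  met :: "'m \<Rightarrow> 'e \<Rightarrow> 'e \<Rightarrow> complex"

definition vector_bundle ::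
  "('m::topological_space, 'n::finite) chart set \<Rightarrow> 'm set \<Rightarrow> ('m, 'e, 'z) vbundle_scheme \<Rightarrow> bool" where
  "vector_bundle \<A> X E \<longleftrightarrow>
     X \<subseteq> \<Union> (fst ` trv E) \<and>
     (\<forall>(V, \<tau>)\<in>trv E. openin (top_of_set X) V \<and>
        (\<forall>x\<in>V. bij_betw (\<tau> x) (fib E x) (carrier_vec (rnk E)))) \<and>
     (\<forall>(V, \<tau>)\<in>trv E. \<forall>(V', \<tau>')\<in>trv E. \<exists>g.
        (\<forall>x\<in>V \<inter> V'. g x \<in> carrier_mat (rnk E) (rnk E) \<and> invertible_mat (g x) \<and>
           (\<forall>a\<in>fib E x. \<tau>' x a = g x *\<^sub>v \<tau> x a)) \<and>
        (\<forall>i<rnk E. \<forall>j<rnk E. smooth_on \<A> (V \<inter> V') (\<lambda>x. g x $$ (i, j))))"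

text \<open>A Hermitian metric is linear in the first and antilinear in the second argument.\<close>

definition hermitian_bundle ::
  "('m::topological_space, 'n::finite) chart set \<Rightarrow> 'm set \<Rightarrow> ('m, 'e, 'z) hbundle_scheme \<Rightarrow> bool" where
  "hermitian_bundle \<A> X E \<longleftrightarrow>
     vector_bundle \<A> X E \<and>
     (\<forall>(V, \<tau>)\<in>trv E. \<exists>H.
        (\<forall>x\<in>V. H x \<in> carrier_mat (rnk E) (rnk E) \<and>
           (\<forall>a\<in>fib E x. \<forall>b\<in>fib E x. met E x a b = (H x *\<^sub>v \<tau> x a) \<bullet>c \<tau> x b)) \<and>
        (\<forall>i<rnk E. \<forall>j<rnk E. smooth_on \<A> V (\<lambda>x. H x $$ (i, j))) \<and>
        (\<forall>x\<in>V. \<forall>a\<in>fib E x. \<forall>b\<in>fib E x. met E x b a = cnj (met E x a b)) \<and>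
        (\<forall>x\<in>V. \<forall>a\<in>fib E x. \<tau> x a \<noteq> 0\<^sub>v (rnk E) \<longrightarrow> 0 < Re (met E x a a)))"

definition fib_coord :: "('m, 'e, 'z) vbundle_scheme \<Rightarrow> 'm \<Rightarrow> 'e \<Rightarrow> complex vec" where
  "fib_coord E x = snd (SOME c. c \<in> trv E \<and> x \<in> fst c) x"

definition fib_zero :: "('m, 'e, 'z) vbundle_scheme \<Rightarrow> 'm \<Rightarrow> 'e" where
  "fib_zero E x = inv_into (fib E x) (fib_coord E x) (0\<^sub>v (rnk E))"

definition sec_diff ::
  "('m, 'e, 'z) vbundle_scheme \<Rightarrow> ('m \<Rightarrow> 'e) \<Rightarrow> ('m \<Rightarrow> 'e) \<Rightarrow> 'm \<Rightarrow> 'e" where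
  "sec_diff E u v = (\<lambda>x.
     inv_into (fib E x) (fib_coord E x) (fib_coord E x (u x) - fib_coord E x (v x)))"

text \<open>Sections over \<open>S\<close> are functions on the whole of \<open>'m\<close> whose values outside \<open>S\<close> are irrelevant.\<close>

definition smooth_section ::
  "('m::topological_space, 'n::finite) chart set \<Rightarrow> ('m, 'e, 'z) vbundle_scheme \<Rightarrow> 'm set \<Rightarrow>
     ('m \<Rightarrow> 'e) \<Rightarrow> bool" where
  "smooth_section \<A> E S u \<longleftrightarrow>
     (\<forall>x\<in>S. u x \<in> fib E x) \<and>
     (\<forall>(V, \<tau>)\<in>trv E. \<forall>i<rnk E. smooth_on \<A> (V \<inter> S) (\<lambda>x. \<tau> x (u x) $ i))"

text \<open>\<open>C\<^sup>\<infinity>(closure D, E)\<close>: sections which are smooth in a neighbourhood of \<open>closure D\<close>.\<close>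

definition smooth_closure_sections ::
  "('m::topological_space, 'n::finite) chart set \<Rightarrow> 'm set \<Rightarrow> 'm set \<Rightarrow> ('m, 'e, 'z) vbundle_scheme \<Rightarrow>
     ('m \<Rightarrow> 'e) set" where
  "smooth_closure_sections \<A> X D E =
     {u. \<exists>O'. open O' \<and> closure D \<subseteq> O' \<and> O' \<subseteq> X \<and> smooth_section \<A> E O' u}"

definition test_sections ::
  "('m::topological_space, 'n::finite) chart set \<Rightarrow> 'm set \<Rightarrow> ('m, 'e, 'z) vbundle_scheme \<Rightarrow>
     ('m \<Rightarrow> 'e) set" where
  "test_sections \<A> D E =
     {u. smooth_section \<A> E D u \<and>
         (\<exists>K. compact K \<and> K \<subseteq> D \<and> (\<forall>x\<in>D - K. u x = fib_zero E x))}"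


section \<open>Differential operators\<close>

text \<open>
  \<open>local_rep\<close>: in the chart \<open>(U, \<phi>)\<close> and the trivialisations \<open>(V, \<tau>)\<close>, \<open>(V', \<sigma>)\<close>, the operator \<open>P\<close> of type
  \<open>E \<rightarrow> G\<close> over the base \<open>X\<close> is \<open>\<Sum>\<^bsub>|\<alpha>| \<le> k\<^esub> a\<^sub>\<alpha>(x) \<partial>\<^sup>\<alpha>\<close>. At a boundary point of \<open>X\<close> the derivatives are those
  of a smooth extension \<open>f\<close> of the coordinates of the section across the boundary.
\<close>

definition local_rep ::
  "('m::topological_space, 'n::finite) chart set \<Rightarrow> 'm set \<Rightarrow> nat \<Rightarrow>
     ('m, 'e, 'y) vbundle_scheme \<Rightarrow> ('m, 'g, 'z) vbundle_scheme \<Rightarrow> (('m \<Rightarrow> 'e) \<Rightarrow> ('m \<Rightarrow> 'g)) \<Rightarrow>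
     ('m, 'n) chart \<Rightarrow> ('m, 'e) triv \<Rightarrow> ('m, 'g) triv \<Rightarrow> (('n \<Rightarrow> nat) \<Rightarrow> 'm \<Rightarrow> complex mat) \<Rightarrow> bool" where
  "local_rep \<A> X k E G P c s t a \<longleftrightarrow> (case (c, s, t) of ((U, \<phi>), (V, \<tau>), (V', \<sigma>)) \<Rightarrow>
     let Q = U \<inter> V \<inter> V' \<inter> X in
     (\<forall>\<alpha>. mdeg \<alpha> \<le> k \<longrightarrow>
        (\<forall>x\<in>Q. a \<alpha> x \<in> carrier_mat (rnk G) (rnk E)) \<and>
        (\<forall>i<rnk G. \<forall>j<rnk E. smooth_on \<A> Q (\<lambda>x. a \<alpha> x $$ (i, j)))) \<and>
     (\<forall>O' u. openin (top_of_set X) O' \<and> smooth_section \<A> E O' u \<longrightarrow>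
        (\<forall>y\<in>O' \<inter> Q. \<forall>W f. open W \<and> y \<in> W \<and>
           (\<forall>j<rnk E. smooth_on_open \<A> W (f j) \<and> (\<forall>z\<in>W \<inter> O' \<inter> Q. f j z = \<tau> z (u z) $ j)) \<longrightarrow>
           (\<forall>i<rnk G. \<sigma> y (P u y) $ i =
              (\<Sum>\<alpha> | mdeg \<alpha> \<le> k. \<Sum>j<rnk E. a \<alpha> y $$ (i, j) * mderiv \<alpha> (f j \<circ> inv_into U \<phi>) (\<phi> y))))))"

definition diff_operator ::
  "('m::topological_space, 'n::finite) chart set \<Rightarrow> 'm set \<Rightarrow> nat \<Rightarrow>
     ('m, 'e, 'y) vbundle_scheme \<Rightarrow> ('m, 'g, 'z) vbundle_scheme \<Rightarrow> (('m \<Rightarrow> 'e) \<Rightarrow> ('m \<Rightarrow> 'g)) \<Rightarrow> bool" where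
  "diff_operator \<A> X k E G P \<longleftrightarrow>
     (\<forall>O' u. openin (top_of_set X) O' \<and> smooth_section \<A> E O' u \<longrightarrow> (\<forall>x\<in>O'. P u x \<in> fib G x)) \<and>
     (\<forall>c\<in>\<A>. \<forall>s\<in>trv E. \<forall>t\<in>trv G. \<exists>a. local_rep \<A> X k E G P c s t a)"

definition symbol ::
  "nat \<Rightarrow> ('m, 'e, 'y) vbundle_scheme \<Rightarrow> ('m, 'g, 'z) vbundle_scheme \<Rightarrow>
     (('n::finite \<Rightarrow> nat) \<Rightarrow> 'm \<Rightarrow> complex mat) \<Rightarrow> 'm \<Rightarrow> real^'n \<Rightarrow> complex mat" where
  "symbol k E G a x \<xi> = Matrix.mat (rnk G) (rnk E) (\<lambda>(i, j).
     \<Sum>\<alpha> | mdeg \<alpha> = k. a \<alpha> x $$ (i, j) * (\<Prod>l\<in>UNIV. (\<i> * complex_of_real (vec_nth \<xi> l)) ^ \<alpha> l))"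

definition injective_symbol ::
  "('m::topological_space, 'n::finite) chart set \<Rightarrow> 'm set \<Rightarrow> nat \<Rightarrow>
     ('m, 'e, 'y) vbundle_scheme \<Rightarrow> ('m, 'g, 'z) vbundle_scheme \<Rightarrow> (('m \<Rightarrow> 'e) \<Rightarrow> ('m \<Rightarrow> 'g)) \<Rightarrow> bool" where
  "injective_symbol \<A> X k E G P \<longleftrightarrow>
     (\<forall>c\<in>\<A>. \<forall>s\<in>trv E. \<forall>t\<in>trv G. \<forall>a. local_rep \<A> X k E G P c s t a \<longrightarrow>
        (\<forall>x\<in>fst c \<inter> fst s \<inter> fst t \<inter> X. \<forall>\<xi>. \<xi> \<noteq> 0 \<longrightarrow>
           inj_on (\<lambda>v. symbol k E G a x \<xi> *\<^sub>v v) (carrier_vec (rnk E))))"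

text \<open>
  Covectors at \<open>x\<close>, in the coordinates of a chart, which annihilate the tangent space of the
  hypersurface \<open>S\<close>, i.e. the velocities of all curves in \<open>S\<close> through \<open>x\<close>.
\<close>

definition conormal :: "'m set \<Rightarrow> ('m, 'n::finite) chart \<Rightarrow> 'm \<Rightarrow> real^'n \<Rightarrow> bool" where
  "conormal S c x \<xi> \<longleftrightarrow> (case c of (U, \<phi>) \<Rightarrow>
     \<forall>\<gamma> v. \<gamma> 0 = \<phi> x \<and> (\<forall>t::real. \<gamma> t \<in> \<phi> ` (U \<inter> S)) \<and> (\<gamma> has_vector_derivative v) (at 0) \<longrightarrow>
       inner \<xi> v = 0)"

definition dirichlet_system ::
  "('m::topological_space, 'n::finite) chart set \<Rightarrow> 'm set \<Rightarrow> 'm set \<Rightarrow> ('m, 'e, 'y) vbundle_scheme \<Rightarrow>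
     nat \<Rightarrow> 'm set \<Rightarrow> (nat \<Rightarrow> nat) \<Rightarrow> (nat \<Rightarrow> ('m, 'g, 'z) vbundle_scheme) \<Rightarrow>
     (nat \<Rightarrow> ('m \<Rightarrow> 'e) \<Rightarrow> ('m \<Rightarrow> 'g)) \<Rightarrow> bool" where
  "dirichlet_system \<A> X D E m N mo Fj B \<longleftrightarrow>
     open N \<and> frontier D \<subseteq> N \<and> N \<subseteq> interior X \<and>
     (\<forall>j<m. vector_bundle \<A> N (Fj j) \<and> mo j \<le> m - 1 \<and> diff_operator \<A> N (mo j) E (Fj j) (B j)) \<and>
     inj_on mo {..<m} \<and>
     (\<forall>j<m. \<forall>c\<in>\<A>. \<forall>s\<in>trv E. \<forall>t\<in>trv (Fj j). \<forall>a. local_rep \<A> N (mo j) E (Fj j) (B j) c s t a \<longrightarrow>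
        (\<forall>x\<in>fst c \<inter> fst s \<inter> fst t \<inter> frontier D. \<forall>\<xi>. \<xi> \<noteq> 0 \<and> conormal (frontier D) c x \<xi> \<longrightarrow>
           vec_space.rank (rnk (Fj j)) (symbol (mo j) E (Fj j) a x \<xi>) = rnk (Fj j)))"


section \<open>Square integrable sections\<close>

definition measurable_section ::
  "('m::topological_space, 'e, 'z) vbundle_scheme \<Rightarrow> 'm set \<Rightarrow> ('m \<Rightarrow> 'e) \<Rightarrow> bool" where
  "measurable_section E D u \<longleftrightarrow>
     (\<forall>x\<in>D. u x \<in> fib E x) \<and>
     (\<forall>(V, \<tau>)\<in>trv E. \<forall>i<rnk E. (\<lambda>x. \<tau> x (u x) $ i) \<in> borel_measurable (restrict_space borel (V \<inter> D)))"

text \<open>Elements of \<open>L\<^sup>2(D, E)\<close> are represented by sections; equality in \<open>L\<^sup>2(D, E)\<close> is equality a.e.\<close>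

definition L2 ::
  "'m::topological_space measure \<Rightarrow> 'm set \<Rightarrow> ('m, 'e, 'z) hbundle_scheme \<Rightarrow> ('m \<Rightarrow> 'e) set" where
  "L2 dx D E = {u. measurable_section E D u \<and> set_integrable dx D (\<lambda>x. met E x (u x) (u x))}"

definition ae_eq :: "'m measure \<Rightarrow> 'm set \<Rightarrow> ('m \<Rightarrow> 'e) \<Rightarrow> ('m \<Rightarrow> 'e) \<Rightarrow> bool" where
  "ae_eq dx D u v \<longleftrightarrow> (AE x\<in>D in dx. u x = v x)"

definition ip ::
  "'m measure \<Rightarrow> 'm set \<Rightarrow> ('m, 'e, 'z) hbundle_scheme \<Rightarrow> ('m \<Rightarrow> 'e) \<Rightarrow> ('m \<Rightarrow> 'e) \<Rightarrow> complex" where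
  "ip dx D E u v = (LINT x:D|dx. met E x (u x) (v x))"

definition L2norm ::
  "'m measure \<Rightarrow> 'm set \<Rightarrow> ('m, 'e, 'z) hbundle_scheme \<Rightarrow> ('m \<Rightarrow> 'e) \<Rightarrow> real" where
  "L2norm dx D E u = sqrt (Re (ip dx D E u u))"

text \<open>
  Weak solutions of \<open>A u = 0\<close> in \<open>D\<close>, here for locally integrable sections \<open>u\<close>: \<open>(u, A\<^sup>* v) = 0\<close> for
  all \<open>v \<in> C\<^sup>\<infinity>\<close> with compact support in \<open>D\<close>. The section \<open>w = A\<^sup>* v\<close> is the one defined by
  \<open>(A \<phi>, v) = (\<phi>, w)\<close> for all smooth \<open>\<phi>\<close>.
\<close>

definition adjoint_at ::
  "('m::topological_space, 'n::finite) chart set \<Rightarrow> 'm set \<Rightarrow> 'm measure \<Rightarrow> 'm set \<Rightarrow>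
     ('m, 'e, 'y) hbundle_scheme \<Rightarrow> ('m, 'f, 'z) hbundle_scheme \<Rightarrow> (('m \<Rightarrow> 'e) \<Rightarrow> ('m \<Rightarrow> 'f)) \<Rightarrow>
     ('m \<Rightarrow> 'f) \<Rightarrow> ('m \<Rightarrow> 'e) \<Rightarrow> bool" where
  "adjoint_at \<A> X dx D E F A v w \<longleftrightarrow>
     w \<in> test_sections \<A> D E \<and>
     (\<forall>\<phi>\<in>smooth_closure_sections \<A> X D E. ip dx D F (A \<phi>) v = ip dx D E \<phi> w)"

definition weak_solutions ::
  "('m::topological_space, 'n::finite) chart set \<Rightarrow> 'm set \<Rightarrow> 'm measure \<Rightarrow> 'm set \<Rightarrow>
     ('m, 'e, 'y) hbundle_scheme \<Rightarrow> ('m, 'f, 'z) hbundle_scheme \<Rightarrow> (('m \<Rightarrow> 'e) \<Rightarrow> ('m \<Rightarrow> 'f)) \<Rightarrow>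
     ('m \<Rightarrow> 'e) set" where
  "weak_solutions \<A> X dx D E F A =
     {u. measurable_section E D u \<and>
         (\<forall>K. compact K \<and> K \<subseteq> D \<longrightarrow> set_integrable dx K (\<lambda>x. sqrt (Re (met E x (u x) (u x))))) \<and>
         (\<forall>v\<in>test_sections \<A> D F. \<forall>w. adjoint_at \<A> X dx D E F A v w \<longrightarrow> ip dx D E u w = 0)}"


section \<open>The space \<open>\<D>\<^sub>T\<close> and the Cauchy problem\<close>

definition smooth_T ::
  "('m::topological_space, 'n::finite) chart set \<Rightarrow> 'm set \<Rightarrow> 'm set \<Rightarrow> ('m, 'e, 'y) vbundle_scheme \<Rightarrow>
     nat \<Rightarrow> (nat \<Rightarrow> ('m, 'g, 'z) vbundle_scheme) \<Rightarrow> (nat \<Rightarrow> ('m \<Rightarrow> 'e) \<Rightarrow> ('m \<Rightarrow> 'g)) \<Rightarrow> 'm set \<Rightarrow>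
     ('m \<Rightarrow> 'e) set" where
  "smooth_T \<A> X D E m Fj B \<Gamma> =
     {u \<in> smooth_closure_sections \<A> X D E. \<forall>j<m. \<forall>x\<in>\<Gamma>. B j u x = fib_zero (Fj j) x}"

text \<open>
  By definition of \<open>D(\<cdot>,\<cdot>)\<close> the map \<open>u \<mapsto> (u, A u)\<close> is an isometry of the smooth sections into the Hilbert
  space \<open>L\<^sup>2(D, E) \<oplus> L\<^sup>2(D, F)\<close>. The completion is therefore the closure of its range there: an
  element of \<open>\<D>\<^sub>T\<close> is a pair, whose second component is \<open>A u\<close> (for the continuous extension of \<open>A\<close> to
  \<open>\<D>\<^sub>T\<close>) and whose first component is \<open>u\<close> as an element of \<open>L\<^sup>2(D, E)\<close>.
\<close>

definition completion_T ::
  "'m::topological_space measure \<Rightarrow> 'm set \<Rightarrow> ('m, 'e, 'y) hbundle_scheme \<Rightarrow>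
     ('m, 'f, 'z) hbundle_scheme \<Rightarrow> (('m \<Rightarrow> 'e) \<Rightarrow> ('m \<Rightarrow> 'f)) \<Rightarrow> ('m \<Rightarrow> 'e) set \<Rightarrow>
     (('m \<Rightarrow> 'e) \<times> ('m \<Rightarrow> 'f)) set" where
  "completion_T dx D E F A C =
     {(u, g). u \<in> L2 dx D E \<and> g \<in> L2 dx D F \<and>
        (\<exists>s. (\<forall>k. s k \<in> C) \<and>
           (\<lambda>k::nat. L2norm dx D E (sec_diff E (s k) u)) \<longlonglongrightarrow> 0 \<and>
           (\<lambda>k. L2norm dx D F (sec_diff F (A (s k)) g)) \<longlonglongrightarrow> 0)}"

definition Dip ::
  "'m measure \<Rightarrow> 'm set \<Rightarrow> ('m, 'e, 'y) hbundle_scheme \<Rightarrow> ('m, 'f, 'z) hbundle_scheme \<Rightarrow>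
     ('m \<Rightarrow> 'e) \<times> ('m \<Rightarrow> 'f) \<Rightarrow> ('m \<Rightarrow> 'e) \<times> ('m \<Rightarrow> 'f) \<Rightarrow> complex" where
  "Dip dx D E F u v = ip dx D E (fst u) (fst v) + ip dx D F (snd u) (snd v)"

definition Dnorm ::
  "'m measure \<Rightarrow> 'm set \<Rightarrow> ('m, 'e, 'y) hbundle_scheme \<Rightarrow> ('m, 'f, 'z) hbundle_scheme \<Rightarrow>
     ('m \<Rightarrow> 'e) \<times> ('m \<Rightarrow> 'f) \<Rightarrow> real" where
  "Dnorm dx D E F u = sqrt (Re (Dip dx D E F u u))"

definition is_u_eps ::
  "'m measure \<Rightarrow> 'm set \<Rightarrow> ('m, 'e, 'y) hbundle_scheme \<Rightarrow> ('m, 'f, 'z) hbundle_scheme \<Rightarrow>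
     (('m \<Rightarrow> 'e) \<times> ('m \<Rightarrow> 'f)) set \<Rightarrow> ('m \<Rightarrow> 'f) \<Rightarrow> real \<Rightarrow> ('m \<Rightarrow> 'e) \<times> ('m \<Rightarrow> 'f) \<Rightarrow> bool" where
  "is_u_eps dx D E F DT f \<epsilon> u \<longleftrightarrow>
     u \<in> DT \<and>
     (\<forall>v\<in>DT. ip dx D F (snd u) (snd v) + complex_of_real \<epsilon> * ip dx D E (fst u) (fst v)
              = ip dx D F f (snd v))"

definition cauchy_solution ::
  "'m measure \<Rightarrow> 'm set \<Rightarrow> (('m \<Rightarrow> 'e) \<times> ('m \<Rightarrow> 'f)) set \<Rightarrow> ('m \<Rightarrow> 'f) \<Rightarrow>
     ('m \<Rightarrow> 'e) \<times> ('m \<Rightarrow> 'f) \<Rightarrow> bool" where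
  "cauchy_solution dx D DT f u \<longleftrightarrow> u \<in> DT \<and> ae_eq dx D (snd u) f"

end

theory Submission
  imports Defs
begin

text \<open>
  The regularised problem is Tikhonov's: \<open>u\<^sub>\<epsilon>\<close> minimises \<open>\<parallel>A v - f\<parallel>\<^sup>2 + \<epsilon> \<parallel>v\<parallel>\<^sup>2\<close> over \<open>v \<in> \<D>\<^sub>T\<close>. As \<open>f\<close> can be
  approximated by \<open>A v\<close>, comparison with a fixed \<open>v\<close> gives \<open>A u\<^sub>\<epsilon> \<rightarrow> f\<close>; comparison with a solution \<open>w\<close>
  gives \<open>\<parallel>u\<^sub>\<epsilon>\<parallel> \<le> \<parallel>w\<parallel>\<close>, while \<open>\<parallel>A u\<^sub>\<epsilon>\<parallel> \<le> \<parallel>f\<parallel>\<close> in any case, so solvability implies boundedness.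
  Conversely, subtracting the equations for \<open>\<delta> < \<epsilon>\<close> and testing with \<open>u\<^sub>\<delta> - u\<^sub>\<epsilon>\<close> shows
  \<open>\<parallel>u\<^sub>\<delta> - u\<^sub>\<epsilon>\<parallel>\<^sup>2 \<le> \<parallel>u\<^sub>\<delta>\<parallel>\<^sup>2 - \<parallel>u\<^sub>\<epsilon>\<parallel>\<^sup>2\<close> (\<open>u_dif_square_le\<close>): the norms grow as \<open>\<epsilon>\<close> decreases, and once
  they are bounded, the \<open>u\<^sub>\<epsilon>\<close> form a Cauchy family. Its limit \<open>a\<close> exists because \<open>L\<^sup>2(D, E)\<close> is complete
  (\<open>L2_complete\<close>), and \<open>(a, f) \<in> \<D>\<^sub>T\<close> because \<open>\<D>\<^sub>T\<close> is closed (\<open>DT_closed\<close>). Testing the equation with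
  \<open>v\<close> such that \<open>A v = 0\<close> shows that every \<open>u\<^sub>\<epsilon>\<close>, hence also \<open>a\<close>, is orthogonal to \<open>v\<close>. So \<open>u\<^sub>\<epsilon>\<close> converges
  even in norm, which implies the weak convergence.

  It remains to identify \<open>\<D>\<^sub>T \<inter> \<S>\<^sub>A(D)\<close> with the kernel of \<open>A\<close> in \<open>\<D>\<^sub>T\<close> (\<open>weak_solution_iff\<close>). The pairing
  \<open>(A u, g) = (u, A\<^sup>* g)\<close> extends from smooth \<open>u\<close> to \<open>\<D>\<^sub>T\<close>, so elements of the kernel are weak solutions.
  The converse requires test sections \<open>g\<close> for which \<open>A\<^sup>* g\<close> exists. These are supplied by integration by
  parts in a chart (\<open>local_formal_adjoint\<close>). Let \<open>u \<in> \<D>\<^sub>T\<close> be a weak solution. If \<open>s\<^sub>k\<close> are smooth with \<open>s\<^sub>k \<rightarrow> u\<close> and \<open>A s\<^sub>k \<rightarrow> A u\<close>, and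
  \<open>\<chi>\<close> is a bump function, then \<open>g = \<chi> A s\<^sub>k\<close> is such a section, and \<open>(A u, \<chi> A s\<^sub>k) = 0\<close> tends to
  \<open>(A u, \<chi> A u) = 0\<close>; hence \<open>A u\<close> vanishes where \<open>\<chi> > 0\<close>.
\<close>

section \<open>Tikhonov regularisation\<close>

text \<open>
  Sections of a bundle are subtracted fibre by fibre, and regularisation is a matter of differences
  alone. The axioms below therefore describe a semi-inner product space by its differences; the Cauchy-Schwarz inequality, whose usual proof needs scalar multiples, is an axiom. Elements
  at distance zero need not be equal.
\<close>

locale difference_space =
  fixes V :: "'a set" and dif :: "'a \<Rightarrow> 'a \<Rightarrow> 'a" and inn :: "'a \<Rightarrow> 'a \<Rightarrow> complex"
  assumes dif_closed: "x \<in> V \<Longrightarrow> y \<in> V \<Longrightarrow> dif x y \<in> V"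
    and inn_dif: "x \<in> V \<Longrightarrow> y \<in> V \<Longrightarrow> z \<in> V \<Longrightarrow> inn (dif x y) z = inn x z - inn y z"
    and inn_sym: "x \<in> V \<Longrightarrow> y \<in> V \<Longrightarrow> inn y x = cnj (inn x y)"
    and inn_nonneg: "x \<in> V \<Longrightarrow> 0 \<le> Re (inn x x)"
    and Cauchy_Schwarz:
      "x \<in> V \<Longrightarrow> y \<in> V \<Longrightarrow> cmod (inn x y) \<le> sqrt (Re (inn x x)) * sqrt (Re (inn y y))"
begin

definition nrm :: "'a \<Rightarrow> real" where "nrm x = sqrt (Re (inn x x))"

lemma nrm_nonneg: "x \<in> V \<Longrightarrow> 0 \<le> nrm x"
  by (simp add: nrm_def inn_nonneg)

lemma nrm_square: "x \<in> V \<Longrightarrow> (nrm x)\<^sup>2 = Re (inn x x)"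
  by (simp add: nrm_def inn_nonneg)

lemma inn_dif_right: "x \<in> V \<Longrightarrow> y \<in> V \<Longrightarrow> z \<in> V \<Longrightarrow> inn z (dif x y) = inn z x - inn z y"
  by (metis complex_cnj_diff dif_closed inn_dif inn_sym)

lemma inn_le: "x \<in> V \<Longrightarrow> y \<in> V \<Longrightarrow> cmod (inn x y) \<le> nrm x * nrm y"
  by (simp add: nrm_def Cauchy_Schwarz)

lemma Re_inn_commute: "x \<in> V \<Longrightarrow> y \<in> V \<Longrightarrow> Re (inn y x) = Re (inn x y)"
  by (simp add: inn_sym[of x y])

lemma nrm_dif_square:
  "x \<in> V \<Longrightarrow> y \<in> V \<Longrightarrow> (nrm (dif x y))\<^sup>2 = (nrm x)\<^sup>2 - 2 * Re (inn x y) + (nrm y)\<^sup>2"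
  by (simp add: nrm_square dif_closed inn_dif inn_dif_right Re_inn_commute[of x y])

lemma nrm_dif_commute: "x \<in> V \<Longrightarrow> y \<in> V \<Longrightarrow> nrm (dif x y) = nrm (dif y x)"
  by (rule power2_eq_imp_eq)
    (simp_all add: nrm_dif_square Re_inn_commute[of x y] dif_closed nrm_nonneg)

lemma nrm_triangle:
  assumes "x \<in> V" "y \<in> V" "z \<in> V"
  shows "nrm (dif x z) \<le> nrm (dif x y) + nrm (dif y z)"
proof (rule power2_le_imp_le)
  let ?a = "dif x y" and ?b = "dif y z"
  have ab: "?a \<in> V" "?b \<in> V" using assms dif_closed by auto
  have "(nrm (dif x z))\<^sup>2 = (nrm ?a)\<^sup>2 + 2 * Re (inn ?a ?b) + (nrm ?b)\<^sup>2"
    using assms by (simp add: nrm_square dif_closed inn_dif inn_dif_right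
        Re_inn_commute[of x y] Re_inn_commute[of x z] Re_inn_commute[of y z])
  also have "Re (inn ?a ?b) \<le> nrm ?a * nrm ?b"
    using inn_le[OF ab] complex_Re_le_cmod order_trans by blast
  finally show "(nrm (dif x z))\<^sup>2 \<le> (nrm ?a + nrm ?b)\<^sup>2" by (simp add: power2_sum)
  show "0 \<le> nrm ?a + nrm ?b" using ab nrm_nonneg by simp
qed

lemma nrm_dif_self: "x \<in> V \<Longrightarrow> nrm (dif x x) = 0"
  by (simp add: nrm_def dif_closed inn_dif)

lemma nrm_dif_le: "x \<in> V \<Longrightarrow> y \<in> V \<Longrightarrow> nrm (dif x y) \<le> nrm x + nrm y"
proof (rule power2_le_imp_le)
  assume xy: "x \<in> V" "y \<in> V"
  have "- Re (inn x y) \<le> nrm x * nrm y"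
    using inn_le[OF xy] abs_Re_le_cmod[of "inn x y"] by linarith
  then show "(nrm (dif x y))\<^sup>2 \<le> (nrm x + nrm y)\<^sup>2" by (simp add: nrm_dif_square[OF xy] power2_sum)
  show "0 \<le> nrm x + nrm y" using xy nrm_nonneg by simp
qed

lemma nrm_dif_dif_le:
  assumes "a \<in> V" "b \<in> V" "c \<in> V" "d \<in> V"
  shows "nrm (dif (dif a b) (dif c d)) \<le> nrm (dif a c) + nrm (dif b d)"
proof -
  have "nrm (dif (dif a b) (dif c d)) = nrm (dif (dif a c) (dif b d))"
    using assms by (simp add: nrm_def dif_closed inn_dif inn_dif_right)
  also have "\<dots> \<le> nrm (dif a c) + nrm (dif b d)" by (intro nrm_dif_le dif_closed assms)
  finally show ?thesis .
qed

lemma tendsto_inn: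
  assumes "\<forall>\<^sub>F i in G. s i \<in> V" "a \<in> V" "((\<lambda>i. nrm (dif (s i) a)) \<longlongrightarrow> 0) G" "z \<in> V"
  shows "((\<lambda>i. inn (s i) z) \<longlongrightarrow> inn a z) G"
proof -
  have "((\<lambda>i. inn (s i) z - inn a z) \<longlongrightarrow> 0) G"
  proof (rule tendsto_0_le[where K = "nrm z"])
    show "((\<lambda>i. nrm (dif (s i) a)) \<longlongrightarrow> 0) G" by fact
    show "\<forall>\<^sub>F i in G. cmod (inn (s i) z - inn a z) \<le> norm (nrm (dif (s i) a)) * nrm z"
      using assms(1)
    proof eventually_elim
      case (elim i)
      then show ?case
        using inn_le[OF dif_closed[OF elim assms(2)] assms(4)] nrm_nonneg[OF dif_closed[OF elim assms(2)]]
        by (simp add: inn_dif assms(2,4))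
    qed
  qed
  then show ?thesis by (simp add: LIM_zero_iff)
qed

end

text \<open>
  A closed subspace \<open>G\<close> of the product of two such spaces, to be thought of as the graph of a closed
  operator \<open>A\<close>, and a right-hand side \<open>f\<close> in the closure of the range of \<open>A\<close>. The regularised
  solutions \<open>u \<epsilon>\<close> minimise \<open>\<parallel>A v - f\<parallel>\<^sup>2 + \<epsilon> \<parallel>v\<parallel>\<^sup>2\<close>.
\<close>

locale tikhonov = dom: difference_space V dif inn + ran: difference_space W dif' inn'
  for V :: "'a set" and dif inn and W :: "'b set" and dif' inn' +
  fixes G :: "('a \<times> 'b) set" and f :: 'b and u :: "real \<Rightarrow> 'a \<times> 'b"
  assumes complete: "\<And>s. (\<And>k. s k \<in> V) \<Longrightarrow>
      (\<And>e. e > 0 \<Longrightarrow> \<exists>N. \<forall>m\<ge>N. \<forall>n\<ge>N. dom.nrm (dif (s m) (s n)) < e) \<Longrightarrow>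
      \<exists>l\<in>V. (\<lambda>k::nat. dom.nrm (dif (s k) l)) \<longlonglongrightarrow> 0"
    and G_sub: "G \<subseteq> V \<times> W"
    and G_dif: "v \<in> G \<Longrightarrow> w \<in> G \<Longrightarrow> (dif (fst v) (fst w), dif' (snd v) (snd w)) \<in> G"
    and G_closed: "\<And>s a b. (\<And>k::nat. s k \<in> G) \<Longrightarrow> a \<in> V \<Longrightarrow> b \<in> W \<Longrightarrow>
      (\<lambda>k. dom.nrm (dif (fst (s k)) a)) \<longlonglongrightarrow> 0 \<Longrightarrow> (\<lambda>k. ran.nrm (dif' (snd (s k)) b)) \<longlonglongrightarrow> 0 \<Longrightarrow>
      (a, b) \<in> G"
    and f_W: "f \<in> W"
    and f_closure: "\<delta> > 0 \<Longrightarrow> \<exists>v\<in>G. ran.nrm (dif' (snd v) f) < \<delta>"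
    and u_G: "\<epsilon> > 0 \<Longrightarrow> u \<epsilon> \<in> G"
    and u_eq: "\<epsilon> > 0 \<Longrightarrow> v \<in> G \<Longrightarrow>
      inn' (snd (u \<epsilon>)) (snd v) + complex_of_real \<epsilon> * inn (fst (u \<epsilon>)) (fst v) = inn' f (snd v)"
begin

lemma G_fst: "v \<in> G \<Longrightarrow> fst v \<in> V" and G_snd: "v \<in> G \<Longrightarrow> snd v \<in> W"
  using G_sub by auto

text \<open>
  By the variational equation, the right-hand side exceeds the left-hand side by
  \<open>\<parallel>A v - A u\<^sub>\<epsilon>\<parallel>\<^sup>2 + \<epsilon> \<parallel>v - u\<^sub>\<epsilon>\<parallel>\<^sup>2\<close>.
\<close>

lemma u_minimises:
  assumes \<epsilon>: "\<epsilon> > 0" and v: "v \<in> G"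
  shows "(ran.nrm (dif' (snd (u \<epsilon>)) f))\<^sup>2 + \<epsilon> * (dom.nrm (fst (u \<epsilon>)))\<^sup>2
    \<le> (ran.nrm (dif' (snd v) f))\<^sup>2 + \<epsilon> * (dom.nrm (fst v))\<^sup>2"
proof -
  note uG = u_G[OF \<epsilon>]
  note mem = G_fst[OF uG] G_snd[OF uG] G_fst[OF v] G_snd[OF v] f_W
  have e1: "Re (inn' (snd (u \<epsilon>)) (snd v)) + \<epsilon> * Re (inn (fst (u \<epsilon>)) (fst v)) = Re (inn' f (snd v))"
    using arg_cong[OF u_eq[OF \<epsilon> v], of Re] by simp
  have e2: "Re (inn' (snd (u \<epsilon>)) (snd (u \<epsilon>))) + \<epsilon> * Re (inn (fst (u \<epsilon>)) (fst (u \<epsilon>))) = Re (inn' f (snd (u \<epsilon>)))"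
    using arg_cong[OF u_eq[OF \<epsilon> uG], of Re] by simp
  have "0 \<le> (ran.nrm (dif' (snd v) (snd (u \<epsilon>))))\<^sup>2 + \<epsilon> * (dom.nrm (dif (fst v) (fst (u \<epsilon>))))\<^sup>2"
    using \<epsilon> by simp
  then show ?thesis
    using e1 e2 ran.Re_inn_commute[of f "snd v"] ran.Re_inn_commute[of f "snd (u \<epsilon>)"]
      ran.Re_inn_commute[of "snd (u \<epsilon>)" "snd v"] dom.Re_inn_commute[of "fst (u \<epsilon>)" "fst v"] mem
    by (simp add: ran.nrm_dif_square dom.nrm_dif_square ran.nrm_square dom.nrm_square algebra_simps)
qed

lemma residual_tendsto_0: "((\<lambda>\<epsilon>. ran.nrm (dif' (snd (u \<epsilon>)) f)) \<longlongrightarrow> 0) (at_right 0)"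
proof (rule tendstoI)
  fix e :: real assume e: "e > 0"
  obtain v where v: "v \<in> G" "ran.nrm (dif' (snd v) f) < e / 2"
    using f_closure[of "e / 2"] e by auto
  let ?N = "(dom.nrm (fst v))\<^sup>2"
  \<comment> \<open>For \<open>\<epsilon> < d\<close> the penalty \<open>\<epsilon> \<parallel>v\<parallel>\<^sup>2\<close> stays below \<open>(e / 2)\<^sup>2\<close>; the summand \<open>1\<close> allows for \<open>v = 0\<close>.\<close>
  define d where "d = (e / 2)\<^sup>2 / (?N + 1)"
  have "?N + 1 > 0" by (rule add_nonneg_pos) auto
  then have d: "d > 0" using e unfolding d_def by simp
  have "\<forall>\<^sub>F \<epsilon> in at_right 0. \<epsilon> < d \<and> \<epsilon> > 0"
    using d eventually_at_right_less[of "0::real"] by (auto simp: eventually_at_right_field intro!: exI[of _ d])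
  then show "\<forall>\<^sub>F \<epsilon> in at_right 0. dist (ran.nrm (dif' (snd (u \<epsilon>)) f)) 0 < e"
  proof eventually_elim
    case (elim \<epsilon>)
    then have \<epsilon>: "\<epsilon> > 0" by simp
    let ?n = "ran.nrm (dif' (snd (u \<epsilon>)) f)"
    have n0: "0 \<le> ?n" "0 \<le> ran.nrm (dif' (snd v) f)"
      using u_G[OF \<epsilon>] v(1) by (auto intro!: ran.nrm_nonneg ran.dif_closed G_snd f_W)
    have "?n\<^sup>2 \<le> ?n\<^sup>2 + \<epsilon> * (dom.nrm (fst (u \<epsilon>)))\<^sup>2" using \<epsilon> by simp
    also have "\<dots> \<le> (ran.nrm (dif' (snd v) f))\<^sup>2 + \<epsilon> * ?N" by (rule u_minimises[OF \<epsilon> v(1)])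
    also have "\<dots> < (e / 2)\<^sup>2 + (e / 2)\<^sup>2"
    proof (rule add_strict_mono)
      show "(ran.nrm (dif' (snd v) f))\<^sup>2 < (e / 2)\<^sup>2" using v(2) n0 by (intro power_strict_mono) auto
      have "\<epsilon> * ?N \<le> \<epsilon> * (?N + 1)" using \<epsilon> by simp
      also have "\<dots> < d * (?N + 1)" using elim \<open>?N + 1 > 0\<close> by (intro mult_strict_right_mono) auto
      finally show "\<epsilon> * ?N < (e / 2)\<^sup>2" using \<open>?N + 1 > 0\<close> by (simp add: d_def)
    qed
    also have "\<dots> \<le> e\<^sup>2" by (simp add: power2_eq_square)
    finally have "?n < e" using e power2_less_imp_less by (metis less_imp_le)
    then show ?case using n0 by simp
  qed
qed

lemma u_bounded_by_solution:
  assumes w: "w \<in> G" "ran.nrm (dif' (snd w) f) = 0" and \<epsilon>: "\<epsilon> > 0"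
  shows "dom.nrm (fst (u \<epsilon>)) \<le> dom.nrm (fst w)"
proof -
  have "\<epsilon> * (dom.nrm (fst (u \<epsilon>)))\<^sup>2 \<le> (ran.nrm (dif' (snd (u \<epsilon>)) f))\<^sup>2 + \<epsilon> * (dom.nrm (fst (u \<epsilon>)))\<^sup>2"
    by simp
  also have "\<dots> \<le> \<epsilon> * (dom.nrm (fst w))\<^sup>2"
    using u_minimises[OF \<epsilon> w(1)] w(2) by simp
  finally show ?thesis
    using \<epsilon> power2_le_imp_le[OF _ dom.nrm_nonneg[OF G_fst[OF w(1)]]] by simp
qed

text \<open>
  The equation tested with \<open>u\<^sub>\<epsilon>\<close> itself gives \<open>\<parallel>A u\<^sub>\<epsilon>\<parallel>\<^sup>2 \<le> Re (f, A u\<^sub>\<epsilon>)\<close>.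
\<close>

lemma image_bounded:
  assumes \<epsilon>: "\<epsilon> > 0"
  shows "ran.nrm (snd (u \<epsilon>)) \<le> ran.nrm f"
proof -
  note uG = u_G[OF \<epsilon>]
  let ?g = "snd (u \<epsilon>)"
  have g: "?g \<in> W" using G_snd uG by simp
  have "(ran.nrm ?g)\<^sup>2 \<le> (ran.nrm ?g)\<^sup>2 + \<epsilon> * (dom.nrm (fst (u \<epsilon>)))\<^sup>2" using \<epsilon> by simp
  also have "\<dots> = Re (inn' f ?g)"
    using arg_cong[OF u_eq[OF \<epsilon> uG], of Re] G_fst[OF uG] g
    by (simp add: ran.nrm_square dom.nrm_square)
  also have "\<dots> \<le> ran.nrm f * ran.nrm ?g"
    using ran.inn_le[OF f_W g] complex_Re_le_cmod order_trans by blast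
  finally have "ran.nrm ?g * ran.nrm ?g \<le> ran.nrm f * ran.nrm ?g" by (simp add: power2_eq_square)
  then show ?thesis
    using ran.nrm_nonneg[OF g] ran.nrm_nonneg[OF f_W]
    by (cases "ran.nrm ?g = 0") (auto dest: mult_right_le_imp_le)
qed

lemma u_orthogonal:
  assumes v: "v \<in> G" "ran.nrm (snd v) = 0" and \<epsilon>: "\<epsilon> > 0"
  shows "inn (fst (u \<epsilon>)) (fst v) = 0"
proof -
  note uG = u_G[OF \<epsilon>]
  have z: "inn' x (snd v) = 0" if "x \<in> W" for x
    using ran.inn_le[OF that G_snd[OF v(1)]] v(2) by simp
  show ?thesis using u_eq[OF \<epsilon> v(1)] z[OF f_W] z[OF G_snd[OF uG]] \<epsilon> by simp
qed

text \<open>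
  With \<open>d = u\<^sub>\<delta> - u\<^sub>\<epsilon>\<close>, the difference of the two equations tested with \<open>d\<close> reads
  \<open>\<parallel>A d\<parallel>\<^sup>2 + \<delta> \<parallel>d\<parallel>\<^sup>2 = (\<epsilon> - \<delta>) Re (u\<^sub>\<epsilon>, d)\<close>. So \<open>Re (u\<^sub>\<epsilon>, d) \<ge> 0\<close>, and the claim is
  \<open>\<parallel>u\<^sub>\<delta>\<parallel>\<^sup>2 = \<parallel>u\<^sub>\<epsilon>\<parallel>\<^sup>2 + 2 Re (u\<^sub>\<epsilon>, d) + \<parallel>d\<parallel>\<^sup>2\<close>.
\<close>

lemma u_dif_square_le:
  assumes "0 < \<delta>" "\<delta> \<le> \<epsilon>"
  shows "(dom.nrm (dif (fst (u \<delta>)) (fst (u \<epsilon>))))\<^sup>2 \<le> (dom.nrm (fst (u \<delta>)))\<^sup>2 - (dom.nrm (fst (u \<epsilon>)))\<^sup>2"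
proof (cases "\<delta> = \<epsilon>")
  case True
  then show ?thesis using dom.nrm_dif_self G_fst[OF u_G[of \<epsilon>]] assms by simp
next
  case False
  define d where "d = (dif (fst (u \<delta>)) (fst (u \<epsilon>)), dif' (snd (u \<delta>)) (snd (u \<epsilon>)))"
  have uG: "u \<delta> \<in> G" "u \<epsilon> \<in> G" using assms u_G by auto
  then have d: "d \<in> G" unfolding d_def by (rule G_dif)
  note mem = uG[THEN G_fst] uG[THEN G_snd] G_fst[OF d] G_snd[OF d]
  have 1: "Re (inn' (snd (u \<delta>)) (snd d)) + \<delta> * Re (inn (fst (u \<delta>)) (fst d)) = Re (inn' f (snd d))"
    using arg_cong[OF u_eq[OF assms(1) d], of Re] by simp
  have 2: "Re (inn' (snd (u \<epsilon>)) (snd d)) + \<epsilon> * Re (inn (fst (u \<epsilon>)) (fst d)) = Re (inn' f (snd d))"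
    using arg_cong[OF u_eq[of \<epsilon>, OF _ d], of Re] assms by simp
  have sq1: "(dom.nrm (fst d))\<^sup>2 = Re (inn (fst (u \<delta>)) (fst d)) - Re (inn (fst (u \<epsilon>)) (fst d))"
    using mem by (simp add: dom.nrm_square) (simp add: d_def dom.inn_dif)
  have sq2: "(ran.nrm (snd d))\<^sup>2 = Re (inn' (snd (u \<delta>)) (snd d)) - Re (inn' (snd (u \<epsilon>)) (snd d))"
    using mem by (simp add: ran.nrm_square) (simp add: d_def ran.inn_dif)
  have "(ran.nrm (snd d))\<^sup>2 + \<delta> * (dom.nrm (fst d))\<^sup>2 = (\<epsilon> - \<delta>) * Re (inn (fst (u \<epsilon>)) (fst d))"
    using 1 2 unfolding sq1 sq2 by (simp add: algebra_simps)
  moreover have "0 \<le> (ran.nrm (snd d))\<^sup>2 + \<delta> * (dom.nrm (fst d))\<^sup>2" using assms by simp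
  ultimately have "0 \<le> (\<epsilon> - \<delta>) * Re (inn (fst (u \<epsilon>)) (fst d))" by simp
  then have pos: "0 \<le> Re (inn (fst (u \<epsilon>)) (fst d))"
    using assms False by (simp add: zero_le_mult_iff)
  have "fst d = dif (fst (u \<delta>)) (fst (u \<epsilon>))" by (simp add: d_def)
  then show ?thesis
    using pos mem(1,2) dom.Re_inn_commute[of "fst (u \<delta>)" "fst (u \<epsilon>)"]
    by (simp add: dom.nrm_dif_square dom.inn_dif_right dom.nrm_square)
qed

text \<open>
  Along \<open>\<epsilon> = 1, 1/2, 1/3, \<dots>\<close> the squared norms increase to a limit \<open>L\<close>, so by the previous lemma the
  \<open>u\<^sub>\<epsilon>\<close> form a Cauchy sequence. All \<open>\<parallel>u\<^sub>\<epsilon>\<parallel>\<^sup>2\<close> are at most \<open>L\<close>, so the same estimate, applied to \<open>\<epsilon>\<close> and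
  a large member of the sequence, carries the convergence over to the whole family.
\<close>

theorem regularised_converges:
  assumes bound: "\<And>\<epsilon>. \<epsilon> > 0 \<Longrightarrow> dom.nrm (fst (u \<epsilon>)) \<le> C"
  obtains a where "a \<in> V" "(a, f) \<in> G" "((\<lambda>\<epsilon>. dom.nrm (dif (fst (u \<epsilon>)) a)) \<longlongrightarrow> 0) (at_right 0)"
    "\<And>v. v \<in> G \<Longrightarrow> ran.nrm (snd v) = 0 \<Longrightarrow> inn a (fst v) = 0"
proof -
  define t where "t n = 1 / real (Suc n)" for n
  have t: "0 < t n" for n by (simp add: t_def)
  have tmono: "t n \<le> t m" if "m \<le> n" for m n using that by (simp add: t_def field_simps)
  have t0: "t \<longlonglongrightarrow> 0" unfolding t_def using LIMSEQ_inverse_real_of_nat by (simp add: inverse_eq_divide)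
  have tr: "filterlim t (at_right 0) sequentially"
    using t0 t by (auto simp: filterlim_at less_imp_neq[THEN not_sym])
  define s where "s n = fst (u (t n))" for n
  define N where "N n = (dom.nrm (s n))\<^sup>2" for n
  have sV: "s n \<in> V" for n unfolding s_def by (rule G_fst[OF u_G[OF t]])
  have le: "(dom.nrm (dif (s n) (s m)))\<^sup>2 \<le> N n - N m" if "m \<le> n" for m n
    unfolding s_def N_def by (rule u_dif_square_le[OF t tmono[OF that]])
  have "incseq N"
    unfolding incseq_def using le by (metis diff_ge_0_iff_ge order_trans zero_le_power2)
  moreover have "N n \<le> C\<^sup>2" for n
    unfolding N_def s_def using bound[OF t] dom.nrm_nonneg[OF sV, unfolded s_def]
    by (intro power_mono) auto
  ultimately obtain L where L: "N \<longlonglongrightarrow> L" "\<And>n. N n \<le> L"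
    using incseq_convergent[of N "C\<^sup>2"] by blast
  have "\<exists>l\<in>V. (\<lambda>k. dom.nrm (dif (s k) l)) \<longlonglongrightarrow> 0"
  proof (rule complete[OF sV])
    fix e :: real assume e: "e > 0"
    then obtain M where "\<forall>n\<ge>M. norm (N n - L) < e\<^sup>2"
      using LIMSEQ_D[OF L(1), of "e\<^sup>2"] by auto
    then have M: "L - N n < e\<^sup>2" if "n \<ge> M" for n using that by (force simp: abs_less_iff)
    have *: "dom.nrm (dif (s n) (s m)) < e" if "M \<le> m" "m \<le> n" for m n
    proof -
      have "(dom.nrm (dif (s n) (s m)))\<^sup>2 < e\<^sup>2" using le[OF that(2)] M[OF that(1)] L(2)[of n] by simp
      then show ?thesis using e power2_less_imp_less by (metis less_imp_le)
    qed
    have "dom.nrm (dif (s m) (s n)) < e" if "m \<ge> M" "n \<ge> M" for m n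
      using *[of m n] *[of n m] that dom.nrm_dif_commute[OF sV sV, of m n] by (cases "m \<le> n") auto
    then show "\<exists>M. \<forall>m\<ge>M. \<forall>n\<ge>M. dom.nrm (dif (s m) (s n)) < e" by blast
  qed
  then obtain a where a: "a \<in> V" "(\<lambda>k. dom.nrm (dif (s k) a)) \<longlonglongrightarrow> 0" by blast
  have aG: "(a, f) \<in> G"
  proof (rule G_closed)
    show "u (t k) \<in> G" for k by (rule u_G[OF t])
    show "(\<lambda>k. dom.nrm (dif (fst (u (t k))) a)) \<longlonglongrightarrow> 0" using a(2) by (simp add: s_def)
    show "(\<lambda>k. ran.nrm (dif' (snd (u (t k))) f)) \<longlonglongrightarrow> 0"
      by (rule filterlim_compose[OF residual_tendsto_0 tr])
  qed (use a f_W in auto)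
  have NL: "(dom.nrm (fst (u \<epsilon>)))\<^sup>2 \<le> L" if "\<epsilon> > 0" for \<epsilon>
  proof -
    obtain n where "t n < \<epsilon>" using \<open>\<epsilon> > 0\<close> t0 t by (metis LIMSEQ_D abs_of_pos diff_zero order_refl real_norm_def)
    then have "0 \<le> N n - (dom.nrm (fst (u \<epsilon>)))\<^sup>2"
      using u_dif_square_le[OF t, of n \<epsilon>] unfolding N_def s_def by (smt (verit) zero_le_power2)
    then show ?thesis using L(2)[of n] by simp
  qed
  have conv: "((\<lambda>\<epsilon>. dom.nrm (dif (fst (u \<epsilon>)) a)) \<longlongrightarrow> 0) (at_right 0)"
  proof (rule tendstoI)
    fix e :: real assume e: "e > 0"
    have "\<forall>\<^sub>F k in sequentially. dom.nrm (dif (s k) a) < e / 2"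
      using a(2) e by (intro order_tendstoD) auto
    moreover have "\<forall>\<^sub>F k in sequentially. L - (e / 2)\<^sup>2 < N k"
      using L(1) e by (intro order_tendstoD) auto
    ultimately obtain k where k: "dom.nrm (dif (s k) a) < e / 2" "L - (e / 2)\<^sup>2 < N k"
      by (metis (mono_tags, lifting) eventually_conj eventually_happens' sequentially_bot)
    have "\<forall>\<^sub>F \<epsilon> in at_right 0. \<epsilon> < t k \<and> \<epsilon> > 0"
      using t by (auto simp: eventually_at_right_field intro!: exI[of _ "t k"])
    then show "\<forall>\<^sub>F \<epsilon> in at_right 0. dist (dom.nrm (dif (fst (u \<epsilon>)) a)) 0 < e"
    proof eventually_elim
      case (elim \<epsilon>)
      then have uV: "fst (u \<epsilon>) \<in> V" using u_G G_fst by simp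
      have "(dom.nrm (dif (fst (u \<epsilon>)) (s k)))\<^sup>2 \<le> (dom.nrm (fst (u \<epsilon>)))\<^sup>2 - N k"
        unfolding N_def s_def using elim by (intro u_dif_square_le) auto
      also have "\<dots> < (e / 2)\<^sup>2" using NL[of \<epsilon>] elim k(2) by simp
      finally have "dom.nrm (dif (fst (u \<epsilon>)) (s k)) < e / 2"
        using e power2_less_imp_less[of _ "e / 2"] by simp
      then have "dom.nrm (dif (fst (u \<epsilon>)) a) < e"
        using dom.nrm_triangle[OF uV sV[of k] a(1)] k(1) by simp
      then show ?case using dom.nrm_nonneg[OF dom.dif_closed[OF uV a(1)]] by simp
    qed
  qed
  have orth: "inn a (fst v) = 0" if v: "v \<in> G" "ran.nrm (snd v) = 0" for v
  proof -
    have "(\<lambda>k. inn (s k) (fst v)) \<longlonglongrightarrow> inn a (fst v)"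
      by (rule dom.tendsto_inn[OF _ a G_fst[OF v(1)]]) (simp add: sV)
    moreover have "inn (s k) (fst v) = 0" for k unfolding s_def by (rule u_orthogonal[OF v t])
    ultimately show ?thesis by (simp add: LIMSEQ_const_iff)
  qed
  show ?thesis using that[OF a(1) aG conv orth] .
qed

end

section \<open>Smooth functions on open subsets of Euclidean space\<close>

lemma pderiv_dir_eq:
  assumes "(f has_derivative f') (at x)"
  shows "pderiv_dir i f x = f' (axis i 1)"
  using frechet_derivative_at[OF assms] by (simp add: pderiv_dir_def)

lemma frechet_derivative_axis: "frechet_derivative f (at x) (axis i 1) = pderiv_dir i f x"
  by (simp add: pderiv_dir_def)

lemma Ck_on_has_derivative:
  "Ck_on (Suc k) S f \<Longrightarrow> x \<in> S \<Longrightarrow> (f has_derivative frechet_derivative f (at x)) (at x)"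
  using frechet_derivative_works by auto

lemma pderiv_dir_cong:
  assumes "open S" "x \<in> S" "\<And>y. y \<in> S \<Longrightarrow> f y = g y" "f differentiable (at x)"
  shows "pderiv_dir i f x = pderiv_dir i g x"
proof -
  have "(f has_derivative frechet_derivative f (at x)) (at x)"
    using assms(4) frechet_derivative_works by blast
  moreover from this have "(g has_derivative frechet_derivative f (at x)) (at x)"
    by (rule has_derivative_transform_within_open[OF _ assms(1,2)]) (use assms(3) in auto)
  ultimately show ?thesis by (simp add: pderiv_dir_eq)
qed

lemma Ck_on_subset: "Ck_on k S f \<Longrightarrow> T \<subseteq> S \<Longrightarrow> Ck_on k T f"
  by (induction k arbitrary: f) (auto intro: continuous_on_subset)

lemma Ck_on_cong:
  assumes "open S" "\<And>y. y \<in> S \<Longrightarrow> f y = g y" "Ck_on k S f"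
  shows "Ck_on k S g"
  using assms(2,3)
proof (induction k arbitrary: f g)
  case 0
  then show ?case by (simp cong: continuous_on_cong)
next
  case (Suc k)
  have d: "f differentiable (at x)" if "x \<in> S" for x using Suc.prems(2) that by simp
  have "g differentiable (at x)" if "x \<in> S" for x
    using d[OF that] has_derivative_transform_within_open[OF _ assms(1) that] Suc.prems(1)
    unfolding differentiable_def by blast
  moreover have "Ck_on k S (pderiv_dir i g)" for i
  proof (rule Suc.IH)
    show "pderiv_dir i f y = pderiv_dir i g y" if "y \<in> S" for y
      using pderiv_dir_cong[OF assms(1) that Suc.prems(1) d[OF that]] .
    show "Ck_on k S (pderiv_dir i f)" using Suc.prems(2) by simp
  qed
  ultimately show ?case by simp
qed

lemma Ck_on_continuous: "Ck_on k S f \<Longrightarrow> continuous_on S f"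
  by (cases k) (auto intro!: differentiable_imp_continuous_on differentiable_at_imp_differentiable_on)

lemma Ck_on_Suc_imp: "Ck_on (Suc k) S f \<Longrightarrow> Ck_on k S f"
proof (induction k arbitrary: f)
  case 0
  then show ?case using Ck_on_continuous by (metis Ck_on.simps(1))
next
  case (Suc k)
  then show ?case by simp
qed

lemma Ck_on_local:
  assumes "\<And>x. x \<in> S \<Longrightarrow> \<exists>T. open T \<and> x \<in> T \<and> Ck_on k T f"
  shows "Ck_on k S f"
  using assms
proof (induction k arbitrary: f)
  case 0
  show ?case
    unfolding Ck_on.simps
  proof (rule continuous_at_imp_continuous_on, rule ballI)
    fix x assume "x \<in> S"
    then obtain T where "open T" "x \<in> T" "continuous_on T f" using 0 by force
    then show "isCont f x" using continuous_on_eq_continuous_at by blast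
  qed
next
  case (Suc k)
  have "f differentiable (at x)" if "x \<in> S" for x using Suc.prems[OF that] by auto
  moreover have "Ck_on k S (pderiv_dir i f)" for i
    by (rule Suc.IH) (use Suc.prems in force)
  ultimately show ?case by simp
qed

lemma Ck_on_bounded_linear:
  assumes "bounded_linear L" "open S" "Ck_on k S f"
  shows "Ck_on k S (\<lambda>x. L (f x))"
  using assms(3)
proof (induction k arbitrary: f)
  case 0
  then show ?case by (simp add: bounded_linear.continuous_on[OF assms(1)])
next
  case (Suc k)
  have D: "((\<lambda>x. L (f x)) has_derivative (\<lambda>h. L (frechet_derivative f (at x) h))) (at x)"
    if "x \<in> S" for x
    by (rule bounded_linear.has_derivative[OF assms(1) Ck_on_has_derivative[OF Suc.prems that]])
  have "Ck_on k S (pderiv_dir i (\<lambda>x. L (f x)))" for i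
    by (rule Ck_on_cong[OF assms(2) _ Suc.IH[of "pderiv_dir i f"]])
      (use Suc.prems in \<open>auto simp: pderiv_dir_eq[OF D] frechet_derivative_axis\<close>)
  then show ?case using D by (auto simp: differentiable_def)
qed

lemma Ck_on_const: "Ck_on k S (\<lambda>x. c)"
proof (induction k arbitrary: c)
  case (Suc k)
  have "pderiv_dir i (\<lambda>x. c) = (\<lambda>x. 0)" for i :: 'a
    by (rule ext, rule pderiv_dir_eq[OF has_derivative_const])
  then show ?case using Suc by simp
qed simp

lemma Ck_on_add:
  assumes "open S" "Ck_on k S f" "Ck_on k S g"
  shows "Ck_on k S (\<lambda>x. f x + g x)"
  using assms(2,3)
proof (induction k arbitrary: f g)
  case 0
  then show ?case by (simp add: continuous_on_add)
next
  case (Suc k)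
  have D: "((\<lambda>x. f x + g x) has_derivative
      (\<lambda>h. frechet_derivative f (at x) h + frechet_derivative g (at x) h)) (at x)"
    if "x \<in> S" for x
    using Suc.prems that Ck_on_has_derivative by (intro has_derivative_add) auto
  have "Ck_on k S (pderiv_dir i (\<lambda>x. f x + g x))" for i
    by (rule Ck_on_cong[OF assms(1) _ Suc.IH[of "pderiv_dir i f" "pderiv_dir i g"]])
      (use Suc.prems in \<open>auto simp: pderiv_dir_eq[OF D] frechet_derivative_axis\<close>)
  then show ?case using D by (auto simp: differentiable_def)
qed

lemma Ck_on_sum:
  assumes "open S" "\<And>i. i \<in> I \<Longrightarrow> Ck_on k S (f i)"
  shows "Ck_on k S (\<lambda>x. \<Sum>i\<in>I. f i x)"
  using assms(2) by (induction I rule: infinite_finite_induct)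
    (auto intro: Ck_on_const Ck_on_add[OF assms(1)])

lemma Ck_on_bilinear:
  assumes "bounded_bilinear b" "open S" "Ck_on k S f" "Ck_on k S g"
  shows "Ck_on k S (\<lambda>x. b (f x) (g x))"
  using assms(3,4)
proof (induction k arbitrary: f g)
  case 0
  then show ?case by (simp add: bounded_bilinear.continuous_on[OF assms(1)])
next
  case (Suc k)
  have D: "((\<lambda>x. b (f x) (g x)) has_derivative
      (\<lambda>h. b (f x) (frechet_derivative g (at x) h) + b (frechet_derivative f (at x) h) (g x))) (at x)"
    if "x \<in> S" for x
    by (rule bounded_bilinear.FDERIV[OF assms(1) Suc.prems[THEN Ck_on_has_derivative, OF that]])
  have k: "Ck_on k S f" "Ck_on k S g" using Suc.prems Ck_on_Suc_imp by blast+
  have "Ck_on k S (pderiv_dir i (\<lambda>x. b (f x) (g x)))" for i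
  proof (rule Ck_on_cong[OF assms(2)])
    show "Ck_on k S (\<lambda>x. b (f x) (pderiv_dir i g x) + b (pderiv_dir i f x) (g x))"
      by (intro Ck_on_add[OF assms(2)] Suc.IH) (use Suc.prems k in auto)
  qed (auto simp: pderiv_dir_eq[OF D] frechet_derivative_axis)
  then show ?case using D by (auto simp: differentiable_def)
qed

lemma Ck_on_inverse:
  fixes g :: "real^'n::finite \<Rightarrow> complex"
  assumes "open S" "Ck_on k S g" "\<And>x. x \<in> S \<Longrightarrow> g x \<noteq> 0"
  shows "Ck_on k S (\<lambda>x. inverse (g x))"
  using assms(2)
proof (induction k)
  case 0
  then show ?case using assms(3) by (auto intro: continuous_on_inverse)
next
  case (Suc k)
  have D: "((\<lambda>x. inverse (g x)) has_derivative
      (\<lambda>h. - (inverse (g x) * frechet_derivative g (at x) h * inverse (g x)))) (at x)"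
    if "x \<in> S" for x
    by (rule Deriv.has_derivative_inverse[OF assms(3)[OF that] Ck_on_has_derivative[OF Suc.prems that]])
  have k: "Ck_on k S (\<lambda>x. inverse (g x))" using Suc Ck_on_Suc_imp by blast
  have "Ck_on k S (pderiv_dir i (\<lambda>x. inverse (g x)))" for i
  proof (rule Ck_on_cong[OF assms(1)])
    show "Ck_on k S (\<lambda>x. - (inverse (g x) * pderiv_dir i g x * inverse (g x)))"
      by (intro Ck_on_bounded_linear[OF bounded_linear_minus[OF bounded_linear_ident]]
            Ck_on_bilinear[OF bounded_bilinear_mult] assms(1) k) (use Suc.prems in auto)
  qed (auto simp: pderiv_dir_eq[OF D] frechet_derivative_axis)
  then show ?case using D by (auto simp: differentiable_def)
qed

text \<open>
  The hypothesis says that \<open>r\<close> lists a function together with all its derivatives, so that the chain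
  rule stays inside the family; the bump functions below come in this form.
\<close>

lemma Ck_on_compose_real:
  fixes r :: "nat \<Rightarrow> real \<Rightarrow> real"
  assumes "open S" "\<And>n t. (r n has_real_derivative r (Suc n) t) (at t)" "Ck_on k S q"
  shows "Ck_on k S (\<lambda>x. r n (q x))"
  using assms(3)
proof (induction k arbitrary: n)
  case 0
  have "continuous_on UNIV (r n)"
    by (intro continuous_at_imp_continuous_on ballI DERIV_isCont[OF assms(2)])
  then show ?case using 0 continuous_on_compose2[of UNIV "r n" S q] by simp
next
  case (Suc k)
  have D: "((\<lambda>x. r n (q x)) has_derivative
      (\<lambda>h. r (Suc n) (q x) * frechet_derivative q (at x) h)) (at x)" if "x \<in> S" for x
  proof -
    have "(q has_derivative frechet_derivative q (at x)) (at x)"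
      using Suc.prems that frechet_derivative_works by auto
    from has_derivative_compose[OF this assms(2)[unfolded has_field_derivative_def]]
    show ?thesis by simp
  qed
  have k: "Ck_on k S q" using Suc Ck_on_Suc_imp by blast
  have "Ck_on k S (pderiv_dir i (\<lambda>x. r n (q x)))" for i
  proof (rule Ck_on_cong[OF assms(1)])
    show "Ck_on k S (\<lambda>x. r (Suc n) (q x) * pderiv_dir i q x)"
      by (intro Ck_on_bilinear[OF bounded_bilinear_mult] assms(1) Suc.IH k)
        (use Suc.prems in auto)
  qed (auto simp: pderiv_dir_eq[OF D] frechet_derivative_axis)
  then show ?case using D by (auto simp: differentiable_def)
qed

lemma Ck_on_compose:
  fixes T :: "real^'n::finite \<Rightarrow> real^'p::finite"
  assumes "open S" "open S'" "T ` S \<subseteq> S'" "Ck_on k S T" "Ck_on k S' f"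
  shows "Ck_on k S (\<lambda>x. f (T x))"
  using assms(4,5)
proof (induction k arbitrary: f)
  case 0
  then show ?case using continuous_on_compose2[of S' f S T] assms(3) by auto
next
  case (Suc k)
  have D: "((\<lambda>x. f (T x)) has_derivative
      (\<lambda>h. frechet_derivative f (at (T x)) (frechet_derivative T (at x) h))) (at x)"
    if "x \<in> S" for x
  proof -
    have "T x \<in> S'" using that assms(3) by auto
    then show ?thesis
      by (intro has_derivative_compose[OF Suc.prems[THEN Ck_on_has_derivative]] that)
  qed
  have k: "Ck_on k S T" using Suc.prems Ck_on_Suc_imp by blast
  have "Ck_on k S (pderiv_dir i (\<lambda>x. f (T x)))" for i
  proof (rule Ck_on_cong[OF assms(1)])
    show "Ck_on k S (\<lambda>x. \<Sum>j\<in>UNIV. vec_nth (pderiv_dir i T x) j *\<^sub>R pderiv_dir j f (T x))"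
      by (intro Ck_on_sum Ck_on_bilinear[OF bounded_bilinear_scaleR] assms(1) Suc.IH k
            Ck_on_bounded_linear[OF bounded_linear_vec_nth]) (use Suc.prems in auto)
  next
    fix x assume x: "x \<in> S"
    then have "T x \<in> S'" using assms(3) by auto
    then have "linear (frechet_derivative f (at (T x)))"
      using Suc.prems by (intro linear_frechet_derivative) auto
    then have expand: "frechet_derivative f (at (T x)) v
        = (\<Sum>j\<in>UNIV. vec_nth v j *\<^sub>R frechet_derivative f (at (T x)) (axis j 1))" for v
    proof -
      interpret linear "frechet_derivative f (at (T x))" by fact
      have "v = (\<Sum>j\<in>UNIV. vec_nth v j *\<^sub>R axis j 1)"
        using basis_expansion[of v] by (simp add: scalar_mult_eq_scaleR)
      then have "frechet_derivative f (at (T x)) v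
          = frechet_derivative f (at (T x)) (\<Sum>j\<in>UNIV. vec_nth v j *\<^sub>R axis j 1)" by simp
      then show ?thesis by (simp add: sum scaleR)
    qed
    show "(\<Sum>j\<in>UNIV. vec_nth (pderiv_dir i T x) j *\<^sub>R pderiv_dir j f (T x))
        = pderiv_dir i (\<lambda>x. f (T x)) x"
      using expand[of "pderiv_dir i T x"]
      by (simp add: pderiv_dir_eq[OF D[OF x]] frechet_derivative_axis)
  qed
  then show ?case using D by (auto simp: differentiable_def)
qed

lemma Cinf_on_pderiv: "Cinf_on S f \<Longrightarrow> Cinf_on S (pderiv_dir i f)"
  unfolding Cinf_on_def by (meson Ck_on.simps(2))

lemma Cinf_on_differentiable: "Cinf_on S f \<Longrightarrow> x \<in> S \<Longrightarrow> f differentiable (at x)"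
  unfolding Cinf_on_def by (meson Ck_on.simps(2))

lemma Cinf_on_has_derivative:
  "Cinf_on S f \<Longrightarrow> x \<in> S \<Longrightarrow> (f has_derivative frechet_derivative f (at x)) (at x)"
  using Cinf_on_differentiable frechet_derivative_works by blast

lemma Cinf_on_continuous: "Cinf_on S f \<Longrightarrow> continuous_on S f"
  by (simp add: Cinf_on_def) (metis Ck_on.simps(1))

lemma Cinf_on_cong: "open S \<Longrightarrow> (\<And>y. y \<in> S \<Longrightarrow> f y = g y) \<Longrightarrow> Cinf_on S f \<Longrightarrow> Cinf_on S g"
  by (simp add: Cinf_on_def) (metis Ck_on_cong)

lemma Cinf_on_subset: "Cinf_on S f \<Longrightarrow> T \<subseteq> S \<Longrightarrow> Cinf_on T f"
  by (auto simp: Cinf_on_def intro: Ck_on_subset)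

lemma Cinf_on_local:
  "(\<And>x. x \<in> S \<Longrightarrow> \<exists>T. open T \<and> x \<in> T \<and> Cinf_on T f) \<Longrightarrow> Cinf_on S f"
  unfolding Cinf_on_def by (meson Ck_on_local)

lemma Cinf_on_const: "Cinf_on S (\<lambda>x. c)"
  by (simp add: Cinf_on_def Ck_on_const)

lemma Cinf_on_bounded_linear:
  "bounded_linear L \<Longrightarrow> open S \<Longrightarrow> Cinf_on S f \<Longrightarrow> Cinf_on S (\<lambda>x. L (f x))"
  by (simp add: Cinf_on_def Ck_on_bounded_linear)

lemma Cinf_on_bilinear:
  "bounded_bilinear b \<Longrightarrow> open S \<Longrightarrow> Cinf_on S f \<Longrightarrow> Cinf_on S g \<Longrightarrow> Cinf_on S (\<lambda>x. b (f x) (g x))"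
  by (simp add: Cinf_on_def Ck_on_bilinear)

lemma Cinf_on_add:
  "open S \<Longrightarrow> Cinf_on S f \<Longrightarrow> Cinf_on S g \<Longrightarrow> Cinf_on S (\<lambda>x. f x + g x)"
  by (simp add: Cinf_on_def Ck_on_add)

lemma Cinf_on_diff:
  assumes "open S" "Cinf_on S f" "Cinf_on S g"
  shows "Cinf_on S (\<lambda>x. f x - g x)"
  using Cinf_on_add[OF assms(1,2) Cinf_on_bounded_linear[OF
        bounded_linear_minus[OF bounded_linear_ident] assms(1,3)]] by simp

lemma Cinf_on_inverse:
  fixes g :: "real^'n::finite \<Rightarrow> complex"
  shows "open S \<Longrightarrow> Cinf_on S g \<Longrightarrow> (\<And>x. x \<in> S \<Longrightarrow> g x \<noteq> 0) \<Longrightarrow> Cinf_on S (\<lambda>x. inverse (g x))"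
  by (simp add: Cinf_on_def Ck_on_inverse)

lemma Cinf_on_compose:
  fixes T :: "real^'n::finite \<Rightarrow> real^'p::finite"
  shows "open S \<Longrightarrow> open S' \<Longrightarrow> T ` S \<subseteq> S' \<Longrightarrow> Cinf_on S T \<Longrightarrow> Cinf_on S' f
    \<Longrightarrow> Cinf_on S (\<lambda>x. f (T x))"
  by (simp add: Cinf_on_def Ck_on_compose)

text \<open>
  A function may be recognised as smooth from its first derivatives; the case \<open>k = 0\<close> comes from
  differentiability.
\<close>

lemma Cinf_on_pderiv_induct:
  "(\<And>x. x \<in> S \<Longrightarrow> f differentiable (at x)) \<Longrightarrow> (\<And>i. Cinf_on S (pderiv_dir i f)) \<Longrightarrow> Cinf_on S f"
  unfolding Cinf_on_def by (metis Ck_on.simps(2) Ck_on_Suc_imp)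

lemma Cinf_on_ident: "Cinf_on S (\<lambda>x. x)"
proof (rule Cinf_on_pderiv_induct)
  have "pderiv_dir i (\<lambda>x. x) = (\<lambda>x. axis i 1)" for i :: 'a
    by (rule ext, rule pderiv_dir_eq[OF has_derivative_ident])
  then show "Cinf_on S (pderiv_dir i (\<lambda>x. x))" for i by (simp add: Cinf_on_const)
qed simp

subsection \<open>Iterated derivatives\<close>

lemma pderiv_dir_diff:
  assumes "open S" "Cinf_on S f" "Cinf_on S g" "x \<in> S"
  shows "pderiv_dir i (\<lambda>x. f x - g x) x = pderiv_dir i f x - pderiv_dir i g x"
  using pderiv_dir_eq[OF has_derivative_diff[OF assms(2,3)[THEN Cinf_on_has_derivative, OF assms(4)]]]
  by (simp add: pderiv_dir_def)

text \<open>
  The operators \<open>mderiv \<alpha>\<close> are compositions of directional derivatives, so whatever holds for the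
  identity and for these and is stable under composition holds for \<open>mderiv \<alpha>\<close>.
\<close>

lemma mderiv_induct:
  assumes "P (\<lambda>f. f)" "\<And>i. P (pderiv_dir i)" "\<And>p q. P p \<Longrightarrow> P q \<Longrightarrow> P (\<lambda>f. p (q f))"
  shows "P (mderiv \<alpha>)"
proof -
  have 1: "P (\<lambda>f. (pderiv_dir i ^^ n) f)" for i n
    by (induction n) (use assms(1) assms(3)[OF assms(2)] in auto)
  have 2: "P (\<lambda>f. foldr (\<lambda>i g. (pderiv_dir i ^^ \<alpha> i) g) xs f)" for xs
    by (induction xs) (use assms(1) assms(3)[OF 1] in auto)
  show ?thesis unfolding mderiv_def[abs_def] by (rule 2)
qed

lemma Cinf_on_mderiv:
  assumes "Cinf_on S f"
  shows "Cinf_on S (mderiv \<alpha> f)"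
proof -
  have "\<forall>f. Cinf_on S f \<longrightarrow> Cinf_on S (mderiv \<alpha> f)"
    by (rule mderiv_induct) (auto intro: Cinf_on_pderiv)
  with assms show ?thesis by blast
qed

lemma mderiv_diff_cong:
  assumes "open S" "Cinf_on S f" "Cinf_on S g" "\<And>x. x \<in> S \<Longrightarrow> h x = f x - g x" "x \<in> S"
  shows "mderiv \<alpha> h x = mderiv \<alpha> f x - mderiv \<alpha> g x"
proof -
  let ?P = "\<lambda>p :: (real^'a \<Rightarrow> 'b) \<Rightarrow> (real^'a \<Rightarrow> 'b). (\<forall>f. Cinf_on S f \<longrightarrow> Cinf_on S (p f)) \<and>
    (\<forall>f g h. Cinf_on S f \<longrightarrow> Cinf_on S g \<longrightarrow> (\<forall>x\<in>S. h x = f x - g x) \<longrightarrow>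
      (\<forall>x\<in>S. p h x = p f x - p g x))"
  have "?P (mderiv \<alpha>)"
  proof (rule mderiv_induct[where P = ?P])
    fix i
    show "?P (pderiv_dir i)"
    proof (intro conjI allI impI ballI)
      fix f g h :: "real^'a \<Rightarrow> 'b" and x
      assume *: "Cinf_on S f" "Cinf_on S g" "\<forall>x\<in>S. h x = f x - g x" "x \<in> S"
      have "(\<lambda>x. f x - g x) differentiable (at x)"
        using Cinf_on_differentiable[OF Cinf_on_diff[OF assms(1) *(1,2)] *(4)] .
      then have "pderiv_dir i (\<lambda>x. f x - g x) x = pderiv_dir i h x"
        by (intro pderiv_dir_cong[OF assms(1)]) (use * in auto)
      then show "pderiv_dir i h x = pderiv_dir i f x - pderiv_dir i g x"
        using pderiv_dir_diff[OF assms(1) *(1,2,4)] by simp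
    qed (auto intro: Cinf_on_pderiv)
  next
    fix p q :: "(real^'a \<Rightarrow> 'b) \<Rightarrow> (real^'a \<Rightarrow> 'b)"
    assume "?P p" "?P q"
    then have pq: "\<And>f. Cinf_on S f \<Longrightarrow> Cinf_on S (p f)" "\<And>f. Cinf_on S f \<Longrightarrow> Cinf_on S (q f)"
      "\<And>f g h. Cinf_on S f \<Longrightarrow> Cinf_on S g \<Longrightarrow> (\<forall>x\<in>S. h x = f x - g x) \<Longrightarrow>
        (\<forall>x\<in>S. p h x = p f x - p g x)"
      "\<And>f g h. Cinf_on S f \<Longrightarrow> Cinf_on S g \<Longrightarrow> (\<forall>x\<in>S. h x = f x - g x) \<Longrightarrow>
        (\<forall>x\<in>S. q h x = q f x - q g x)"
      by simp_all
    show "?P (\<lambda>f. p (q f))"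
    proof (rule conjI; intro allI impI)
      fix f :: "real^'a \<Rightarrow> 'b" assume "Cinf_on S f"
      then show "Cinf_on S (p (q f))" by (intro pq(1) pq(2))
    next
      fix f g h :: "real^'a \<Rightarrow> 'b"
      assume "Cinf_on S f" "Cinf_on S g" "\<forall>x\<in>S. h x = f x - g x"
      then show "\<forall>x\<in>S. p (q h) x = p (q f) x - p (q g) x" by (intro pq)
    qed
  qed auto
  then show ?thesis using assms by blast
qed

subsection \<open>Bump functions\<close>

definition flat_fun :: "real poly \<Rightarrow> real \<Rightarrow> real" where
  "flat_fun p x = (if 0 < x then poly p (1 / x) * exp (- (1 / x)) else 0)"

lemma poly_exp_decay:
  fixes p :: "real poly"
  shows "((\<lambda>y. poly p y * exp (- y)) \<longlongrightarrow> 0) at_top"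
proof -
  have "((\<lambda>y. \<Sum>i\<le>degree p. coeff p i * (y ^ i / exp y)) \<longlongrightarrow> (\<Sum>i\<le>degree p. coeff p i * 0)) at_top"
    by (intro tendsto_sum tendsto_mult tendsto_const tendsto_power_div_exp_0)
  moreover have "(\<Sum>i\<le>degree p. coeff p i * (y ^ i / exp y)) = poly p y * exp (- y)" for y
    by (simp add: poly_altdef sum_distrib_right exp_minus divide_inverse mult.assoc)
  ultimately show ?thesis by simp
qed

lemma flat_fun_tendsto_0:
  "((\<lambda>x. poly p (1 / x) * exp (- (1 / x))) \<longlongrightarrow> 0) (at_right (0::real))"
  using filterlim_compose[OF poly_exp_decay[of p] filterlim_inverse_at_top_right]
  by (simp add: inverse_eq_divide)

text \<open>
  The family of all \<open>p(1/x) exp(-1/x)\<close>, continued by zero, is stable under differentiation; this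
  is why \<open>exp(-1/x)\<close> is smooth across the origin.
\<close>

lemma flat_fun_has_derivative:
  "(flat_fun p has_real_derivative flat_fun ([:0, 0, 1:] * (p - Polynomial.pderiv p)) t) (at t)"
proof -
  consider "t > 0" | "t < 0" | "t = 0" by linarith
  then show ?thesis
  proof cases
    case 1
    have "((\<lambda>x. poly p (1 / x) * exp (- (1 / x))) has_real_derivative
        flat_fun ([:0, 0, 1:] * (p - Polynomial.pderiv p)) t) (at t)"
      using 1
      apply (auto intro!: derivative_eq_intros simp: flat_fun_def)
      apply (simp add: field_simps power2_eq_square)
      done
    then show ?thesis
      by (rule has_field_derivative_transform_within_open[where S = "{0<..}"])
        (use 1 in \<open>auto simp: flat_fun_def\<close>)
  next
    case 2
    have "((\<lambda>x. 0) has_real_derivative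
        flat_fun ([:0, 0, 1:] * (p - Polynomial.pderiv p)) t) (at t)"
      using 2 by (simp add: flat_fun_def)
    then show ?thesis
      by (rule has_field_derivative_transform_within_open[where S = "{..<0}"])
        (use 2 in \<open>auto simp: flat_fun_def\<close>)
  next
    case 3
    have "((\<lambda>h. poly (pCons 0 p) (1 / h) * exp (- (1 / h))) \<longlongrightarrow> 0) (at_right 0)"
      by (rule flat_fun_tendsto_0)
    then have "((\<lambda>h. (flat_fun p h - flat_fun p 0) / h) \<longlongrightarrow> 0) (at_right 0)"
      by (rule Lim_transform_eventually)
        (auto simp: flat_fun_def eventually_at_filter)
    moreover have "((\<lambda>h. (flat_fun p h - flat_fun p 0) / h) \<longlongrightarrow> 0) (at_left 0)"
      by (rule Lim_transform_eventually[OF tendsto_const])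
        (auto simp: flat_fun_def eventually_at_filter)
    ultimately have "((\<lambda>h. (flat_fun p h - flat_fun p 0) / h) \<longlongrightarrow> 0) (at 0)"
      by (simp add: filterlim_split_at)
    then show ?thesis using 3 by (simp add: has_field_derivative_iff flat_fun_def)
  qed
qed

text \<open>
  The function is \<open>exp (-1 / t)\<close> with \<open>t = r\<^sup>2 - |x - z|\<^sup>2\<close>, which is polynomial in \<open>x\<close>; here \<open>r\<close> is the radius
  of a closed ball \<open>K\<close> around \<open>z\<close> in the given open set.
\<close>

lemma smooth_bump:
  fixes z :: "real^'n::finite"
  assumes "open S" "z \<in> S"
  obtains \<chi> :: "real^'n \<Rightarrow> real" and K where
    "Cinf_on UNIV \<chi>" "compact K" "K \<subseteq> S" "\<And>x. x \<notin> K \<Longrightarrow> \<chi> x = 0" "0 < \<chi> z"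
    "\<And>x. 0 \<le> \<chi> x" "\<And>x. \<chi> x \<le> 1"
proof -
  obtain r where r: "r > 0" "cball z r \<subseteq> S"
    using assms open_contains_cball by blast
  define D where "D = (\<lambda>p :: real poly. [:0, 0, 1:] * (p - Polynomial.pderiv p))"
  define \<chi> where "\<chi> x = flat_fun 1 (r\<^sup>2 - inner (x - z) (x - z))" for x
  have q: "Cinf_on UNIV (\<lambda>x. r\<^sup>2 - inner (x - z) (x - z))"
    by (intro Cinf_on_diff Cinf_on_const Cinf_on_bilinear[OF bounded_bilinear_inner]
        Cinf_on_ident open_UNIV)
  have flat: "(flat_fun p has_real_derivative flat_fun (D p) t) (at t)" for p t
    unfolding D_def by (rule flat_fun_has_derivative)
  have "Ck_on k UNIV \<chi>" for k
  proof -
    have "Ck_on k UNIV (\<lambda>x. flat_fun ((D ^^ 0) 1) (r\<^sup>2 - inner (x - z) (x - z)))"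
      using q by (intro Ck_on_compose_real[where r = "\<lambda>n. flat_fun ((D ^^ n) 1)" and n = 0, OF open_UNIV])
        (simp_all add: Cinf_on_def flat)
    then show ?thesis by (simp add: \<chi>_def[abs_def])
  qed
  then have "Cinf_on UNIV \<chi>" by (simp add: Cinf_on_def)
  moreover have "\<chi> x = 0" if "x \<notin> cball z r" for x
  proof -
    have "r < norm (x - z)" using that by (simp add: dist_norm norm_minus_commute)
    then have "r\<^sup>2 < (norm (x - z))\<^sup>2" using r by (intro power_strict_mono) auto
    then show ?thesis by (simp add: \<chi>_def flat_fun_def power2_norm_eq_inner)
  qed
  moreover have "0 < \<chi> z" using r by (simp add: \<chi>_def flat_fun_def)
  moreover have "0 \<le> \<chi> x" "\<chi> x \<le> 1" for x by (auto simp: \<chi>_def flat_fun_def)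
  ultimately show ?thesis by (intro that[OF _ compact_cball r(2)])
qed

subsection \<open>Integration by parts\<close>

lemma set_integrable_compact_support:
  fixes h :: "real^'n::finite \<Rightarrow> complex"
  assumes "open S" "compact K" "K \<subseteq> S" "continuous_on S h" "\<And>x. x \<in> S - K \<Longrightarrow> h x = 0"
  shows "set_integrable lborel S h"
proof -
  have "(\<lambda>x. indicator S x *\<^sub>R h x) = (\<lambda>x. indicator K x *\<^sub>R h x)"
    using assms(3,5) by (intro ext) (auto simp: indicator_def)
  then show ?thesis
    using borel_integrable_compact[OF assms(2), of h] continuous_on_subset[OF assms(4,3)]
    unfolding set_integrable_def by simp
qed

text \<open>
  Translations preserve the integral, so all difference quotients of a compactly supported function
  integrate to zero; by dominated convergence, so does its derivative.
\<close>

lemma integral_pderiv_dir_eq_0: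
  fixes h :: "real^'n::finite \<Rightarrow> complex"
  assumes "Cinf_on UNIV h" "compact K" "\<And>x. x \<notin> K \<Longrightarrow> h x = 0"
  shows "(LINT x|lborel. pderiv_dir i h x) = 0"
proof -
  define e :: "real^'n" where "e = axis i 1"
  have ne: "norm e = 1" by (simp add: e_def)
  define t where "t n = 1 / real (Suc n)" for n
  have t: "0 < t n" "t n \<le> 1" for n by (auto simp: t_def)
  have t0: "t \<longlonglongrightarrow> 0" unfolding t_def using LIMSEQ_inverse_real_of_nat by (simp add: inverse_eq_divide)
  have D: "(h has_derivative frechet_derivative h (at x)) (at x)" for x
    using Cinf_on_has_derivative[OF assms(1)] by simp
  have lin: "linear (frechet_derivative h (at x))" for x
    using D has_derivative_linear by blast
  have contp: "continuous_on UNIV (pderiv_dir i h)"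
    using Cinf_on_continuous[OF Cinf_on_pderiv[OF assms(1)]] .
  have conth: "continuous_on UNIV h" using Cinf_on_continuous[OF assms(1)] .
  have zero: "pderiv_dir i h x = 0" if "x \<notin> K" for x
  proof -
    have "open (- K)" using assms(2) compact_imp_closed by auto
    have "(h has_derivative (\<lambda>_. 0)) (at x)"
      by (rule has_derivative_transform_within_open[OF has_derivative_const[of 0] \<open>open (- K)\<close>])
        (use that assms(3) in auto)
    then show ?thesis by (simp add: pderiv_dir_eq)
  qed
  obtain B where B: "\<And>x. norm (pderiv_dir i h x) \<le> B" "B \<ge> 0"
  proof -
    have "compact (pderiv_dir i h ` K)"
      by (intro compact_continuous_image assms(2) continuous_on_subset[OF contp]) simp
    then obtain b where "\<forall>y\<in>pderiv_dir i h ` K. norm y \<le> b"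
      using compact_imp_bounded bounded_iff by blast
    then have "norm (pderiv_dir i h x) \<le> max b 0" for x
      by (cases "x \<in> K") (auto simp: zero intro: max.coboundedI1)
    then show ?thesis using that[of "max b 0"] by auto
  qed
  have line: "((\<lambda>s. h (x + s *\<^sub>R e)) has_vector_derivative pderiv_dir i h (x + s *\<^sub>R e)) (at s within A)" for x s A
  proof -
    have "((\<lambda>s. x + s *\<^sub>R e) has_derivative (\<lambda>s. s *\<^sub>R e)) (at s within A)"
      by (auto intro!: derivative_eq_intros)
    from has_derivative_compose[OF this D]
    show ?thesis by (simp add: has_vector_derivative_def linear_scale[OF lin] e_def frechet_derivative_axis)
  qed
  define g where "g n x = (h (x + t n *\<^sub>R e) - h x) /\<^sub>R t n" for n x
  have gB: "norm (g n x) \<le> B" for n x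
  proof -
    have "norm (h (x + t n *\<^sub>R e) - h (x + 0 *\<^sub>R e)) \<le> B * norm (t n - 0)"
    proof (rule differentiable_bound[of "{0..t n}"])
      fix s assume "s \<in> {0..t n}"
      show "((\<lambda>s. h (x + s *\<^sub>R e)) has_derivative (\<lambda>r. r *\<^sub>R pderiv_dir i h (x + s *\<^sub>R e))) (at s within {0..t n})"
        using line has_vector_derivative_def by blast
      show "onorm (\<lambda>r. r *\<^sub>R pderiv_dir i h (x + s *\<^sub>R e)) \<le> B"
        by (rule onorm_le) (metis B(1) abs_ge_zero mult.commute mult_right_mono norm_scaleR real_norm_def)
    qed (use t in \<open>auto simp: less_imp_le\<close>)
    moreover have "norm (g n x) = norm (h (x + t n *\<^sub>R e) - h x) / t n"
      using t[of n] by (simp add: g_def divide_inverse mult.commute)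
    ultimately show ?thesis using t[of n] by (simp add: pos_divide_le_eq)
  qed
  \<comment> \<open>\<open>K'\<close> contains the supports of all difference quotients with step at most \<open>1\<close>, so \<open>B\<close> times its indicator dominates them.\<close>
  define K' where "K' = K \<union> (\<lambda>(x, s). x - s *\<^sub>R e) ` (K \<times> {0..1})"
  have "compact K'" unfolding K'_def
    by (intro compact_Un assms(2) compact_continuous_image compact_Times)
      (auto intro!: continuous_intros simp: case_prod_unfold)
  have gz: "g n x = 0" if "x \<notin> K'" for n x
  proof -
    have "x + t n *\<^sub>R e \<notin> K"
    proof
      assume "x + t n *\<^sub>R e \<in> K"
      then have "(x + t n *\<^sub>R e, t n) \<in> K \<times> {0..1}" using t[of n] by (auto simp: less_imp_le)
      then have "(\<lambda>(x, s). x - s *\<^sub>R e) (x + t n *\<^sub>R e, t n) \<in> K'" unfolding K'_def by blast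
      then show False using that by simp
    qed
    then show ?thesis using that assms(3) by (auto simp: g_def K'_def)
  qed
  have hint: "integrable lborel h"
  proof -
    have "integrable lborel (\<lambda>x. indicator K x *\<^sub>R h x)"
      by (intro borel_integrable_compact assms(2) continuous_on_subset[OF conth]) simp
    moreover have "(\<lambda>x. indicator K x *\<^sub>R h x) = h" using assms(3) by (intro ext) (auto simp: indicator_def)
    ultimately show ?thesis by simp
  qed
  have "(\<lambda>n. LINT x|lborel. g n x) \<longlonglongrightarrow> (LINT x|lborel. pderiv_dir i h x)"
  proof (rule integral_dominated_convergence[where w = "\<lambda>x. B * indicator K' x"])
    show "integrable lborel (\<lambda>x. B * indicator K' x)"
      using \<open>compact K'\<close> by (intro integrable_mult_right integrable_real_indicator)
        (auto intro!: emeasure_bounded_finite[unfolded infinity_ennreal_def] compact_imp_bounded intro: borel_compact)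
    show "AE x in lborel. (\<lambda>n. g n x) \<longlonglongrightarrow> pderiv_dir i h x"
    proof (rule AE_I2)
      fix x
      have "((\<lambda>s. (h (x + s *\<^sub>R e) - h x) /\<^sub>R s) \<longlongrightarrow> pderiv_dir i h x) (at 0)"
      proof -
        have "((\<lambda>s. h (x + s *\<^sub>R e)) has_derivative (\<lambda>s. s *\<^sub>R pderiv_dir i h x)) (at 0)"
          using line[of x 0 UNIV] by (simp add: has_vector_derivative_def)
        then have "((\<lambda>s. norm (h (x + s *\<^sub>R e) - h x - s *\<^sub>R pderiv_dir i h x) / norm s) \<longlongrightarrow> 0) (at 0)"
          by (simp add: has_derivative_at)
        then have "((\<lambda>s. norm ((h (x + s *\<^sub>R e) - h x) /\<^sub>R s - pderiv_dir i h x)) \<longlongrightarrow> 0) (at 0)"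
        proof (rule Lim_transform_eventually)
          show "\<forall>\<^sub>F s in at 0. norm (h (x + s *\<^sub>R e) - h x - s *\<^sub>R pderiv_dir i h x) / norm s
            = norm ((h (x + s *\<^sub>R e) - h x) /\<^sub>R s - pderiv_dir i h x)"
            unfolding eventually_at_filter
          proof (intro always_eventually allI impI)
            fix s :: real assume "s \<noteq> 0"
            then have "(h (x + s *\<^sub>R e) - h x) /\<^sub>R s - pderiv_dir i h x
                = (h (x + s *\<^sub>R e) - h x - s *\<^sub>R pderiv_dir i h x) /\<^sub>R s"
              by (simp add: scaleR_diff_right)
            then show "norm (h (x + s *\<^sub>R e) - h x - s *\<^sub>R pderiv_dir i h x) / norm s
              = norm ((h (x + s *\<^sub>R e) - h x) /\<^sub>R s - pderiv_dir i h x)"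
              by (simp add: divide_inverse mult.commute)
          qed
        qed
        then show "((\<lambda>s. (h (x + s *\<^sub>R e) - h x) /\<^sub>R s) \<longlongrightarrow> pderiv_dir i h x) (at 0)"
          by (rule LIM_zero_cancel[OF tendsto_norm_zero_cancel])
      qed
      moreover have "filterlim t (at 0) sequentially"
        using t t0 by (auto simp: filterlim_at less_imp_neq[THEN not_sym])
      ultimately show "(\<lambda>n. g n x) \<longlonglongrightarrow> pderiv_dir i h x"
        unfolding g_def by (rule filterlim_compose)
    qed
    show "AE x in lborel. norm (g n x) \<le> B * indicator K' x" for n
      using gB gz by (auto simp: indicator_def)
    show "pderiv_dir i h \<in> borel_measurable lborel"
      using contp borel_measurable_continuous_onI by auto
    show "g n \<in> borel_measurable lborel" for n
      unfolding g_def[abs_def]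
      by (simp, intro borel_measurable_continuous_onI continuous_intros
          continuous_on_compose2[OF conth]) auto
  qed
  moreover have "(LINT x|lborel. g n x) = 0" for n
  proof -
    have tr: "has_bochner_integral lborel (\<lambda>x. h (x + t n *\<^sub>R e)) (LINT x|lborel. h x)"
    proof -
      have m: "h \<in> borel_measurable borel" using conth borel_measurable_continuous_onI by blast
      have eq: "lborel = distr lborel borel (\<lambda>x. t n *\<^sub>R e + x)"
        using lborel_distr_plus[of "t n *\<^sub>R e"] by simp
      have "integrable (distr lborel borel (\<lambda>x. t n *\<^sub>R e + x)) h" using hint eq by simp
      then have "integrable lborel (\<lambda>x. h (t n *\<^sub>R e + x))"
        by (subst (asm) integrable_distr_eq) (use m in auto)
      moreover have "(LINT x|lborel. h x) = (LINT x|lborel. h (t n *\<^sub>R e + x))"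
        by (subst eq, subst integral_distr) (use m in auto)
      ultimately show ?thesis by (simp add: has_bochner_integral_iff add.commute)
    qed
    then have "has_bochner_integral lborel (g n)
        (((LINT x|lborel. h x) - (LINT x|lborel. h x)) /\<^sub>R t n)"
      unfolding g_def[abs_def]
      by (intro has_bochner_integral_scaleR_right has_bochner_integral_diff has_bochner_integral_integrable hint)
    then show ?thesis by (simp add: has_bochner_integral_iff)
  qed
  ultimately show ?thesis by (simp add: LIMSEQ_const_iff)
qed

text \<open>
  The product \<open>\<phi> \<psi>\<close>, continued by zero, is smooth on the whole space, and the integral of its derivative
  vanishes. The second claim allows the step to be iterated.
\<close>

lemma integration_by_parts:
  fixes \<phi> \<psi> :: "real^'n::finite \<Rightarrow> complex"
  assumes "open S" "compact K" "K \<subseteq> S" "Cinf_on S \<phi>" "Cinf_on S \<psi>"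
    and "\<And>x. x \<in> S - K \<Longrightarrow> \<psi> x = 0"
  shows "(LINT x:S|lborel. pderiv_dir i \<phi> x * \<psi> x) = (LINT x:S|lborel. \<phi> x * (- pderiv_dir i \<psi> x))"
    and "\<And>x. x \<in> S - K \<Longrightarrow> pderiv_dir i \<psi> x = 0"
proof -
  have oK: "open (- K)" using assms(2) compact_imp_closed by auto
  show z: "pderiv_dir i \<psi> x = 0" if "x \<in> S - K" for x
  proof -
    have "open (S - K)" using assms(1,2) by (simp add: compact_imp_closed open_Diff)
    have "(\<psi> has_derivative (\<lambda>_. 0)) (at x)"
      by (rule has_derivative_transform_within_open[OF has_derivative_const[of 0] \<open>open (S - K)\<close>])
        (use that assms(6) in auto)
    then show ?thesis by (simp add: pderiv_dir_eq)
  qed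
  define h where "h x = (if x \<in> S then \<phi> x * \<psi> x else 0)" for x
  have p: "Cinf_on S (\<lambda>x. \<phi> x * \<psi> x)"
    by (intro Cinf_on_bilinear[OF bounded_bilinear_mult] assms)
  have hz: "h x = 0" if "x \<notin> K" for x using that assms(6) by (auto simp: h_def)
  have smooth: "Cinf_on UNIV h"
  proof (rule Cinf_on_local)
    fix x
    have "Cinf_on S h" by (rule Cinf_on_cong[OF assms(1) _ p]) (simp add: h_def)
    moreover have "Cinf_on (- K) h"
      by (rule Cinf_on_cong[OF oK _ Cinf_on_const[of _ 0]]) (simp add: hz)
    ultimately show "\<exists>T. open T \<and> x \<in> T \<and> Cinf_on T h"
      using assms(1,3) oK by (metis ComplI subsetD)
  qed
  have prod: "pderiv_dir i h x = pderiv_dir i \<phi> x * \<psi> x + \<phi> x * pderiv_dir i \<psi> x" if "x \<in> S" for x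
  proof -
    have "((\<lambda>x. \<phi> x * \<psi> x) has_derivative (\<lambda>v. \<phi> x * frechet_derivative \<psi> (at x) v
        + frechet_derivative \<phi> (at x) v * \<psi> x)) (at x)"
      by (rule has_derivative_mult[OF assms(4,5)[THEN Cinf_on_has_derivative, OF that]])
    moreover have "pderiv_dir i (\<lambda>x. \<phi> x * \<psi> x) x = pderiv_dir i h x"
      by (rule pderiv_dir_cong[OF assms(1) that _ Cinf_on_differentiable[OF p that]]) (simp add: h_def)
    ultimately show ?thesis by (simp add: pderiv_dir_eq frechet_derivative_axis add.commute)
  qed
  have out: "pderiv_dir i h x = 0" if "x \<notin> S" for x
  proof -
    have "(h has_derivative (\<lambda>_. 0)) (at x)"
      by (rule has_derivative_transform_within_open[OF has_derivative_const[of 0] oK])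
        (use that assms(3) hz in auto)
    then show ?thesis by (simp add: pderiv_dir_eq)
  qed
  note cont = assms(4,5)[THEN Cinf_on_continuous] assms(4,5)[THEN Cinf_on_pderiv, THEN Cinf_on_continuous]
  have 1: "set_integrable lborel S (\<lambda>x. pderiv_dir i \<phi> x * \<psi> x)"
    using assms(6) by (intro set_integrable_compact_support[OF assms(1-3)] continuous_intros cont) auto
  have 2: "set_integrable lborel S (\<lambda>x. \<phi> x * pderiv_dir i \<psi> x)"
    using z by (intro set_integrable_compact_support[OF assms(1-3)] continuous_intros cont) auto
  have "0 = (LINT x|lborel. pderiv_dir i h x)"
    using integral_pderiv_dir_eq_0[OF smooth assms(2) hz] by simp
  also have "\<dots> = (LINT x:S|lborel. pderiv_dir i \<phi> x * \<psi> x + \<phi> x * pderiv_dir i \<psi> x)"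
    unfolding set_lebesgue_integral_def
    by (rule Bochner_Integration.integral_cong) (auto simp: prod out indicator_def)
  also have "\<dots> = (LINT x:S|lborel. pderiv_dir i \<phi> x * \<psi> x) + (LINT x:S|lborel. \<phi> x * pderiv_dir i \<psi> x)"
    by (rule set_integral_add[OF 1 2])
  finally show "(LINT x:S|lborel. pderiv_dir i \<phi> x * \<psi> x) = (LINT x:S|lborel. \<phi> x * (- pderiv_dir i \<psi> x))"
    by (simp add: eq_neg_iff_add_eq_0 set_lebesgue_integral_def)
qed

text \<open>
  The transpose of \<open>mderiv \<alpha>\<close> on functions with support in \<open>K\<close>. It is obtained by composing the
  transposes of the directional derivatives in reverse order.
\<close>

lemma mderiv_transpose:
  fixes \<psi> :: "real^'n::finite \<Rightarrow> complex"
  assumes "open S" "compact K" "K \<subseteq> S" "Cinf_on S \<psi>" "\<And>x. x \<in> S - K \<Longrightarrow> \<psi> x = 0"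
  obtains \<psi>' where "Cinf_on S \<psi>'" "\<And>x. x \<in> S - K \<Longrightarrow> \<psi>' x = 0"
    "\<And>\<phi>. Cinf_on S \<phi> \<Longrightarrow>
      (LINT x:S|lborel. mderiv \<alpha> \<phi> x * \<psi> x) = (LINT x:S|lborel. \<phi> x * \<psi>' x)"
proof -
  let ?C = "\<lambda>\<psi>. Cinf_on S \<psi> \<and> (\<forall>x\<in>S - K. \<psi> x = 0)"
  let ?P = "\<lambda>p :: (real^'n \<Rightarrow> complex) \<Rightarrow> (real^'n \<Rightarrow> complex).
    (\<forall>\<phi>. Cinf_on S \<phi> \<longrightarrow> Cinf_on S (p \<phi>)) \<and>
    (\<forall>\<psi>. ?C \<psi> \<longrightarrow> (\<exists>\<psi>'. ?C \<psi>' \<and> (\<forall>\<phi>. Cinf_on S \<phi> \<longrightarrow>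
      (LINT x:S|lborel. p \<phi> x * \<psi> x) = (LINT x:S|lborel. \<phi> x * \<psi>' x))))"
  have "?P (mderiv \<alpha>)"
  proof (rule mderiv_induct[where P = ?P])
    show "?P (\<lambda>f. f)" by auto
  next
    fix i
    show "?P (pderiv_dir i)"
    proof (intro conjI allI impI)
      fix \<psi> :: "real^'n \<Rightarrow> complex" assume *: "?C \<psi>"
      let ?\<psi>' = "\<lambda>x. - pderiv_dir i \<psi> x"
      have "Cinf_on S ?\<psi>'"
        using * by (intro Cinf_on_bounded_linear[OF bounded_linear_minus[OF bounded_linear_ident]]
            Cinf_on_pderiv assms(1)) auto
      moreover have "?\<psi>' x = 0" if "x \<in> S - K" for x
        using integration_by_parts(2)[OF assms(1-3) _ _ _ that, of \<psi> \<psi>] * by auto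
      moreover have "(LINT x:S|lborel. pderiv_dir i \<phi> x * \<psi> x) = (LINT x:S|lborel. \<phi> x * ?\<psi>' x)"
        if "Cinf_on S \<phi>" for \<phi>
        using integration_by_parts(1)[OF assms(1-3) that] * by auto
      ultimately show "\<exists>\<psi>'. ?C \<psi>' \<and> (\<forall>\<phi>. Cinf_on S \<phi> \<longrightarrow>
          (LINT x:S|lborel. pderiv_dir i \<phi> x * \<psi> x) = (LINT x:S|lborel. \<phi> x * \<psi>' x))"
        by (intro exI[of _ ?\<psi>']) simp
    qed (rule Cinf_on_pderiv)
  next
    fix p q assume p: "?P p" and q: "?P q"
    show "?P (\<lambda>f. p (q f))"
    proof (intro conjI allI impI)
      fix \<phi> :: "real^'n \<Rightarrow> complex" assume "Cinf_on S \<phi>"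
      then show "Cinf_on S (p (q \<phi>))" using p q by simp
    next
      fix \<psi> :: "real^'n \<Rightarrow> complex" assume *: "?C \<psi>"
      obtain \<psi>1 where 1: "?C \<psi>1" "\<And>\<phi>. Cinf_on S \<phi> \<Longrightarrow>
          (LINT x:S|lborel. p \<phi> x * \<psi> x) = (LINT x:S|lborel. \<phi> x * \<psi>1 x)"
        using conjunct2[OF p, rule_format, OF *] by blast
      obtain \<psi>2 where 2: "?C \<psi>2" "\<And>\<phi>. Cinf_on S \<phi> \<Longrightarrow>
          (LINT x:S|lborel. q \<phi> x * \<psi>1 x) = (LINT x:S|lborel. \<phi> x * \<psi>2 x)"
        using conjunct2[OF q, rule_format, OF 1(1)] by blast
      have "(LINT x:S|lborel. p (q \<phi>) x * \<psi> x) = (LINT x:S|lborel. \<phi> x * \<psi>2 x)"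
        if "Cinf_on S \<phi>" for \<phi>
        using 1(2)[OF conjunct1[OF q, rule_format, OF that]] 2(2)[OF that] by simp
      with 2(1) show "\<exists>\<psi>'. ?C \<psi>' \<and> (\<forall>\<phi>. Cinf_on S \<phi> \<longrightarrow>
          (LINT x:S|lborel. p (q \<phi>) x * \<psi> x) = (LINT x:S|lborel. \<phi> x * \<psi>' x))"
        by (intro exI[of _ \<psi>2]) simp
    qed
  qed
  then have "\<exists>\<psi>'. ?C \<psi>' \<and> (\<forall>\<phi>. Cinf_on S \<phi> \<longrightarrow>
      (LINT x:S|lborel. mderiv \<alpha> \<phi> x * \<psi> x) = (LINT x:S|lborel. \<phi> x * \<psi>' x))"
    using assms(4,5) by blast
  then show ?thesis using that by blast
qed

section \<open>Smooth functions on manifolds\<close>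

lemma chart_props:
  assumes "closed_manifold \<A>" "(U, \<phi>) \<in> \<A>"
  shows chart_open: "open U"
    and chart_continuous: "continuous_on U \<phi>"
    and chart_inv_continuous: "continuous_on (\<phi> ` U) (inv_into U \<phi>)"
    and chart_inj: "inj_on \<phi> U"
    and chart_open_image: "\<And>W. open W \<Longrightarrow> W \<subseteq> U \<Longrightarrow> open (\<phi> ` W)"
proof -
  have c: "open U" "open (\<phi> ` U)" and h: "homeomorphism U (\<phi> ` U) \<phi> (inv_into U \<phi>)"
    using bspec[of \<A> is_chart "(U, \<phi>)"] assms by (simp_all add: closed_manifold_def is_chart_def)
  show "open U" by fact
  show "continuous_on U \<phi>" "continuous_on (\<phi> ` U) (inv_into U \<phi>)"
    using h by (auto simp: homeomorphism_def)
  show "inj_on \<phi> U" by (rule inj_on_inverseI[of _ "inv_into U \<phi>"]) (rule homeomorphism_apply1[OF h])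
  fix W assume W: "open W" "W \<subseteq> U"
  then have "openin (top_of_set U) W" using c(1) by (simp add: openin_open_eq)
  then have "openin (top_of_set (\<phi> ` U)) (\<phi> ` W)" using homeomorphism_imp_open_map[OF h] by blast
  then show "open (\<phi> ` W)" by (simp add: openin_open_eq[OF c(2)])
qed

lemma chart_cover:
  assumes "closed_manifold \<A>"
  shows "\<exists>U \<phi>. (U, \<phi>) \<in> \<A> \<and> p \<in> U"
proof -
  have "p \<in> \<Union> (fst ` \<A>)" using assms by (simp add: closed_manifold_def)
  then show ?thesis by force
qed

lemma smooth_on_open_chart:
  "smooth_on_open \<A> V f \<Longrightarrow> (U, \<phi>) \<in> \<A> \<Longrightarrow> W \<subseteq> U \<inter> V \<Longrightarrow> Cinf_on (\<phi> ` W) (f \<circ> inv_into U \<phi>)"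
  unfolding smooth_on_open_def using Cinf_on_subset by (metis (no_types, lifting) case_prodD image_mono)

lemma smooth_on_openI:
  "open V \<Longrightarrow> (\<And>U \<phi>. (U, \<phi>) \<in> \<A> \<Longrightarrow> Cinf_on (\<phi> ` (U \<inter> V)) (f \<circ> inv_into U \<phi>)) \<Longrightarrow>
    smooth_on_open \<A> V f"
  unfolding smooth_on_open_def by auto

lemma smooth_on_open_open: "smooth_on_open \<A> V f \<Longrightarrow> open V"
  by (simp add: smooth_on_open_def)

context
  fixes \<A> :: "('m::t2_space, 'n::finite) chart set"
  assumes mfd: "closed_manifold \<A>"
begin

lemma chart_inter_open: "open V \<Longrightarrow> (U, \<phi>) \<in> \<A> \<Longrightarrow> open (\<phi> ` (U \<inter> V))"
  using chart_open_image[OF mfd] chart_open[OF mfd] by (metis Int_lower1 open_Int)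

lemma smooth_on_open_subset:
  "smooth_on_open \<A> V f \<Longrightarrow> open W \<Longrightarrow> W \<subseteq> V \<Longrightarrow> smooth_on_open \<A> W f"
  by (rule smooth_on_openI) (auto intro: smooth_on_open_chart)

lemma smooth_on_open_cong:
  assumes "smooth_on_open \<A> V f" "\<And>x. x \<in> V \<Longrightarrow> f x = g x"
  shows "smooth_on_open \<A> V g"
proof (rule smooth_on_openI)
  show V: "open V" using assms(1) by (rule smooth_on_open_open)
  fix U \<phi> assume c: "(U, \<phi>) \<in> \<A>"
  show "Cinf_on (\<phi> ` (U \<inter> V)) (g \<circ> inv_into U \<phi>)"
    by (rule Cinf_on_cong[OF chart_inter_open[OF V c] _ smooth_on_open_chart[OF assms(1) c order_refl]])
      (use assms(2) chart_inj[OF mfd c] in \<open>auto simp: inv_into_f_f\<close>)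
qed

lemma smooth_on_open_local:
  assumes "\<And>x. x \<in> V \<Longrightarrow> \<exists>W. x \<in> W \<and> smooth_on_open \<A> W f" "open V"
  shows "smooth_on_open \<A> V f"
proof (rule smooth_on_openI)
  fix U \<phi> assume c: "(U, \<phi>) \<in> \<A>"
  show "Cinf_on (\<phi> ` (U \<inter> V)) (f \<circ> inv_into U \<phi>)"
  proof (rule Cinf_on_local)
    fix y assume "y \<in> \<phi> ` (U \<inter> V)"
    then obtain x where x: "x \<in> U" "x \<in> V" "y = \<phi> x" by auto
    obtain W where W: "x \<in> W" "smooth_on_open \<A> W f" using assms(1) x(2) by blast
    have "open (\<phi> ` (U \<inter> W))" using chart_inter_open[OF smooth_on_open_open[OF W(2)] c] .
    moreover have "y \<in> \<phi> ` (U \<inter> W)" using x W by auto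
    moreover have "Cinf_on (\<phi> ` (U \<inter> W)) (f \<circ> inv_into U \<phi>)"
      by (rule smooth_on_open_chart[OF W(2) c]) simp
    ultimately show "\<exists>T. open T \<and> y \<in> T \<and> Cinf_on T (f \<circ> inv_into U \<phi>)" by blast
  qed
qed (rule assms(2))

lemma smooth_on_open_const: "open V \<Longrightarrow> smooth_on_open \<A> V (\<lambda>x. c)"
  by (rule smooth_on_openI) (auto simp: o_def intro: Cinf_on_const)

lemma smooth_on_open_bounded_linear:
  assumes "bounded_linear L" "smooth_on_open \<A> V f"
  shows "smooth_on_open \<A> V (\<lambda>x. L (f x))"
proof (rule smooth_on_openI[OF smooth_on_open_open[OF assms(2)]])
  fix U \<phi> assume c: "(U, \<phi>) \<in> \<A>"
  show "Cinf_on (\<phi> ` (U \<inter> V)) ((\<lambda>x. L (f x)) \<circ> inv_into U \<phi>)"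
    using Cinf_on_bounded_linear[OF assms(1) chart_inter_open[OF smooth_on_open_open[OF assms(2)] c]
        smooth_on_open_chart[OF assms(2) c order_refl]]
    by (simp add: o_def)
qed

lemma smooth_on_open_bilinear:
  assumes "bounded_bilinear b" "smooth_on_open \<A> V f" "smooth_on_open \<A> V g"
  shows "smooth_on_open \<A> V (\<lambda>x. b (f x) (g x))"
proof (rule smooth_on_openI[OF smooth_on_open_open[OF assms(2)]])
  fix U \<phi> assume c: "(U, \<phi>) \<in> \<A>"
  show "Cinf_on (\<phi> ` (U \<inter> V)) ((\<lambda>x. b (f x) (g x)) \<circ> inv_into U \<phi>)"
    using Cinf_on_bilinear[OF assms(1) chart_inter_open[OF smooth_on_open_open[OF assms(2)] c]
        smooth_on_open_chart[OF assms(2) c order_refl] smooth_on_open_chart[OF assms(3) c order_refl]]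
    by (simp add: o_def)
qed

lemmas smooth_on_open_mult = smooth_on_open_bilinear[OF bounded_bilinear_mult]

lemma smooth_on_open_add:
  assumes "smooth_on_open \<A> V f" "smooth_on_open \<A> V g"
  shows "smooth_on_open \<A> V (\<lambda>x. f x + g x)"
proof (rule smooth_on_openI[OF smooth_on_open_open[OF assms(1)]])
  fix U \<phi> assume c: "(U, \<phi>) \<in> \<A>"
  show "Cinf_on (\<phi> ` (U \<inter> V)) ((\<lambda>x. f x + g x) \<circ> inv_into U \<phi>)"
    using Cinf_on_add[OF chart_inter_open[OF smooth_on_open_open[OF assms(1)] c]
        smooth_on_open_chart[OF assms(1) c order_refl] smooth_on_open_chart[OF assms(2) c order_refl]]
    by (simp add: o_def)
qed

lemma smooth_on_open_diff:
  assumes "smooth_on_open \<A> V f" "smooth_on_open \<A> V g"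
  shows "smooth_on_open \<A> V (\<lambda>x. f x - g x)"
  using smooth_on_open_add[OF assms(1) smooth_on_open_bounded_linear[OF
        bounded_linear_minus[OF bounded_linear_ident] assms(2)]] by simp

lemma smooth_on_open_sum:
  assumes "open V" "\<And>i. i \<in> I \<Longrightarrow> smooth_on_open \<A> V (f i)"
  shows "smooth_on_open \<A> V (\<lambda>x. \<Sum>i\<in>I. f i x)"
  using assms(2) by (induction I rule: infinite_finite_induct)
    (auto intro: smooth_on_open_const[OF assms(1)] smooth_on_open_add)

lemma smooth_on_open_prod:
  fixes f :: "'i \<Rightarrow> 'm \<Rightarrow> complex"
  assumes "open V" "\<And>i. i \<in> I \<Longrightarrow> smooth_on_open \<A> V (f i)"
  shows "smooth_on_open \<A> V (\<lambda>x. \<Prod>i\<in>I. f i x)"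
  using assms(2) by (induction I rule: infinite_finite_induct)
    (auto intro: smooth_on_open_const[OF assms(1)] smooth_on_open_mult)

lemma smooth_on_open_inverse:
  fixes f :: "'m \<Rightarrow> complex"
  assumes "smooth_on_open \<A> V f" "\<And>x. x \<in> V \<Longrightarrow> f x \<noteq> 0"
  shows "smooth_on_open \<A> V (\<lambda>x. inverse (f x))"
proof (rule smooth_on_openI[OF smooth_on_open_open[OF assms(1)]])
  fix U \<phi> assume c: "(U, \<phi>) \<in> \<A>"
  have "inverse (f (inv_into U \<phi> y)) = inverse ((f \<circ> inv_into U \<phi>) y)" for y by simp
  moreover have "(f \<circ> inv_into U \<phi>) y \<noteq> 0" if "y \<in> \<phi> ` (U \<inter> V)" for y
    using that assms(2) chart_inj[OF mfd c] by auto
  ultimately show "Cinf_on (\<phi> ` (U \<inter> V)) ((\<lambda>x. inverse (f x)) \<circ> inv_into U \<phi>)"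
    using Cinf_on_inverse[OF chart_inter_open[OF smooth_on_open_open[OF assms(1)] c]
        smooth_on_open_chart[OF assms(1) c order_refl]]
    by (simp add: o_def)
qed

lemmas smooth_on_open_cnj = smooth_on_open_bounded_linear[OF bounded_linear_cnj]
  and smooth_on_open_of_real = smooth_on_open_bounded_linear[OF bounded_linear_of_real]

lemma smooth_on_open_continuous:
  assumes "smooth_on_open \<A> V f"
  shows "continuous_on V f"
proof (rule continuous_at_imp_continuous_on, rule ballI)
  fix x assume x: "x \<in> V"
  obtain U \<phi> where c: "(U, \<phi>) \<in> \<A>" "x \<in> U" using chart_cover[OF mfd] by blast
  have V: "open V" using assms by (rule smooth_on_open_open)
  have A: "continuous_on (\<phi> ` (U \<inter> V)) (f \<circ> inv_into U \<phi>)"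
    by (rule Cinf_on_continuous[OF smooth_on_open_chart[OF assms c(1) order_refl]])
  have B: "continuous_on (U \<inter> V) \<phi>"
    by (rule continuous_on_subset[OF chart_continuous[OF mfd c(1)]]) simp
  have "continuous_on (U \<inter> V) (\<lambda>x. (f \<circ> inv_into U \<phi>) (\<phi> x))"
    by (rule continuous_on_compose2[OF A B]) simp
  then have "continuous_on (U \<inter> V) f"
    by (rule continuous_on_eq) (use chart_inj[OF mfd c(1)] in auto)
  then show "isCont f x"
    using continuous_on_eq_continuous_at[of "U \<inter> V" f] chart_open[OF mfd c(1)] V x c(2) by auto
qed

text \<open>
  Near each point a nonvanishing function has constant sign.
\<close>

lemma smooth_on_open_abs:
  fixes f :: "'m \<Rightarrow> real"
  assumes "smooth_on_open \<A> V f" "\<And>x. x \<in> V \<Longrightarrow> f x \<noteq> 0"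
  shows "smooth_on_open \<A> V (\<lambda>x. \<bar>f x\<bar>)"
proof (rule smooth_on_open_local)
  show V: "open V" using assms(1) by (rule smooth_on_open_open)
  fix x assume x: "x \<in> V"
  have cont: "continuous_on V f" using smooth_on_open_continuous[OF assms(1)] .
  define P where "P = V \<inter> f -` {0<..}"
  define N where "N = V \<inter> f -` {..<0}"
  have o: "open P" "open N" unfolding P_def N_def
    using cont V by (auto intro: continuous_open_preimage)
  have "smooth_on_open \<A> P (\<lambda>x. \<bar>f x\<bar>)"
    by (rule smooth_on_open_cong[OF smooth_on_open_subset[OF assms(1) o(1)]]) (auto simp: P_def)
  moreover have "smooth_on_open \<A> N (\<lambda>x. \<bar>f x\<bar>)"
    by (rule smooth_on_open_cong[OF smooth_on_open_bounded_linear[OF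
        bounded_linear_minus[OF bounded_linear_ident] smooth_on_open_subset[OF assms(1) o(2)]]])
      (auto simp: N_def)
  moreover have "x \<in> P \<or> x \<in> N" using x assms(2) by (auto simp: P_def N_def not_less less_le)
  ultimately show "\<exists>W. x \<in> W \<and> smooth_on_open \<A> W (\<lambda>x. \<bar>f x\<bar>)" by blast
qed

text \<open>
  By the chain rule, as the transition functions are smooth, one chart suffices.
\<close>

lemma smooth_on_open_in_chart:
  assumes c: "(U, \<phi>) \<in> \<A>" and W: "open W" "W \<subseteq> U" and h: "Cinf_on (\<phi> ` W) h"
  shows "smooth_on_open \<A> W (\<lambda>x. h (\<phi> x))"
proof (rule smooth_on_openI[OF W(1)])
  fix U' \<phi>' assume c': "(U', \<phi>') \<in> \<A>"
  let ?S = "\<phi>' ` (U' \<inter> W)" and ?T = "\<phi> \<circ> inv_into U' \<phi>'"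
  have "compatible (U', \<phi>') (U, \<phi>)" using mfd c c' unfolding closed_manifold_def by blast
  then have "Cinf_on (\<phi>' ` (U' \<inter> U)) ?T" by (simp add: compatible_def transition_def)
  then have T: "Cinf_on ?S ?T" by (rule Cinf_on_subset) (use W in auto)
  have sub: "?T ` ?S \<subseteq> \<phi> ` W" using chart_inj[OF mfd c'] by auto
  have "Cinf_on ?S (\<lambda>x. h (?T x))"
    by (rule Cinf_on_compose[OF chart_inter_open[OF W(1) c'] chart_open_image[OF mfd c W] sub T h])
  then show "Cinf_on ?S ((\<lambda>x. h (\<phi> x)) \<circ> inv_into U' \<phi>')" by (simp add: o_def)
qed

lemma smooth_on_imp_open:
  assumes "smooth_on \<A> S f" "open W" "W \<subseteq> S"
  shows "smooth_on_open \<A> W f"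
proof (rule smooth_on_open_local)
  fix x assume "x \<in> W"
  then obtain V g where V: "x \<in> V" "smooth_on_open \<A> V g" "\<forall>q\<in>V \<inter> S. g q = f q"
    using assms(1,3) unfolding smooth_on_def by blast
  have "open (V \<inter> W)" using smooth_on_open_open[OF V(2)] assms(2) by auto
  then have "smooth_on_open \<A> (V \<inter> W) f"
    using V(3) assms(3) by (intro smooth_on_open_cong[OF smooth_on_open_subset[OF V(2)]]) auto
  then show "\<exists>W. x \<in> W \<and> smooth_on_open \<A> W f" using V(1) \<open>x \<in> W\<close> by blast
qed (rule assms(2))

lemma smooth_on_if_open: "smooth_on_open \<A> V f \<Longrightarrow> S \<subseteq> V \<Longrightarrow> smooth_on \<A> S f"
  unfolding smooth_on_def by blast

lemma smooth_on_open_iff: "open S \<Longrightarrow> smooth_on \<A> S f \<longleftrightarrow> smooth_on_open \<A> S f"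
  using smooth_on_imp_open smooth_on_if_open by blast

subsection \<open>Integration in a chart\<close>

lemma volume_measure_chart:
  assumes "volume_measure \<A> X \<omega> dx" "(U, \<phi>) \<in> \<A>" "S \<in> sets borel" "S \<subseteq> U \<inter> X"
  shows "emeasure dx S = (\<integral>\<^sup>+z\<in>\<phi> ` S. ennreal \<bar>\<omega> (U, \<phi>) (inv_into U \<phi> z)\<bar> \<partial>lborel)"
proof -
  have "\<forall>S\<in>sets borel. S \<subseteq> U \<inter> X \<longrightarrow>
      emeasure dx S = (\<integral>\<^sup>+z\<in>\<phi> ` S. ennreal \<bar>\<omega> (U, \<phi>) (inv_into U \<phi> z)\<bar> \<partial>lborel)"
    using assms(1,2) unfolding volume_measure_def by blast
  then show ?thesis using assms(3,4) by blast
qed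

text \<open>
  On \<open>W\<close> the volume measure is the image of Lebesgue measure with density \<open>|\<omega>|\<close> under the inverse of the
  chart: both measures agree on Borel sets by definition.
\<close>

lemma chart_integral:
  fixes h :: "'m \<Rightarrow> complex"
  assumes vm: "volume_measure \<A> X \<omega> dx" and c: "(U, \<phi>) \<in> \<A>" and W: "open W" "W \<subseteq> U \<inter> X"
    and \<omega>: "continuous_on W (\<omega> (U, \<phi>))" and h: "continuous_on W h"
  shows "(LINT x:W|dx. h x)
    = (LINT z:\<phi> ` W|lborel. complex_of_real \<bar>\<omega> (U, \<phi>) (inv_into U \<phi> z)\<bar> * h (inv_into U \<phi> z))"
proof -
  let ?i = "inv_into U \<phi>" and ?S = "\<phi> ` W"
  define d where "d z = \<bar>\<omega> (U, \<phi>) (?i z)\<bar>" for z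
  have dx: "space dx = UNIV" "sets dx = sets borel" using vm by (auto simp: volume_measure_def)
  have S: "open ?S" using chart_open_image[OF mfd c] W by auto
  have inj: "inj_on \<phi> U" using chart_inj[OF mfd c] .
  have i_im: "?i z \<in> W" if "z \<in> ?S" for z using that inj W(2) by auto
  have i_cont: "continuous_on ?S ?i"
    using chart_inv_continuous[OF mfd c] W(2) by (metis continuous_on_subset image_mono le_inf_iff)
  have d_cont: "continuous_on ?S d" unfolding d_def
    by (intro continuous_intros continuous_on_compose2[OF \<omega> i_cont]) (use i_im in auto)
  have hi_cont: "continuous_on ?S (\<lambda>z. h (?i z))"
    by (rule continuous_on_compose2[OF h i_cont]) (use i_im in auto)
  let ?R = "restrict_space lborel ?S"
  have "sets ?R = sets (restrict_space borel ?S)" by (simp add: sets_restrict_space)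
  note R_meas = measurable_cong_sets[OF this refl]
  have d_meas: "(\<lambda>z. ennreal (d z)) \<in> borel_measurable ?R"
    using borel_measurable_continuous_on_restrict[OF d_cont]
    by (intro measurable_compose[OF _ measurable_ennreal]) (simp add: R_meas)
  have i_meas: "?i \<in> measurable ?R (restrict_space borel W)"
  proof (rule measurable_restrict_space2)
    show "?i \<in> space ?R \<rightarrow> W" using i_im by (auto simp: space_restrict_space)
    have "?i \<in> borel_measurable (restrict_space borel ?S)"
      by (rule borel_measurable_continuous_on_restrict[OF i_cont])
    then show "?i \<in> borel_measurable ?R" by (simp add: R_meas)
  qed
  have eq: "restrict_space dx W = distr (density ?R (\<lambda>z. ennreal (d z))) (restrict_space borel W) ?i"
  proof (rule measure_eqI)
    show "sets (restrict_space dx W) = sets (distr (density ?R (\<lambda>z. ennreal (d z))) (restrict_space borel W) ?i)"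
      by (simp add: sets_restrict_space dx)
    fix B assume "B \<in> sets (restrict_space dx W)"
    then have B: "B \<in> sets borel" "B \<subseteq> W" and BR: "B \<in> sets (restrict_space borel W)"
      using W(1) by (auto simp: sets_restrict_space dx)
    have vi: "?i -` B \<inter> space (density ?R (\<lambda>z. ennreal (d z))) = \<phi> ` B"
      using B(2) W(2) inj by (auto simp: space_restrict_space)
    have im: "\<phi> ` B \<in> sets ?R"
      using measurable_sets[OF i_meas BR] vi by simp
    have "emeasure dx B = (\<integral>\<^sup>+z\<in>\<phi> ` B. ennreal (d z) \<partial>lborel)"
      using B W(2) unfolding d_def by (intro volume_measure_chart[OF vm c]) auto
    also have "\<dots> = (\<integral>\<^sup>+z. (ennreal (d z) * indicator (\<phi> ` B) z) \<partial>?R)"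
      using S subsetD[OF B(2)] by (subst nn_integral_restrict_space)
        (auto intro!: nn_integral_cong simp: indicator_def split: if_splits)
    also have "\<dots> = emeasure (distr (density ?R (\<lambda>z. ennreal (d z))) (restrict_space borel W) ?i) B"
      using i_meas BR im vi d_meas by (simp add: emeasure_distr emeasure_density)
    finally show "emeasure (restrict_space dx W) B
        = emeasure (distr (density ?R (\<lambda>z. ennreal (d z))) (restrict_space borel W) ?i) B"
      using B W(1) by (simp add: emeasure_restrict_space dx)
  qed
  have h_meas: "h \<in> borel_measurable (restrict_space borel W)"
    by (rule borel_measurable_continuous_on_restrict[OF h])
  have "(LINT x:W|dx. h x) = (LINT x|restrict_space dx W. h x)"
    using W(1) by (subst integral_restrict_space) (auto simp: dx set_lebesgue_integral_def)
  also have "\<dots> = (LINT z|density ?R (\<lambda>z. ennreal (d z)). h (?i z))"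
    unfolding eq by (rule integral_distr) (use i_meas h_meas in auto)
  also have "\<dots> = (LINT z|?R. d z *\<^sub>R h (?i z))"
  proof (rule integral_density)
    show "(\<lambda>z. h (?i z)) \<in> borel_measurable ?R" using measurable_compose[OF i_meas h_meas] .
    have "d \<in> borel_measurable (restrict_space borel ?S)"
      by (rule borel_measurable_continuous_on_restrict[OF d_cont])
    then show "d \<in> borel_measurable ?R" by (simp add: R_meas)
  qed (simp add: d_def)
  also have "\<dots> = (LINT z:?S|lborel. d z *\<^sub>R h (?i z))"
    using S by (subst integral_restrict_space) (auto simp: set_lebesgue_integral_def)
  finally show ?thesis by (simp add: d_def scaleR_conv_of_real)
qed

lemma volume_finite_near:
  assumes vf: "volume_form \<A> X \<omega>" and vm: "volume_measure \<A> X \<omega> dx" and p: "p \<in> interior X"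
  obtains W where "open W" "p \<in> W" "W \<subseteq> X" "emeasure dx W < \<infinity>"
proof -
  obtain U \<phi> where c: "(U, \<phi>) \<in> \<A>" "p \<in> U" using chart_cover[OF mfd] by blast
  let ?U = "U \<inter> interior X"
  have oU: "open U" "open ?U" using chart_open[OF mfd c(1)] by auto
  have inj: "inj_on \<phi> U" using chart_inj[OF mfd c(1)] .
  have S: "open (\<phi> ` ?U)" using chart_open_image[OF mfd c(1) oU(2)] by auto
  then obtain r where r: "r > 0" "cball (\<phi> p) r \<subseteq> \<phi> ` ?U"
    using c(2) p open_contains_cball by blast
  define W where "W = {x \<in> U. \<phi> x \<in> ball (\<phi> p) r}"
  have imW: "\<phi> ` W = ball (\<phi> p) r"
  proof -
    have "ball (\<phi> p) r \<subseteq> \<phi> ` U" using r ball_subset_cball by blast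
    then show ?thesis by (auto simp: W_def)
  qed
  have Wsub: "W \<subseteq> ?U"
  proof
    fix x assume x: "x \<in> W"
    then have "\<phi> x \<in> \<phi> ` ?U" using r ball_subset_cball by (auto simp: W_def)
    then show "x \<in> ?U" using inj x by (auto simp: W_def dest: inj_onD)
  qed
  have W: "open W"
    using continuous_open_preimage[OF chart_continuous[OF mfd c(1)] oU(1) open_ball[of "\<phi> p" r]]
    by (simp add: W_def vimage_def Int_def)
  let ?d = "\<lambda>z. \<bar>\<omega> (U, \<phi>) (inv_into U \<phi> z)\<bar>"
  have "smooth_on \<A> (U \<inter> X) (\<omega> (U, \<phi>))" using vf c(1) unfolding volume_form_def by (metis fst_conv)
  then have "smooth_on_open \<A> ?U (\<omega> (U, \<phi>))"
    by (rule smooth_on_imp_open[OF _ oU(2)]) (use interior_subset in auto)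
  then have "continuous_on (\<phi> ` ?U) (\<omega> (U, \<phi>) \<circ> inv_into U \<phi>)"
    by (intro Cinf_on_continuous smooth_on_open_chart[OF _ c(1)]) auto
  then have "continuous_on (cball (\<phi> p) r) ?d"
    using r(2) by (intro continuous_intros) (auto simp: o_def intro: continuous_on_subset)
  then obtain b where b: "\<And>z. z \<in> cball (\<phi> p) r \<Longrightarrow> ?d z \<le> b"
    using compact_continuous_image[OF _ compact_cball] compact_imp_bounded bounded_iff
    by (metis (no_types, lifting) abs_idempotent image_eqI real_norm_def)
  have "emeasure dx W = (\<integral>\<^sup>+z\<in>\<phi> ` W. ennreal (?d z) \<partial>lborel)"
    using W Wsub interior_subset[of X] by (intro volume_measure_chart[OF vm c(1)]) auto
  also have "\<dots> \<le> (\<integral>\<^sup>+z. ennreal b * indicator (ball (\<phi> p) r) z \<partial>lborel)"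
    unfolding imW using b by (intro nn_integral_mono) (auto simp: indicator_def ennreal_leI)
  also have "\<dots> = ennreal b * emeasure lborel (ball (\<phi> p) r)"
    by (simp add: nn_integral_cmult_indicator)
  also have "\<dots> < \<infinity>"
    using emeasure_bounded_finite[OF bounded_ball, of "\<phi> p" r] by (simp add: ennreal_mult_less_top)
  finally have "emeasure dx W < \<infinity>" .
  moreover have "p \<in> W" using c r by (auto simp: W_def)
  ultimately show ?thesis using that W Wsub interior_subset by blast
qed

text \<open>
  Every point of \<open>interior X\<close> has a neighbourhood of finite measure, namely the preimage of a small ball,
  on which the density is bounded; finitely many of these cover \<open>K\<close>.
\<close>

lemma volume_finite_on_compact:
  assumes vf: "volume_form \<A> X \<omega>" and vm: "volume_measure \<A> X \<omega> dx"
    and K: "compact K" "K \<subseteq> interior X" and D: "D \<in> sets borel" "D \<subseteq> K"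
  shows "emeasure dx D < \<infinity>"
proof -
  have dx: "sets dx = sets borel" using vm by (auto simp: volume_measure_def)
  have "\<forall>p\<in>K. \<exists>W. open W \<and> p \<in> W \<and> emeasure dx W < \<infinity>"
    using volume_finite_near[OF vf vm] K(2) by (metis subsetD)
  then obtain W where W: "\<And>p. p \<in> K \<Longrightarrow> open (W p) \<and> p \<in> W p \<and> emeasure dx (W p) < \<infinity>"
    by metis
  then have "K \<subseteq> (\<Union>p\<in>K. W p)" by auto
  then obtain C where C: "C \<subseteq> K" "finite C" "K \<subseteq> (\<Union>p\<in>C. W p)"
    using compactE_image[OF K(1), of K W] W by metis
  have "emeasure dx D \<le> emeasure dx (\<Union>p\<in>C. W p)"
    using D C W by (intro emeasure_mono) (auto simp: dx intro!: borel_open open_UN dest: subsetD)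
  also have "\<dots> \<le> (\<Sum>p\<in>C. emeasure dx (W p))"
    using C W by (intro emeasure_subadditive_finite) (auto simp: dx)
  also have "\<dots> < \<infinity>" using C W by (auto simp: subset_iff)
  finally show ?thesis .
qed

end

section \<open>Vector bundles and Hermitian metrics\<close>

definition sec_scale ::
  "('m, 'e, 'z) vbundle_scheme \<Rightarrow> ('m \<Rightarrow> complex) \<Rightarrow> ('m \<Rightarrow> 'e) \<Rightarrow> 'm \<Rightarrow> 'e" where
  "sec_scale E h u = (\<lambda>x. inv_into (fib E x) (fib_coord E x) (h x \<cdot>\<^sub>v fib_coord E x (u x)))"

lemma smooth_on_mono: "smooth_on \<A> S f \<Longrightarrow> T \<subseteq> S \<Longrightarrow> smooth_on \<A> T f"
  unfolding smooth_on_def by (metis IntD1 IntD2 IntI subsetD)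

locale vbundle_over =
  fixes \<A> :: "('m::{t2_space, second_countable_topology}, 'n::finite) chart set" and X :: "'m set"
    and E :: "('m, 'e, 'z) vbundle_scheme"
  assumes mfd: "closed_manifold \<A>" and vb: "vector_bundle \<A> X E"
begin

lemma triv_cover: "x \<in> X \<Longrightarrow> \<exists>V \<tau>. (V, \<tau>) \<in> trv E \<and> x \<in> V"
proof -
  assume "x \<in> X"
  moreover have "X \<subseteq> \<Union> (fst ` trv E)" using vb unfolding vector_bundle_def by (elim conjE)
  ultimately show ?thesis by force
qed

lemma triv_props:
  assumes "(V, \<tau>) \<in> trv E"
  shows triv_openin: "openin (top_of_set X) V"
    and triv_bij: "x \<in> V \<Longrightarrow> bij_betw (\<tau> x) (fib E x) (carrier_vec (rnk E))"
proof -
  have "\<forall>(V, \<tau>)\<in>trv E. openin (top_of_set X) V \<and>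
        (\<forall>x\<in>V. bij_betw (\<tau> x) (fib E x) (carrier_vec (rnk E)))"
    using vb unfolding vector_bundle_def by (elim conjE)
  from bspec[OF this assms] show "openin (top_of_set X) V"
    "x \<in> V \<Longrightarrow> bij_betw (\<tau> x) (fib E x) (carrier_vec (rnk E))" by simp_all
qed

lemma triv_sub: "(V, \<tau>) \<in> trv E \<Longrightarrow> V \<subseteq> X"
  using triv_openin openin_imp_subset by blast

lemma triv_open: "(V, \<tau>) \<in> trv E \<Longrightarrow> open W \<Longrightarrow> W \<subseteq> X \<Longrightarrow> open (V \<inter> W)"
proof -
  assume "(V, \<tau>) \<in> trv E" "open W" "W \<subseteq> X"
  then obtain T where T: "open T" "V = X \<inter> T" using triv_openin openin_open by metis
  then have "V \<inter> W = T \<inter> W" using \<open>W \<subseteq> X\<close> by auto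
  then show ?thesis using T \<open>open W\<close> by auto
qed

lemma triv_carrier: "(V, \<tau>) \<in> trv E \<Longrightarrow> x \<in> V \<Longrightarrow> a \<in> fib E x \<Longrightarrow> \<tau> x a \<in> carrier_vec (rnk E)"
  using triv_bij bij_betw_apply by metis

lemma triv_eqI: "(V, \<tau>) \<in> trv E \<Longrightarrow> x \<in> V \<Longrightarrow> a \<in> fib E x \<Longrightarrow> b \<in> fib E x \<Longrightarrow> \<tau> x a = \<tau> x b \<Longrightarrow> a = b"
  using triv_bij[of V \<tau> x] unfolding bij_betw_def inj_on_def by blast

lemma triv_change:
  assumes "(V, \<tau>) \<in> trv E" "(V', \<tau>') \<in> trv E"
  obtains g where "\<And>x. x \<in> V \<inter> V' \<Longrightarrow> g x \<in> carrier_mat (rnk E) (rnk E)"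
    "\<And>x a. x \<in> V \<inter> V' \<Longrightarrow> a \<in> fib E x \<Longrightarrow> \<tau>' x a = g x *\<^sub>v \<tau> x a"
    "\<And>i j. i < rnk E \<Longrightarrow> j < rnk E \<Longrightarrow> smooth_on \<A> (V \<inter> V') (\<lambda>x. g x $$ (i, j))"
proof -
  have "\<forall>(V, \<tau>)\<in>trv E. \<forall>(V', \<tau>')\<in>trv E. \<exists>g.
        (\<forall>x\<in>V \<inter> V'. g x \<in> carrier_mat (rnk E) (rnk E) \<and> invertible_mat (g x) \<and>
           (\<forall>a\<in>fib E x. \<tau>' x a = g x *\<^sub>v \<tau> x a)) \<and>
        (\<forall>i<rnk E. \<forall>j<rnk E. smooth_on \<A> (V \<inter> V') (\<lambda>x. g x $$ (i, j)))"
    using vb unfolding vector_bundle_def by (elim conjE)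
  from bspec[OF this assms(1), unfolded case_prod_conv, THEN bspec, OF assms(2), unfolded case_prod_conv]
  obtain g where "\<forall>x\<in>V \<inter> V'. g x \<in> carrier_mat (rnk E) (rnk E) \<and> invertible_mat (g x) \<and>
      (\<forall>a\<in>fib E x. \<tau>' x a = g x *\<^sub>v \<tau> x a)"
    "\<forall>i<rnk E. \<forall>j<rnk E. smooth_on \<A> (V \<inter> V') (\<lambda>x. g x $$ (i, j))"
    by (elim exE conjE)
  then show ?thesis by (intro that[of g]) simp_all
qed

lemma fib_coord_triv: "x \<in> X \<Longrightarrow> \<exists>V \<tau>. (V, \<tau>) \<in> trv E \<and> x \<in> V \<and> fib_coord E x = \<tau> x"
proof -
  assume "x \<in> X"
  then have "\<exists>c. c \<in> trv E \<and> x \<in> fst c" using triv_cover[of x] by force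
  then have "(SOME c. c \<in> trv E \<and> x \<in> fst c) \<in> trv E \<and> x \<in> fst (SOME c. c \<in> trv E \<and> x \<in> fst c)"
    by (rule someI_ex)
  then show ?thesis unfolding fib_coord_def
    by (cases "SOME c. c \<in> trv E \<and> x \<in> fst c") auto
qed

lemma fib_coord_bij: "x \<in> X \<Longrightarrow> bij_betw (fib_coord E x) (fib E x) (carrier_vec (rnk E))"
  using fib_coord_triv[of x] triv_bij by fastforce

lemma fib_coord_carrier: "x \<in> X \<Longrightarrow> a \<in> fib E x \<Longrightarrow> fib_coord E x a \<in> carrier_vec (rnk E)"
  using fib_coord_bij bij_betw_apply by metis

lemma fib_vec:
  assumes "x \<in> X" "c \<in> carrier_vec (rnk E)"
  shows fib_vec_in: "inv_into (fib E x) (fib_coord E x) c \<in> fib E x"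
    and fib_vec_coord: "fib_coord E x (inv_into (fib E x) (fib_coord E x) c) = c"
proof -
  have c: "c \<in> fib_coord E x ` fib E x" using fib_coord_bij[OF assms(1)] assms(2) by (simp add: bij_betw_def)
  show "inv_into (fib E x) (fib_coord E x) c \<in> fib E x" by (rule inv_into_into[OF c])
  show "fib_coord E x (inv_into (fib E x) (fib_coord E x) c) = c" by (rule f_inv_into_f[OF c])
qed

text \<open>
  In every trivialisation the coordinates are a matrix times the distinguished ones \<open>fib_coord\<close>, so
  the linear structure of the fibres does not depend on the trivialisation.
\<close>

lemma triv_change_coord:
  assumes "(V, \<tau>) \<in> trv E" "x \<in> V"
  obtains g where "g \<in> carrier_mat (rnk E) (rnk E)"
    "\<And>a. a \<in> fib E x \<Longrightarrow> \<tau> x a = g *\<^sub>v fib_coord E x a"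
proof -
  have "x \<in> X" using assms triv_sub by blast
  then obtain V0 \<tau>0 where c: "(V0, \<tau>0) \<in> trv E" "x \<in> V0" "fib_coord E x = \<tau>0 x"
    using fib_coord_triv by blast
  obtain g where "g x \<in> carrier_mat (rnk E) (rnk E)" "\<And>a. a \<in> fib E x \<Longrightarrow> \<tau> x a = g x *\<^sub>v \<tau>0 x a"
    using triv_change[OF c(1) assms(1)] c(2) assms(2) by (metis IntI)
  then show ?thesis using that c(3) by metis
qed

lemma sec_diff_triv:
  assumes "(V, \<tau>) \<in> trv E" "x \<in> V" "u x \<in> fib E x" "v x \<in> fib E x"
  shows sec_diff_fib: "sec_diff E u v x \<in> fib E x"
    and triv_sec_diff: "\<tau> x (sec_diff E u v x) = \<tau> x (u x) - \<tau> x (v x)"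
proof -
  have x: "x \<in> X" using assms triv_sub by blast
  have c: "fib_coord E x (u x) - fib_coord E x (v x) \<in> carrier_vec (rnk E)"
    using fib_coord_carrier[OF x] assms by simp
  show s: "sec_diff E u v x \<in> fib E x" unfolding sec_diff_def by (rule fib_vec_in[OF x c])
  obtain g where g: "g \<in> carrier_mat (rnk E) (rnk E)"
    "\<And>a. a \<in> fib E x \<Longrightarrow> \<tau> x a = g *\<^sub>v fib_coord E x a"
    using triv_change_coord[OF assms(1,2)] by blast
  have "fib_coord E x (sec_diff E u v x) = fib_coord E x (u x) - fib_coord E x (v x)"
    unfolding sec_diff_def by (rule fib_vec_coord[OF x c])
  then show "\<tau> x (sec_diff E u v x) = \<tau> x (u x) - \<tau> x (v x)"
    using g(2)[OF s] g(2)[OF assms(3)] g(2)[OF assms(4)]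
      mult_minus_distrib_mat_vec[OF g(1) fib_coord_carrier[OF x assms(3)] fib_coord_carrier[OF x assms(4)]]
    by simp
qed

lemma sec_diff_comp:
  assumes "(V, \<tau>) \<in> trv E" "x \<in> V" "u x \<in> fib E x" "v x \<in> fib E x" "i < rnk E"
  shows "\<tau> x (sec_diff E u v x) $ i = \<tau> x (u x) $ i - \<tau> x (v x) $ i"
  using triv_sec_diff[of V \<tau> x u v, OF assms(1-4)] triv_carrier[OF assms(1,2,4)] assms(5) by simp

lemma sec_scale_triv:
  assumes "(V, \<tau>) \<in> trv E" "x \<in> V" "u x \<in> fib E x"
  shows sec_scale_fib: "sec_scale E h u x \<in> fib E x"
    and triv_sec_scale: "\<tau> x (sec_scale E h u x) = h x \<cdot>\<^sub>v \<tau> x (u x)"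
proof -
  have x: "x \<in> X" using assms triv_sub by blast
  have c: "h x \<cdot>\<^sub>v fib_coord E x (u x) \<in> carrier_vec (rnk E)"
    using fib_coord_carrier[OF x] assms by simp
  show s: "sec_scale E h u x \<in> fib E x" unfolding sec_scale_def by (rule fib_vec_in[OF x c])
  obtain g where g: "g \<in> carrier_mat (rnk E) (rnk E)"
    "\<And>a. a \<in> fib E x \<Longrightarrow> \<tau> x a = g *\<^sub>v fib_coord E x a"
    using triv_change_coord[OF assms(1,2)] by blast
  have "fib_coord E x (sec_scale E h u x) = h x \<cdot>\<^sub>v fib_coord E x (u x)"
    unfolding sec_scale_def by (rule fib_vec_coord[OF x c])
  then show "\<tau> x (sec_scale E h u x) = h x \<cdot>\<^sub>v \<tau> x (u x)"
    using g(2)[OF s] g(2)[OF assms(3)] mult_mat_vec[OF g(1) fib_coord_carrier[OF x assms(3)]] by simp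
qed

lemma sec_scale_comp:
  assumes "(V, \<tau>) \<in> trv E" "x \<in> V" "u x \<in> fib E x" "i < rnk E"
  shows "\<tau> x (sec_scale E h u x) $ i = h x * \<tau> x (u x) $ i"
  using triv_sec_scale[of V \<tau> x u h, OF assms(1-3)] triv_carrier[OF assms(1-3)] assms(4) by simp

lemma fib_zero_triv:
  assumes "(V, \<tau>) \<in> trv E" "x \<in> V"
  shows fib_zero_in: "fib_zero E x \<in> fib E x"
    and triv_fib_zero: "\<tau> x (fib_zero E x) = 0\<^sub>v (rnk E)"
proof -
  have x: "x \<in> X" using assms triv_sub by blast
  show s: "fib_zero E x \<in> fib E x" unfolding fib_zero_def by (rule fib_vec_in[OF x]) simp
  obtain g where g: "g \<in> carrier_mat (rnk E) (rnk E)"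
    "\<And>a. a \<in> fib E x \<Longrightarrow> \<tau> x a = g *\<^sub>v fib_coord E x a"
    using triv_change_coord[OF assms] by blast
  have "fib_coord E x (fib_zero E x) = 0\<^sub>v (rnk E)"
    unfolding fib_zero_def by (rule fib_vec_coord[OF x]) simp
  then show "\<tau> x (fib_zero E x) = 0\<^sub>v (rnk E)"
    using g by (simp add: s mult_mat_vec_def[of g] scalar_prod_def) (auto simp: zero_vec_def)
qed

lemma triv_eq_zero:
  assumes "(V, \<tau>) \<in> trv E" "x \<in> V" "a \<in> fib E x" "\<And>i. i < rnk E \<Longrightarrow> \<tau> x a $ i = 0"
  shows "a = fib_zero E x"
proof -
  have "\<tau> x a = 0\<^sub>v (rnk E)" using triv_carrier[OF assms(1-3)] assms(4) by (intro eq_vecI) auto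
  then show ?thesis
    using triv_eqI[OF assms(1-3) fib_zero_in[OF assms(1,2)]] triv_fib_zero[OF assms(1,2)] by simp
qed

lemma smooth_section_comp:
  assumes "smooth_section \<A> E W u" "open W" "W \<subseteq> X" "(V, \<tau>) \<in> trv E" "i < rnk E"
  shows "smooth_on_open \<A> (V \<inter> W) (\<lambda>x. \<tau> x (u x) $ i)"
proof -
  have "\<forall>(V, \<tau>)\<in>trv E. \<forall>i<rnk E. smooth_on \<A> (V \<inter> W) (\<lambda>x. \<tau> x (u x) $ i)"
    using assms(1) unfolding smooth_section_def by (elim conjE)
  from bspec[OF this assms(4)] assms(5) show ?thesis
    by (simp add: smooth_on_open_iff[OF mfd triv_open[OF assms(4,2,3)]])
qed

lemma smooth_sectionI:
  assumes "open W" "W \<subseteq> X" "\<And>x. x \<in> W \<Longrightarrow> u x \<in> fib E x"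
    and "\<And>V \<tau> i. (V, \<tau>) \<in> trv E \<Longrightarrow> i < rnk E \<Longrightarrow> smooth_on_open \<A> (V \<inter> W) (\<lambda>x. \<tau> x (u x) $ i)"
  shows "smooth_section \<A> E W u"
  using assms(3) by (auto simp: smooth_section_def intro!: smooth_on_if_open[OF mfd assms(4)])

lemma smooth_section_fib: "smooth_section \<A> E W u \<Longrightarrow> x \<in> W \<Longrightarrow> u x \<in> fib E x"
  by (simp add: smooth_section_def)

lemma smooth_section_subset:
  assumes "smooth_section \<A> E W u" "W' \<subseteq> W"
  shows "smooth_section \<A> E W' u"
proof -
  have "smooth_on \<A> (V \<inter> W') (\<lambda>x. \<tau> x (u x) $ i)"
    if "(V, \<tau>) \<in> trv E" "i < rnk E" for V \<tau> i
  proof -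
    have "smooth_on \<A> (V \<inter> W) (\<lambda>x. \<tau> x (u x) $ i)"
      using assms(1) that by (auto simp: smooth_section_def)
    then show ?thesis by (rule smooth_on_mono) (use assms(2) in auto)
  qed
  then show ?thesis using assms by (auto simp: smooth_section_def)
qed

lemma smooth_section_diff:
  assumes "smooth_section \<A> E W u" "smooth_section \<A> E W v" "open W" "W \<subseteq> X"
  shows "smooth_section \<A> E W (sec_diff E u v)"
proof (rule smooth_sectionI[OF assms(3,4)])
  fix x assume x: "x \<in> W"
  then obtain V \<tau> where "(V, \<tau>) \<in> trv E" "x \<in> V" using triv_cover assms(4) by blast
  then show "sec_diff E u v x \<in> fib E x"
    using sec_diff_fib smooth_section_fib[OF assms(1) x] smooth_section_fib[OF assms(2) x] by blast
next
  fix V \<tau> i assume t: "(V, \<tau>) \<in> trv E" "i < rnk E"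
  show "smooth_on_open \<A> (V \<inter> W) (\<lambda>x. \<tau> x (sec_diff E u v x) $ i)"
    by (rule smooth_on_open_cong[OF mfd smooth_on_open_diff[OF mfd
            smooth_section_comp[OF assms(1,3,4) t] smooth_section_comp[OF assms(2,3,4) t]]])
      (use sec_diff_comp[OF t(1) _ _ _ t(2)] smooth_section_fib[OF assms(1)]
        smooth_section_fib[OF assms(2)] in auto)
qed

text \<open>
  The coordinates in any other trivialisation are combinations of the given ones with smooth coefficients.
\<close>

lemma smooth_section_local:
  assumes "open W" "W \<subseteq> X" "\<And>x. x \<in> W \<Longrightarrow> u x \<in> fib E x"
    and "\<And>x. x \<in> W \<Longrightarrow> \<exists>V \<tau> O'. (V, \<tau>) \<in> trv E \<and> x \<in> O' \<and> O' \<subseteq> V \<inter> W \<and>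
      (\<forall>i<rnk E. smooth_on_open \<A> O' (\<lambda>x. \<tau> x (u x) $ i))"
  shows "smooth_section \<A> E W u"
proof (rule smooth_sectionI[OF assms(1-3)])
  fix V' \<tau>' i assume t: "(V', \<tau>') \<in> trv E" "i < rnk E"
  have o: "open (V' \<inter> W)" by (rule triv_open[OF t(1) assms(1,2)])
  show "smooth_on_open \<A> (V' \<inter> W) (\<lambda>x. \<tau>' x (u x) $ i)"
  proof (rule smooth_on_open_local[OF mfd _ o])
    fix x assume x: "x \<in> V' \<inter> W"
    then obtain V \<tau> O' where V: "(V, \<tau>) \<in> trv E" "x \<in> O'" "O' \<subseteq> V \<inter> W"
      "\<And>i. i < rnk E \<Longrightarrow> smooth_on_open \<A> O' (\<lambda>x. \<tau> x (u x) $ i)"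
      using assms(4) by (metis IntD2)
    obtain g where g: "\<And>x. x \<in> V \<inter> V' \<Longrightarrow> g x \<in> carrier_mat (rnk E) (rnk E)"
      "\<And>x a. x \<in> V \<inter> V' \<Longrightarrow> a \<in> fib E x \<Longrightarrow> \<tau>' x a = g x *\<^sub>v \<tau> x a"
      "\<And>i j. i < rnk E \<Longrightarrow> j < rnk E \<Longrightarrow> smooth_on \<A> (V \<inter> V') (\<lambda>x. g x $$ (i, j))"
      using triv_change[OF V(1) t(1)] by blast
    let ?P = "V' \<inter> O'"
    have "open O'" using V(4) smooth_on_open_open t(2) by blast
    moreover have "?P = (V' \<inter> W) \<inter> O'" using V(3) by auto
    ultimately have P: "open ?P" using o by auto
    have "smooth_on_open \<A> ?P (\<lambda>x. \<Sum>j\<in>{0..<rnk E}. g x $$ (i, j) * \<tau> x (u x) $ j)"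
    proof (intro smooth_on_open_sum[OF mfd P] smooth_on_open_mult[OF mfd])
      fix j assume j: "j \<in> {0..<rnk E}"
      show "smooth_on_open \<A> ?P (\<lambda>x. g x $$ (i, j))"
        by (rule smooth_on_imp_open[OF mfd g(3)[OF t(2)] P]) (use j V(3) in auto)
      show "smooth_on_open \<A> ?P (\<lambda>x. \<tau> x (u x) $ j)"
        by (rule smooth_on_open_subset[OF mfd V(4) P]) (use j in auto)
    qed
    then have "smooth_on_open \<A> ?P (\<lambda>x. \<tau>' x (u x) $ i)"
    proof (rule smooth_on_open_cong[OF mfd])
      fix y assume y: "y \<in> ?P"
      then have yV: "y \<in> V \<inter> V'" "u y \<in> fib E y" using V(3) assms(3) by auto
      show "(\<Sum>j\<in>{0..<rnk E}. g y $$ (i, j) * \<tau> y (u y) $ j) = \<tau>' y (u y) $ i"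
        using g(2)[OF yV] g(1)[OF yV(1)] t(2) triv_carrier[OF V(1) _ yV(2)] yV(1)
        by (simp add: scalar_prod_def)
    qed
    then show "\<exists>W. x \<in> W \<and> smooth_on_open \<A> W (\<lambda>x. \<tau>' x (u x) $ i)" using x V(2) by blast
  qed
qed

end

locale hbundle_over =
  fixes \<A> :: "('m::{t2_space, second_countable_topology}, 'n::finite) chart set" and X :: "'m set"
    and E :: "('m, 'e, 'z) hbundle_scheme"
  assumes mfd': "closed_manifold \<A>" and hbundle: "hermitian_bundle \<A> X E"

sublocale hbundle_over \<subseteq> vbundle_over \<A> X E
  using mfd' hbundle by unfold_locales (auto simp: hermitian_bundle_def)

context hbundle_over
begin

definition gram :: "('m, 'e) triv \<Rightarrow> 'm \<Rightarrow> complex mat" where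
  "gram c = (SOME H. (\<forall>x\<in>fst c. H x \<in> carrier_mat (rnk E) (rnk E) \<and>
           (\<forall>a\<in>fib E x. \<forall>b\<in>fib E x. met E x a b = (H x *\<^sub>v snd c x a) \<bullet>c snd c x b)) \<and>
        (\<forall>i<rnk E. \<forall>j<rnk E. smooth_on \<A> (fst c) (\<lambda>x. H x $$ (i, j))))"

lemma metric_props:
  assumes "(V, \<tau>) \<in> trv E"
  shows gram_carrier: "x \<in> V \<Longrightarrow> gram (V, \<tau>) x \<in> carrier_mat (rnk E) (rnk E)"
    and met_gram: "x \<in> V \<Longrightarrow> a \<in> fib E x \<Longrightarrow> b \<in> fib E x \<Longrightarrow>
      met E x a b = (gram (V, \<tau>) x *\<^sub>v \<tau> x a) \<bullet>c \<tau> x b"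
    and gram_smooth: "i < rnk E \<Longrightarrow> j < rnk E \<Longrightarrow> smooth_on \<A> V (\<lambda>x. gram (V, \<tau>) x $$ (i, j))"
    and met_sym_triv: "x \<in> V \<Longrightarrow> a \<in> fib E x \<Longrightarrow> b \<in> fib E x \<Longrightarrow> met E x b a = cnj (met E x a b)"
    and met_pos_triv: "x \<in> V \<Longrightarrow> a \<in> fib E x \<Longrightarrow> \<tau> x a \<noteq> 0\<^sub>v (rnk E) \<Longrightarrow> 0 < Re (met E x a a)"
proof -
  have "\<forall>(V, \<tau>)\<in>trv E. \<exists>H.
        (\<forall>x\<in>V. H x \<in> carrier_mat (rnk E) (rnk E) \<and>
           (\<forall>a\<in>fib E x. \<forall>b\<in>fib E x. met E x a b = (H x *\<^sub>v \<tau> x a) \<bullet>c \<tau> x b)) \<and>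
        (\<forall>i<rnk E. \<forall>j<rnk E. smooth_on \<A> V (\<lambda>x. H x $$ (i, j))) \<and>
        (\<forall>x\<in>V. \<forall>a\<in>fib E x. \<forall>b\<in>fib E x. met E x b a = cnj (met E x a b)) \<and>
        (\<forall>x\<in>V. \<forall>a\<in>fib E x. \<tau> x a \<noteq> 0\<^sub>v (rnk E) \<longrightarrow> 0 < Re (met E x a a))"
    using hbundle unfolding hermitian_bundle_def by (elim conjE)
  from bspec[OF this assms, unfolded case_prod_conv]
  obtain H where H: "(\<forall>x\<in>V. H x \<in> carrier_mat (rnk E) (rnk E) \<and>
           (\<forall>a\<in>fib E x. \<forall>b\<in>fib E x. met E x a b = (H x *\<^sub>v \<tau> x a) \<bullet>c \<tau> x b)) \<and>
        (\<forall>i<rnk E. \<forall>j<rnk E. smooth_on \<A> V (\<lambda>x. H x $$ (i, j)))"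
    and rest: "\<forall>x\<in>V. \<forall>a\<in>fib E x. \<forall>b\<in>fib E x. met E x b a = cnj (met E x a b)"
      "\<forall>x\<in>V. \<forall>a\<in>fib E x. \<tau> x a \<noteq> 0\<^sub>v (rnk E) \<longrightarrow> 0 < Re (met E x a a)"
    by blast
  have G: "(\<forall>x\<in>V. gram (V, \<tau>) x \<in> carrier_mat (rnk E) (rnk E) \<and>
           (\<forall>a\<in>fib E x. \<forall>b\<in>fib E x. met E x a b = (gram (V, \<tau>) x *\<^sub>v \<tau> x a) \<bullet>c \<tau> x b)) \<and>
        (\<forall>i<rnk E. \<forall>j<rnk E. smooth_on \<A> V (\<lambda>x. gram (V, \<tau>) x $$ (i, j)))"
    unfolding gram_def fst_conv snd_conv by (rule someI[of _ H]) (rule H)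
  show "x \<in> V \<Longrightarrow> gram (V, \<tau>) x \<in> carrier_mat (rnk E) (rnk E)" using G by blast
  show "x \<in> V \<Longrightarrow> a \<in> fib E x \<Longrightarrow> b \<in> fib E x \<Longrightarrow> met E x a b = (gram (V, \<tau>) x *\<^sub>v \<tau> x a) \<bullet>c \<tau> x b"
    using G by blast
  show "i < rnk E \<Longrightarrow> j < rnk E \<Longrightarrow> smooth_on \<A> V (\<lambda>x. gram (V, \<tau>) x $$ (i, j))" using G by blast
  show "x \<in> V \<Longrightarrow> a \<in> fib E x \<Longrightarrow> b \<in> fib E x \<Longrightarrow> met E x b a = cnj (met E x a b)" using rest by blast
  show "x \<in> V \<Longrightarrow> a \<in> fib E x \<Longrightarrow> \<tau> x a \<noteq> 0\<^sub>v (rnk E) \<Longrightarrow> 0 < Re (met E x a a)" using rest by blast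
qed

lemma met_expand:
  assumes "(V, \<tau>) \<in> trv E" "x \<in> V" "a \<in> fib E x" "b \<in> fib E x"
  shows "met E x a b = (\<Sum>i<rnk E. (\<Sum>j<rnk E. gram (V, \<tau>) x $$ (i, j) * \<tau> x a $ j) * cnj (\<tau> x b $ i))"
  using triv_carrier[OF assms(1,2,3)] triv_carrier[OF assms(1,2,4)] gram_carrier[OF assms(1,2)]
  by (simp add: met_gram[OF assms] scalar_prod_def lessThan_atLeast0)

lemma met_sym: "x \<in> X \<Longrightarrow> a \<in> fib E x \<Longrightarrow> b \<in> fib E x \<Longrightarrow> met E x b a = cnj (met E x a b)"
  using triv_cover met_sym_triv by metis

lemma met_zero_left: "x \<in> X \<Longrightarrow> b \<in> fib E x \<Longrightarrow> met E x (fib_zero E x) b = 0"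
  by (drule triv_cover, elim exE conjE) (simp add: met_expand fib_zero_in triv_fib_zero)

lemma met_zero_right: "x \<in> X \<Longrightarrow> b \<in> fib E x \<Longrightarrow> met E x b (fib_zero E x) = 0"
  by (drule triv_cover, elim exE conjE) (simp add: met_expand fib_zero_in triv_fib_zero)

lemma met_nonneg: "x \<in> X \<Longrightarrow> a \<in> fib E x \<Longrightarrow> 0 \<le> Re (met E x a a)"
proof -
  assume x: "x \<in> X" and a: "a \<in> fib E x"
  obtain V \<tau> where t: "(V, \<tau>) \<in> trv E" "x \<in> V" using triv_cover[OF x] by blast
  show ?thesis
  proof (cases "\<tau> x a = 0\<^sub>v (rnk E)")
    case True
    then show ?thesis by (simp add: met_expand[OF t a a])
  qed (use met_pos_triv[OF t a] in simp)
qed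

lemma met_Im: "x \<in> X \<Longrightarrow> a \<in> fib E x \<Longrightarrow> met E x a a = complex_of_real (Re (met E x a a))"
  using met_sym[of x a a] by (metis Reals_cnj_iff of_real_Re)

lemma met_definite: "x \<in> X \<Longrightarrow> a \<in> fib E x \<Longrightarrow> Re (met E x a a) = 0 \<Longrightarrow> a = fib_zero E x"
proof -
  assume x: "x \<in> X" and a: "a \<in> fib E x" and z: "Re (met E x a a) = 0"
  obtain V \<tau> where t: "(V, \<tau>) \<in> trv E" "x \<in> V" using triv_cover[OF x] by blast
  then have "\<tau> x a = 0\<^sub>v (rnk E)" using met_pos_triv[OF t a] z by auto
  then show ?thesis using triv_eq_zero[OF t a] by simp
qed

lemma met_diff_left:
  assumes "x \<in> X" "u x \<in> fib E x" "v x \<in> fib E x" "b \<in> fib E x"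
  shows "met E x (sec_diff E u v x) b = met E x (u x) b - met E x (v x) b"
proof -
  obtain V \<tau> where t: "(V, \<tau>) \<in> trv E" "x \<in> V" using triv_cover[OF assms(1)] by blast
  show ?thesis
    using sec_diff_comp[of V \<tau> x u v, OF t assms(2,3)] sec_diff_fib[of V \<tau> x u v, OF t assms(2,3)] assms
    by (simp add: met_expand[OF t] right_diff_distrib left_diff_distrib sum_subtractf)
qed

lemma met_scale_left:
  assumes "x \<in> X" "u x \<in> fib E x" "b \<in> fib E x"
  shows "met E x (sec_scale E h u x) b = h x * met E x (u x) b"
proof -
  obtain V \<tau> where t: "(V, \<tau>) \<in> trv E" "x \<in> V" using triv_cover[OF assms(1)] by blast
  show ?thesis
    using sec_scale_comp[of V \<tau> x u _ h, OF t assms(2)] sec_scale_fib[of V \<tau> x u h, OF t assms(2)] assms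
    by (simp add: met_expand[OF t] sum_distrib_left sum_distrib_right mult.assoc mult.left_commute)
qed

lemma sec_in_fib:
  assumes "x \<in> X" "u x \<in> fib E x"
  shows "v x \<in> fib E x \<Longrightarrow> sec_diff E u v x \<in> fib E x" "sec_scale E h u x \<in> fib E x"
  using triv_cover[OF assms(1)] sec_diff_fib[of _ _ x u v, OF _ _ assms(2)]
    sec_scale_fib[of _ _ x u h, OF _ _ assms(2)] by auto

lemma met_diff_right:
  assumes "x \<in> X" "u x \<in> fib E x" "v x \<in> fib E x" "b \<in> fib E x"
  shows "met E x b (sec_diff E u v x) = met E x b (u x) - met E x b (v x)"
  using met_diff_left[of x u v b, OF assms] met_sym[OF assms(1) _ assms(4)] sec_in_fib(1)[of x u v, OF assms(1-3)] assms
  by simp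

lemma met_scale_right:
  assumes "x \<in> X" "u x \<in> fib E x" "b \<in> fib E x"
  shows "met E x b (sec_scale E h u x) = cnj (h x) * met E x b (u x)"
  using met_scale_left[of x u b h, OF assms] met_sym[OF assms(1) _ assms(3)] sec_in_fib(2)[of x u h, OF assms(1,2)] assms
  by simp

lemma met_Cauchy_Schwarz:
  assumes "x \<in> X" "a \<in> fib E x" "b \<in> fib E x"
  shows "(cmod (met E x a b))\<^sup>2 \<le> Re (met E x a a) * Re (met E x b b)"
proof (cases "Re (met E x b b) = 0")
  case True
  then have "b = fib_zero E x" using met_definite assms by blast
  then have "met E x a b = 0" using met_sym[OF assms(1,3,2)] met_zero_left[OF assms(1,2)] by simp
  then show ?thesis using met_nonneg assms by simp
next
  case False
  define \<beta> where "\<beta> = Re (met E x b b)"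
  define p where "p = met E x a b"
  have \<beta>: "\<beta> > 0" "met E x b b = of_real \<beta>"
    using met_nonneg[OF assms(1,3)] False met_Im[OF assms(1,3)] by (auto simp: \<beta>_def)
  \<comment> \<open>\<open>k b\<close> is the orthogonal projection of \<open>a\<close> to the line spanned by \<open>b\<close>.\<close>
  define k where "k = p / of_real \<beta>"
  let ?v = "sec_scale E (\<lambda>_. k) (\<lambda>_. b)"
  let ?z = "sec_diff E (\<lambda>_. a) ?v"
  have v: "?v x \<in> fib E x" using sec_in_fib(2)[of x "\<lambda>_. b" "\<lambda>_. k"] assms(1,3) by simp
  have z: "?z x \<in> fib E x" using sec_in_fib(1)[of x "\<lambda>_. a" ?v] assms(1,2) v by simp
  have "met E x (?z x) (?z x) = (met E x a a - cnj k * p) - (k * cnj p - k * (cnj k * of_real \<beta>))"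
    using met_diff_left[of x "\<lambda>_. a" ?v "?z x"] met_diff_right[of x "\<lambda>_. a" ?v]
      met_scale_left[of x "\<lambda>_. b" _ "\<lambda>_. k"] met_scale_right[of x "\<lambda>_. b" _ "\<lambda>_. k"]
      assms v z met_sym[OF assms] \<beta>(2)
    by (simp add: p_def)
  also have "\<dots> = met E x a a - of_real ((cmod p)\<^sup>2 / \<beta>)"
  proof -
    have "p * cnj p = of_real ((cmod p)\<^sup>2)" by (simp add: complex_norm_square[symmetric])
    moreover have "cnj k * p = p * cnj p / of_real \<beta>" "k * cnj p = p * cnj p / of_real \<beta>"
      "k * (cnj k * of_real \<beta>) = p * cnj p / of_real \<beta>"
      using \<beta>(1) by (auto simp: k_def)
    ultimately show ?thesis by (simp only: ) simp
  qed
  finally have "0 \<le> Re (met E x a a) - (cmod p)\<^sup>2 / \<beta>" using met_nonneg[OF assms(1) z] by simp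
  then show ?thesis using \<beta>(1) by (simp add: p_def[symmetric] \<beta>_def[symmetric] divide_le_eq)
qed

text \<open>
  The Gram matrix has a smooth inverse, by Cramer's rule. It expresses a coordinate of a vector by
  its products with others, which shows that the coordinates are dominated by the metric, and it
  will convert densities into sections.
\<close>

definition gram_inv :: "('m, 'e) triv \<Rightarrow> 'm \<Rightarrow> nat \<Rightarrow> nat \<Rightarrow> complex" where
  "gram_inv c x i j = adj_mat (gram c x) $$ (i, j) * inverse (Determinant.det (gram c x))"

text \<open>
  A vector in the kernel of the Gram matrix would have length zero.
\<close>

lemma gram_det: 
  assumes t: "(V, \<tau>) \<in> trv E" "x \<in> V"
  shows "Determinant.det (gram (V, \<tau>) x) \<noteq> 0"
proof
  assume "Determinant.det (gram (V, \<tau>) x) = 0"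
  then obtain c where c: "c \<in> carrier_vec (rnk E)" "c \<noteq> 0\<^sub>v (rnk E)" "gram (V, \<tau>) x *\<^sub>v c = 0\<^sub>v (rnk E)"
    using det_0_iff_vec_prod_zero[OF gram_carrier[OF t]] by blast
  have "c \<in> \<tau> x ` fib E x" using triv_bij[OF t] c(1) by (simp add: bij_betw_def)
  then obtain a where a: "a \<in> fib E x" "\<tau> x a = c" by blast
  have "met E x a a = 0" using c by (simp add: met_gram[OF t a(1) a(1)] a(2))
  then show False using met_pos_triv[OF t a(1)] a(2) c(2) by simp
qed

lemma gram_inv:
  assumes t: "(V, \<tau>) \<in> trv E" "x \<in> V" and ij: "i < rnk E" "j < rnk E"
  shows "(\<Sum>l<rnk E. gram_inv (V, \<tau>) x i l * gram (V, \<tau>) x $$ (l, j)) = (if i = j then 1 else 0)"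
proof -
  let ?H = "gram (V, \<tau>) x"
  have H: "?H \<in> carrier_mat (rnk E) (rnk E)" by (rule gram_carrier[OF t])
  have "(\<Sum>l<rnk E. adj_mat ?H $$ (i, l) * ?H $$ (l, j)) = (adj_mat ?H * ?H) $$ (i, j)"
    using H adj_mat(1)[OF H] ij by (simp add: scalar_prod_def lessThan_atLeast0)
  also have "\<dots> = Determinant.det ?H * (if i = j then 1 else 0)"
    unfolding adj_mat(3)[OF H] using ij by simp
  finally have "(\<Sum>l<rnk E. adj_mat ?H $$ (i, l) * ?H $$ (l, j)) * inverse (Determinant.det ?H)
      = (if i = j then 1 else 0)"
    using gram_det[OF t] by simp
  then show ?thesis by (simp add: gram_inv_def sum_distrib_right mult.assoc mult.commute[of "inverse _"])
qed

lemma gram_inv_solve: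
  assumes t: "(V, \<tau>) \<in> trv E" "x \<in> V" and i: "i < rnk E"
  shows "(\<Sum>l<rnk E. gram_inv (V, \<tau>) x i l * (\<Sum>j<rnk E. gram (V, \<tau>) x $$ (l, j) * c j)) = c i"
proof -
  have "(\<Sum>l<rnk E. gram_inv (V, \<tau>) x i l * (\<Sum>j<rnk E. gram (V, \<tau>) x $$ (l, j) * c j))
      = (\<Sum>j<rnk E. (\<Sum>l<rnk E. gram_inv (V, \<tau>) x i l * gram (V, \<tau>) x $$ (l, j)) * c j)"
    by (simp add: sum_distrib_left sum_distrib_right mult.assoc) (rule sum.swap)
  also have "\<dots> = (\<Sum>j<rnk E. (if i = j then c j else 0))"
    using gram_inv[OF t i] by (intro sum.cong) auto
  also have "\<dots> = c i" using i by simp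
  finally show ?thesis .
qed

lemma smooth_det:
  assumes "open W" "\<And>x. x \<in> W \<Longrightarrow> M x \<in> carrier_mat n n"
    and "\<And>i j. i < n \<Longrightarrow> j < n \<Longrightarrow> smooth_on_open \<A> W (\<lambda>x. M x $$ (i, j))"
  shows "smooth_on_open \<A> W (\<lambda>x. Determinant.det (M x) :: complex)"
proof (rule smooth_on_open_cong[OF mfd])
  show "smooth_on_open \<A> W (\<lambda>x. \<Sum>p\<in>{p. p permutes {0..<n}}. signof p * (\<Prod>i=0..<n. M x $$ (i, p i)))"
  proof (intro smooth_on_open_sum[OF mfd] smooth_on_open_mult[OF mfd] smooth_on_open_prod[OF mfd]
      smooth_on_open_const[OF mfd] assms(1))
    fix p i assume "p \<in> {p. p permutes {0..<n}}" "i \<in> {0..<n}"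
    then show "smooth_on_open \<A> W (\<lambda>x. M x $$ (i, p i))"
      using permutes_in_image[of p "{0..<n}" i] by (intro assms(3)) auto
  qed
qed (use det_def'[OF assms(2)] in simp)

lemma gram_inv_smooth:
  assumes t: "(V, \<tau>) \<in> trv E" and W: "open W" "W \<subseteq> V" and ij: "i < rnk E" "j < rnk E"
  shows "smooth_on_open \<A> W (\<lambda>x. gram_inv (V, \<tau>) x i j)"
proof -
  let ?n = "rnk E" and ?H = "gram (V, \<tau>)"
  have H: "x \<in> W \<Longrightarrow> ?H x \<in> carrier_mat ?n ?n" for x using gram_carrier[OF t] W by auto
  have sm: "smooth_on_open \<A> W (\<lambda>x. ?H x $$ (k, l))" if "k < ?n" "l < ?n" for k l
    by (rule smooth_on_imp_open[OF mfd gram_smooth[OF t that] W])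
  have "smooth_on_open \<A> W (\<lambda>x. Determinant.det (?H x))"
    by (rule smooth_det[OF W(1) H sm])
  then have 1: "smooth_on_open \<A> W (\<lambda>x. inverse (Determinant.det (?H x)))"
    by (rule smooth_on_open_inverse[OF mfd]) (use gram_det[OF t] W in auto)
  have "smooth_on_open \<A> W (\<lambda>x. Determinant.det (mat_delete (?H x) j i))"
  proof (rule smooth_det[OF W(1)])
    show "mat_delete (?H x) j i \<in> carrier_mat (?n - 1) (?n - 1)" if "x \<in> W" for x
      by (rule mat_delete_carrier[OF H[OF that]])
    fix k l assume kl: "k < ?n - 1" "l < ?n - 1"
    show "smooth_on_open \<A> W (\<lambda>x. mat_delete (?H x) j i $$ (k, l))"
      by (rule smooth_on_open_cong[OF mfd sm[of "if k < j then k else Suc k" "if l < i then l else Suc l"]])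
        (use kl H in \<open>auto simp: mat_delete_def dest!: H\<close>)
  qed
  then have "smooth_on_open \<A> W (\<lambda>x. (- 1) ^ (j + i) * Determinant.det (mat_delete (?H x) j i))"
    by (intro smooth_on_open_mult[OF mfd] smooth_on_open_const[OF mfd] W(1))
  then have 2: "smooth_on_open \<A> W (\<lambda>x. adj_mat (?H x) $$ (i, j))"
    by (rule smooth_on_open_cong[OF mfd])
      (use ij H in \<open>auto simp: adj_mat_def cofactor_def dest!: H\<close>)
  show ?thesis unfolding gram_inv_def by (rule smooth_on_open_mult[OF mfd 2 1])
qed

lemma coord_bound:
  assumes t: "(V, \<tau>) \<in> trv E" "x \<in> V" and i: "i < rnk E"
  obtains B where "B \<ge> 0" "\<And>a. a \<in> fib E x \<Longrightarrow> cmod (\<tau> x a $ i) \<le> B * sqrt (Re (met E x a a))"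
proof -
  have x: "x \<in> X" using t triv_sub by blast
  \<comment> \<open>The vector with these coordinates represents the functional \<open>a \<mapsto> \<tau> x a $ i\<close> by the metric.\<close>
  define d where "d = vec (rnk E) (\<lambda>l. cnj (gram_inv (V, \<tau>) x i l))"
  have "d \<in> \<tau> x ` fib E x" using triv_bij[OF t] by (simp add: bij_betw_def d_def)
  then obtain b where b: "b \<in> fib E x" "\<tau> x b = d" by blast
  show ?thesis
  proof (rule that)
    fix a assume a: "a \<in> fib E x"
    have "met E x a b = (\<Sum>l<rnk E. gram_inv (V, \<tau>) x i l * (\<Sum>j<rnk E. gram (V, \<tau>) x $$ (l, j) * \<tau> x a $ j))"
      unfolding met_expand[OF t a b(1)] b(2) by (intro sum.cong) (auto simp: d_def mult.commute)
    also have "\<dots> = \<tau> x a $ i" by (rule gram_inv_solve[OF t i])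
    finally have "(cmod (\<tau> x a $ i))\<^sup>2 \<le> Re (met E x a a) * Re (met E x b b)"
      using met_Cauchy_Schwarz[OF x a b(1)] by simp
    then have "cmod (\<tau> x a $ i) \<le> sqrt (Re (met E x a a) * Re (met E x b b))"
      by (rule real_le_rsqrt)
    then show "cmod (\<tau> x a $ i) \<le> sqrt (Re (met E x b b)) * sqrt (Re (met E x a a))"
      by (simp add: real_sqrt_mult mult.commute)
  qed (use met_nonneg[OF x b(1)] in simp)
qed

lemma met_continuous:
  assumes "smooth_section \<A> E W u" "smooth_section \<A> E W v" "open W" "W \<subseteq> X"
  shows "continuous_on W (\<lambda>x. met E x (u x) (v x))"
proof (rule continuous_at_imp_continuous_on, rule ballI)
  fix x assume x: "x \<in> W"
  obtain V \<tau> where t: "(V, \<tau>) \<in> trv E" "x \<in> V" using triv_cover assms(4) x by blast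
  have o: "open (V \<inter> W)" by (rule triv_open[OF t(1) assms(3,4)])
  have g: "continuous_on (V \<inter> W) (\<lambda>x. gram (V, \<tau>) x $$ (i, j))" if "i < rnk E" "j < rnk E" for i j
    by (intro smooth_on_open_continuous[OF mfd] smooth_on_imp_open[OF mfd gram_smooth[OF t(1) that] o]) simp
  have c: "continuous_on (V \<inter> W) (\<lambda>x. \<tau> x (w x) $ i)" if "smooth_section \<A> E W w" "i < rnk E" for w i
    by (rule smooth_on_open_continuous[OF mfd smooth_section_comp[OF that(1) assms(3,4) t(1) that(2)]])
  have "continuous_on (V \<inter> W) (\<lambda>x. \<Sum>i<rnk E. (\<Sum>j<rnk E. gram (V, \<tau>) x $$ (i, j) * \<tau> x (u x) $ j) * cnj (\<tau> x (v x) $ i))"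
    by (intro continuous_intros g c assms(1,2)) auto
  then have "continuous_on (V \<inter> W) (\<lambda>x. met E x (u x) (v x))"
    by (rule continuous_on_eq) (use met_expand[OF t(1)] assms(1,2)[THEN smooth_section_fib] in auto)
  then show "isCont (\<lambda>x. met E x (u x) (v x)) x"
    using continuous_on_eq_continuous_at[OF o] x t(2) by blast
qed

end

section \<open>The Hilbert space of square integrable sections\<close>

text \<open>
  This turns an inequality of the form \<open>2 c \<le> t A + B / t\<close>, which can be integrated, into one of
  Cauchy-Schwarz type; for \<open>A, B > 0\<close> the optimal choice is \<open>t = sqrt (B / A)\<close>.
\<close>

lemma le_sqrt_mult_of_arith_mean:
  fixes c A B :: real
  assumes "\<And>t. t > 0 \<Longrightarrow> c \<le> (t * A + B / t) / 2" "A \<ge> 0" "B \<ge> 0"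
  shows "c \<le> sqrt A * sqrt B"
proof -
  consider "A = 0" | "B = 0" | "A > 0" "B > 0" using assms(2,3) by linarith
  then show ?thesis
  proof cases
    case 1
    have "c \<le> 0"
    proof (rule ccontr)
      assume "\<not> c \<le> 0"
      then have c: "c > 0" by simp
      have "c \<le> (B / ((B + 1) / c)) / 2" using assms(1)[of "(B + 1) / c"] 1 c assms(3) by simp
      also have "\<dots> = c * (B / (B + 1)) / 2" using c by simp
      also have "\<dots> \<le> c / 2" using c assms(3) by (simp add: field_simps)
      finally show False using c by simp
    qed
    then show ?thesis using 1 by simp
  next
    case 2
    have "c \<le> 0"
    proof (rule ccontr)
      assume "\<not> c \<le> 0"
      then have c: "c > 0" by simp
      have "c \<le> (c / (A + 1) * A) / 2" using assms(1)[of "c / (A + 1)"] 2 c assms(2) by simp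
      also have "\<dots> \<le> c / 2" using c assms(2) by (simp add: field_simps)
      finally show False using c by simp
    qed
    then show ?thesis using 2 by simp
  next
    case 3
    have "A = sqrt A * sqrt A" "B = sqrt B * sqrt B" using 3 by auto
    then have "sqrt B / sqrt A * A = sqrt A * sqrt B" "B / (sqrt B / sqrt A) = sqrt A * sqrt B"
      using 3 by (simp_all add: field_simps)
    then show ?thesis using assms(1)[of "sqrt B / sqrt A"] 3 by simp
  qed
qed

lemma arith_mean_sqrt:
  fixes a b t :: real
  assumes "t > 0" "a \<ge> 0" "b \<ge> 0"
  shows "sqrt (a * b) \<le> (t * a + b / t) / 2"
proof -
  have "sqrt (a * b) = sqrt ((t * a) * (b / t))" using assms by simp
  also have "\<dots> \<le> (t * a + b / t) / 2" by (rule arith_geo_mean_sqrt) (use assms in auto)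
  finally show ?thesis .
qed

locale L2_sections = hbundle_over \<A> X E
  for \<A> :: "('m::{t2_space, second_countable_topology}, 'n::finite) chart set" and X :: "'m set"
    and E :: "('m, 'e) hbundle" +
  fixes dx :: "'m measure" and D :: "'m set"
  assumes D_open: "open D" and D_compact: "compact (closure D)" and D_sub: "closure D \<subseteq> interior X"
    and dx_sets: "sets dx = sets borel" and dx_finite: "emeasure dx D < \<infinity>"
begin

abbreviation "MD \<equiv> restrict_space dx D"

lemma D_X: "x \<in> D \<Longrightarrow> x \<in> X"
  using D_sub closure_subset interior_subset by blast

lemma D_subset_X: "D \<subseteq> X" using D_X by blast

lemma D_meas: "D \<inter> space dx \<in> sets dx"
  by (metis D_open borel_open dx_sets sets.Int_space_eq2)

lemma space_dx: "space dx = UNIV"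
  using sets_eq_imp_space_eq[OF dx_sets] by simp

lemma space_MD: "space MD = D"
  by (simp add: space_restrict_space space_dx)

lemma MD_measurable: "borel_measurable MD = borel_measurable (restrict_space borel D)"
  by (rule measurable_cong_sets) (auto simp: sets_restrict_space dx_sets)

lemma finite_MD: "finite_measure MD"
  by (rule finite_measureI) (use dx_finite D_meas in \<open>simp add: emeasure_restrict_space space_restrict_space space_dx\<close>)

lemma set_integrable_MD:
  fixes h :: "'m \<Rightarrow> 'b::{banach, second_countable_topology}"
  shows "set_integrable dx D h \<longleftrightarrow> integrable MD h"
  by (simp add: set_integrable_def integrable_restrict_space[OF D_meas])

lemma set_integral_MD:
  fixes h :: "'m \<Rightarrow> 'b::{banach, second_countable_topology}"
  shows "(LINT x:D|dx. h x) = (LINT x|MD. h x)"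
  by (simp add: set_lebesgue_integral_def integral_restrict_space[OF D_meas])

lemma AE_MD: "(AE x\<in>D in dx. P x) \<longleftrightarrow> (AE x in MD. P x)"
  by (simp add: AE_restrict_space_iff[OF D_meas])

lemma ip_MD: "ip dx D E u v = (LINT x|MD. met E x (u x) (v x))"
  by (simp add: ip_def set_integral_MD)

lemma ae_eq_MD: "ae_eq dx D u v \<longleftrightarrow> (AE x in MD. u x = v x)"
  by (simp add: ae_eq_def AE_MD)

lemma triv_D_open: "(V, \<tau>) \<in> trv E \<Longrightarrow> open (V \<inter> D)"
  by (rule triv_open[OF _ D_open]) (use D_X in auto)

subsection \<open>Measurability\<close>

text \<open>
  A second countable space is Lindeloef, so countably many trivialisations cover \<open>D\<close>.
\<close>

lemma measurable_local:
  fixes h :: "'m \<Rightarrow> 'b::topological_space"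
  assumes "\<And>V \<tau>. (V, \<tau>) \<in> trv E \<Longrightarrow> h \<in> borel_measurable (restrict_space borel (V \<inter> D))"
  shows "h \<in> borel_measurable MD"
proof -
  let ?F = "(\<lambda>c. fst c \<inter> D) ` trv E"
  have "\<And>S. S \<in> ?F \<Longrightarrow> open S" using triv_D_open by auto
  then obtain C where C: "C \<subseteq> ?F" "countable C" "\<Union>C = \<Union>?F" using Lindelof by metis
  have cov: "D \<subseteq> \<Union>C"
  proof
    fix x assume x: "x \<in> D"
    then obtain V \<tau> where "(V, \<tau>) \<in> trv E" "x \<in> V" using triv_cover D_X by blast
    then have "x \<in> \<Union>?F" using x by force
    then show "x \<in> \<Union>C" by (simp only: C(3))
  qed
  have "h \<in> borel_measurable (restrict_space borel D)"
  proof (rule measurable_piecewise_restrict[OF C(2)])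
    fix S assume "S \<in> C"
    then obtain V \<tau> where V: "(V, \<tau>) \<in> trv E" "S = V \<inter> D" using C(1) by auto
    have o: "open S" using triv_D_open[OF V(1)] V(2) by simp
    then show "S \<inter> space (restrict_space borel D) \<in> sets (restrict_space borel D)"
      using D_open V(2) by (subst sets_restrict_space_iff) (auto simp: space_restrict_space)
    have "D \<inter> S = V \<inter> D" using V(2) by auto
    then have "restrict_space (restrict_space borel D) S = restrict_space borel (V \<inter> D)"
      using o D_open by (subst restrict_restrict_space) (simp_all add: borel_open)
    then show "h \<in> borel_measurable (restrict_space (restrict_space borel D) S)"
      using assms[OF V(1)] by simp
  next
    show "space (restrict_space borel D) \<subseteq> \<Union> C" using cov by (simp add: space_restrict_space)
  qed
  then show ?thesis by (simp add: MD_measurable)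
qed

lemma measurable_triv_restrict:
  assumes "h \<in> borel_measurable MD" "(V, \<tau>) \<in> trv E"
  shows "h \<in> borel_measurable (restrict_space borel (V \<inter> D))"
proof -
  have "h \<in> borel_measurable (restrict_space (restrict_space borel D) (V \<inter> D))"
    using assms(1) unfolding MD_measurable by (rule measurable_restrict_space1)
  moreover have "D \<inter> (V \<inter> D) = V \<inter> D" by auto
  then have "restrict_space (restrict_space borel D) (V \<inter> D) = restrict_space borel (V \<inter> D)"
    using triv_D_open[OF assms(2)] D_open by (subst restrict_restrict_space) (simp_all add: borel_open)
  ultimately show ?thesis by simp
qed

lemma measurable_section_fib: "measurable_section E D u \<Longrightarrow> x \<in> D \<Longrightarrow> u x \<in> fib E x"
  by (simp add: measurable_section_def)

lemma measurable_section_comp: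
  "measurable_section E D u \<Longrightarrow> (V, \<tau>) \<in> trv E \<Longrightarrow> i < rnk E \<Longrightarrow>
    (\<lambda>x. \<tau> x (u x) $ i) \<in> borel_measurable (restrict_space borel (V \<inter> D))"
  by (auto simp: measurable_section_def)

lemma measurable_sectionI:
  assumes "\<And>x. x \<in> D \<Longrightarrow> u x \<in> fib E x"
    "\<And>V \<tau> i. (V, \<tau>) \<in> trv E \<Longrightarrow> i < rnk E \<Longrightarrow>
      (\<lambda>x. \<tau> x (u x) $ i) \<in> borel_measurable (restrict_space borel (V \<inter> D))"
  shows "measurable_section E D u"
  using assms by (auto simp: measurable_section_def)

lemma space_VD: "space (restrict_space borel (V \<inter> D)) = V \<inter> D"
  by (simp add: space_restrict_space)

lemma measurable_section_diff:
  assumes "measurable_section E D u" "measurable_section E D v"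
  shows "measurable_section E D (sec_diff E u v)"
proof (rule measurable_sectionI)
  fix x assume "x \<in> D"
  then show "sec_diff E u v x \<in> fib E x"
    using assms[THEN measurable_section_fib] D_X by (intro sec_in_fib(1)) auto
next
  fix V \<tau> i assume t: "(V, \<tau>) \<in> trv E" "i < rnk E"
  show "(\<lambda>x. \<tau> x (sec_diff E u v x) $ i) \<in> borel_measurable (restrict_space borel (V \<inter> D))"
  proof (subst measurable_cong)
    show "\<tau> x (sec_diff E u v x) $ i = \<tau> x (u x) $ i - \<tau> x (v x) $ i"
      if "x \<in> space (restrict_space borel (V \<inter> D))" for x
      using that assms[THEN measurable_section_fib]
      by (intro sec_diff_comp[OF t(1) _ _ _ t(2)]) (auto simp: space_VD)
  qed (intro borel_measurable_diff measurable_section_comp[OF _ t] assms)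
qed

lemma measurable_section_scale:
  assumes "measurable_section E D u" "h \<in> borel_measurable MD"
  shows "measurable_section E D (sec_scale E h u)"
proof (rule measurable_sectionI)
  fix x assume "x \<in> D"
  then show "sec_scale E h u x \<in> fib E x"
    using measurable_section_fib[OF assms(1)] D_X by (intro sec_in_fib(2)) auto
next
  fix V \<tau> i assume t: "(V, \<tau>) \<in> trv E" "i < rnk E"
  show "(\<lambda>x. \<tau> x (sec_scale E h u x) $ i) \<in> borel_measurable (restrict_space borel (V \<inter> D))"
  proof (subst measurable_cong)
    show "\<tau> x (sec_scale E h u x) $ i = h x * \<tau> x (u x) $ i"
      if "x \<in> space (restrict_space borel (V \<inter> D))" for x
      using that measurable_section_fib[OF assms(1)]
      by (intro sec_scale_comp[OF t(1) _ _ t(2)]) (auto simp: space_VD)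
  qed (intro borel_measurable_times measurable_section_comp[OF _ t] measurable_triv_restrict[OF _ t(1)] assms)
qed

lemma met_measurable:
  assumes "measurable_section E D u" "measurable_section E D v"
  shows "(\<lambda>x. met E x (u x) (v x)) \<in> borel_measurable MD"
proof (rule measurable_local)
  fix V \<tau> assume t: "(V, \<tau>) \<in> trv E"
  have g: "(\<lambda>x. gram (V, \<tau>) x $$ (i, j)) \<in> borel_measurable (restrict_space borel (V \<inter> D))"
    if "i < rnk E" "j < rnk E" for i j
    by (intro borel_measurable_continuous_on_restrict smooth_on_open_continuous[OF mfd]
        smooth_on_imp_open[OF mfd gram_smooth[OF t that] triv_D_open[OF t]]) simp
  show "(\<lambda>x. met E x (u x) (v x)) \<in> borel_measurable (restrict_space borel (V \<inter> D))"
  proof (subst measurable_cong)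
    show "met E x (u x) (v x) = (\<Sum>i<rnk E. (\<Sum>j<rnk E. gram (V, \<tau>) x $$ (i, j) * \<tau> x (u x) $ j) * cnj (\<tau> x (v x) $ i))"
      if "x \<in> space (restrict_space borel (V \<inter> D))" for x
      using that assms[THEN measurable_section_fib] by (intro met_expand[OF t]) (auto simp: space_VD)
    have c: "(\<lambda>x. cnj (\<tau> x (v x) $ i)) \<in> borel_measurable (restrict_space borel (V \<inter> D))" if "i < rnk E" for i
      using measurable_compose[OF measurable_section_comp[OF assms(2) t that], of cnj borel]
        borel_measurable_continuous_onI[OF continuous_on_cnj[OF continuous_on_id]] by simp
    show "(\<lambda>x. \<Sum>i<rnk E. (\<Sum>j<rnk E. gram (V, \<tau>) x $$ (i, j) * \<tau> x (u x) $ j) * cnj (\<tau> x (v x) $ i))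
        \<in> borel_measurable (restrict_space borel (V \<inter> D))"
      by (intro borel_measurable_sum borel_measurable_times g c measurable_section_comp[OF assms(1) t]) auto
  qed
qed

abbreviation sq :: "('m \<Rightarrow> 'e) \<Rightarrow> 'm \<Rightarrow> real" where
  "sq u x \<equiv> Re (met E x (u x) (u x))"

lemma sq_measurable: "measurable_section E D u \<Longrightarrow> sq u \<in> borel_measurable MD"
  using met_measurable[of u u] by simp

lemma sq_nonneg: "measurable_section E D u \<Longrightarrow> x \<in> D \<Longrightarrow> 0 \<le> sq u x"
  using met_nonneg D_X measurable_section_fib by blast

text \<open>
  The square of the length is real, so integrability may be checked on its real part.
\<close>

lemma L2_iff: "u \<in> L2 dx D E \<longleftrightarrow> measurable_section E D u \<and> integrable MD (sq u)"
proof -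
  have "integrable MD (\<lambda>x. met E x (u x) (u x)) \<longleftrightarrow> integrable MD (sq u)" if u: "measurable_section E D u"
  proof -
    have "integrable MD (\<lambda>x. met E x (u x) (u x)) \<longleftrightarrow> integrable MD (\<lambda>x. complex_of_real (sq u x))"
      by (rule Bochner_Integration.integrable_cong)
        (use u in \<open>auto simp: space_MD intro!: met_Im D_X measurable_section_fib\<close>)
    then show ?thesis by (simp add: complex_of_real_integrable_eq)
  qed
  then show ?thesis by (auto simp: L2_def set_integrable_MD)
qed

lemma L2_meas: "u \<in> L2 dx D E \<Longrightarrow> measurable_section E D u"
  and L2_int: "u \<in> L2 dx D E \<Longrightarrow> integrable MD (sq u)"
  by (simp_all add: L2_iff)

lemma L2_fib: "u \<in> L2 dx D E \<Longrightarrow> x \<in> D \<Longrightarrow> u x \<in> fib E x"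
  using L2_meas measurable_section_fib by blast

lemma met_le_mean:
  assumes "x \<in> D" "u x \<in> fib E x" "v x \<in> fib E x" "t > 0"
  shows "cmod (met E x (u x) (v x)) \<le> (t * sq u x + sq v x / t) / 2"
proof -
  have "cmod (met E x (u x) (v x)) \<le> sqrt (sq u x * sq v x)"
    by (rule real_le_rsqrt) (rule met_Cauchy_Schwarz[OF D_X[OF assms(1)] assms(2,3)])
  also have "\<dots> \<le> (t * sq u x + sq v x / t) / 2"
    by (rule arith_mean_sqrt) (use assms met_nonneg D_X in auto)
  finally show ?thesis .
qed

lemma met_integrable:
  assumes "u \<in> L2 dx D E" "v \<in> L2 dx D E"
  shows "integrable MD (\<lambda>x. met E x (u x) (v x))"
proof (rule Bochner_Integration.integrable_bound)
  show "integrable MD (\<lambda>x. (1 * sq u x + sq v x / 1) / 2)"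
    using assms[THEN L2_int] by simp
  show "(\<lambda>x. met E x (u x) (v x)) \<in> borel_measurable MD" by (intro met_measurable L2_meas assms)
  show "AE x in MD. cmod (met E x (u x) (v x)) \<le> norm ((1 * sq u x + sq v x / 1) / 2)"
  proof (rule AE_I2)
    fix x assume "x \<in> space MD"
    then show "cmod (met E x (u x) (v x)) \<le> norm ((1 * sq u x + sq v x / 1) / 2)"
      using met_le_mean[of x u v 1] assms[THEN L2_fib, of x] by (auto simp: space_MD)
  qed
qed

lemma sq_diff_le:
  assumes "x \<in> D" "u x \<in> fib E x" "v x \<in> fib E x"
  shows "sq (sec_diff E u v) x \<le> 2 * sq u x + 2 * sq v x"
proof -
  have x: "x \<in> X" using D_X assms(1) .
  have "sq (sec_diff E u v) x = sq u x - Re (met E x (u x) (v x)) - (Re (met E x (v x) (u x)) - sq v x)"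
    using sec_in_fib(1)[of x u v, OF x assms(2,3)]
    by (simp add: met_diff_left[of x u v, OF x assms(2,3)] met_diff_right[of x u v, OF x assms(2,3)] assms)
  moreover have "- Re (met E x (u x) (v x)) \<le> (sq u x + sq v x) / 2"
    using met_le_mean[of x u v 1, OF assms] abs_Re_le_cmod[of "met E x (u x) (v x)"] by (simp add: abs_le_iff)
  moreover have "Re (met E x (v x) (u x)) = Re (met E x (u x) (v x))"
    using met_sym[OF x assms(2,3)] by simp
  ultimately show ?thesis by (simp add: field_simps)
qed

lemma L2_diff:
  assumes "u \<in> L2 dx D E" "v \<in> L2 dx D E"
  shows "sec_diff E u v \<in> L2 dx D E"
  unfolding L2_iff
proof
  show m: "measurable_section E D (sec_diff E u v)"
    by (intro measurable_section_diff L2_meas assms)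
  show "integrable MD (sq (sec_diff E u v))"
  proof (rule Bochner_Integration.integrable_bound)
    show "integrable MD (\<lambda>x. 2 * sq u x + 2 * sq v x)" using assms[THEN L2_int] by simp
    show "sq (sec_diff E u v) \<in> borel_measurable MD" by (rule sq_measurable[OF m])
    show "AE x in MD. norm (sq (sec_diff E u v) x) \<le> norm (2 * sq u x + 2 * sq v x)"
    proof (rule AE_I2)
      fix x assume "x \<in> space MD"
      then have x: "x \<in> D" by (simp add: space_MD)
      show "norm (sq (sec_diff E u v) x) \<le> norm (2 * sq u x + 2 * sq v x)"
        using sq_diff_le[of x u v, OF x] assms[THEN L2_fib, OF x] sq_nonneg[OF m x] by simp
    qed
  qed
qed

lemma L2_Cauchy_Schwarz:
  assumes "u \<in> L2 dx D E" "v \<in> L2 dx D E"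
  shows "cmod (ip dx D E u v) \<le> sqrt (Re (ip dx D E u u)) * sqrt (Re (ip dx D E v v))"
proof (rule le_sqrt_mult_of_arith_mean)
  have Re: "Re (ip dx D E w w) = (LINT x|MD. sq w x)" if "w \<in> L2 dx D E" for w
    using integral_Re[OF met_integrable[OF that that]] by (simp add: ip_MD)
  show "0 \<le> Re (ip dx D E u u)" "0 \<le> Re (ip dx D E v v)"
    using assms by (auto simp: Re space_MD intro!: integral_nonneg_AE AE_I2 sq_nonneg L2_meas)
  fix t :: real assume t: "t > 0"
  have "cmod (ip dx D E u v) \<le> (LINT x|MD. cmod (met E x (u x) (v x)))"
    unfolding ip_MD by (rule integral_norm_bound)
  also have "\<dots> \<le> (LINT x|MD. (t * sq u x + sq v x / t) / 2)"
  proof (rule integral_mono)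
    show "integrable MD (\<lambda>x. cmod (met E x (u x) (v x)))"
      using met_integrable[OF assms] by simp
    show "integrable MD (\<lambda>x. (t * sq u x + sq v x / t) / 2)"
      using assms[THEN L2_int] by simp
    show "cmod (met E x (u x) (v x)) \<le> (t * sq u x + sq v x / t) / 2" if "x \<in> space MD" for x
      using that assms[THEN L2_fib] t by (intro met_le_mean) (auto simp: space_MD)
  qed
  also have "\<dots> = (t * Re (ip dx D E u u) + Re (ip dx D E v v) / t) / 2"
    using assms[THEN L2_int] by (simp add: Re assms)
  finally show "cmod (ip dx D E u v) \<le> (t * Re (ip dx D E u u) + Re (ip dx D E v v) / t) / 2" .
qed

sublocale difference_space "L2 dx D E" "sec_diff E" "ip dx D E"
proof unfold_locales
  fix u v w assume uv: "u \<in> L2 dx D E" "v \<in> L2 dx D E"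
  show "sec_diff E u v \<in> L2 dx D E" by (rule L2_diff[OF uv])
  show "cmod (ip dx D E u v) \<le> sqrt (Re (ip dx D E u u)) * sqrt (Re (ip dx D E v v))"
    by (rule L2_Cauchy_Schwarz[OF uv])
  show "ip dx D E v u = cnj (ip dx D E u v)"
  proof -
    have "ip dx D E v u = (LINT x|MD. cnj (met E x (u x) (v x)))"
      unfolding ip_MD by (rule Bochner_Integration.integral_cong)
        (use uv[THEN L2_fib] in \<open>auto simp: space_MD intro!: met_sym D_X\<close>)
    then show ?thesis by (simp add: ip_MD)
  qed
  assume w: "w \<in> L2 dx D E"
  show "ip dx D E (sec_diff E u v) w = ip dx D E u w - ip dx D E v w"
  proof -
    have "ip dx D E (sec_diff E u v) w = (LINT x|MD. met E x (u x) (w x) - met E x (v x) (w x))"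
      unfolding ip_MD by (rule Bochner_Integration.integral_cong)
        (use uv[THEN L2_fib] L2_fib[OF w] in \<open>auto simp: space_MD intro!: met_diff_left D_X\<close>)
    also have "\<dots> = ip dx D E u w - ip dx D E v w"
      using met_integrable uv w by (simp add: ip_MD)
    finally show ?thesis .
  qed
next
  fix u assume u: "u \<in> L2 dx D E"
  have "Re (ip dx D E u u) = (LINT x|MD. sq u x)"
    using integral_Re[OF met_integrable[OF u u]] by (simp add: ip_MD)
  then show "0 \<le> Re (ip dx D E u u)"
    using u by (auto simp: space_MD intro!: integral_nonneg_AE AE_I2 sq_nonneg L2_meas)
qed

lemma L2norm_nrm: "L2norm dx D E = nrm"
  by (rule ext) (simp add: L2norm_def nrm_def)

lemma nrm_sq_integral: "u \<in> L2 dx D E \<Longrightarrow> (nrm u)\<^sup>2 = (LINT x|MD. sq u x)"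
  using integral_Re[OF met_integrable[of u u]] by (simp add: nrm_square ip_MD)

lemma nrm_sq_nn_integral: "u \<in> L2 dx D E \<Longrightarrow> ennreal ((nrm u)\<^sup>2) = (\<integral>\<^sup>+x. ennreal (sq u x) \<partial>MD)"
  by (subst nn_integral_eq_integral)
    (auto simp: nrm_sq_integral space_MD L2_int intro!: AE_I2 sq_nonneg L2_meas)

lemma nrm_eq_0:
  assumes "u \<in> L2 dx D E" "v \<in> L2 dx D E" "nrm (sec_diff E u v) = 0"
  shows "AE x in MD. u x = v x"
proof -
  let ?d = "sec_diff E u v"
  have d: "?d \<in> L2 dx D E" by (rule L2_diff[OF assms(1,2)])
  have "(LINT x|MD. sq ?d x) = 0" using nrm_sq_integral[OF d] assms(3) by simp
  then have z: "AE x in MD. sq ?d x = 0"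
    by (subst (asm) integral_nonneg_eq_0_iff_AE[OF L2_int[OF d]])
      (auto simp: space_MD intro!: AE_I2 sq_nonneg[OF L2_meas[OF d]])
  have eq: "u x = v x" if x: "x \<in> D" "sq ?d x = 0" for x
  proof -
    obtain V \<tau> where t: "(V, \<tau>) \<in> trv E" "x \<in> V" using triv_cover D_X[OF x(1)] by blast
    note f = assms(1,2)[THEN L2_fib, OF x(1)]
    have "?d x = fib_zero E x" using met_definite D_X x L2_fib[OF d] by blast
    then have "\<tau> x (u x) $ i = \<tau> x (v x) $ i" if "i < rnk E" for i
      using sec_diff_comp[of V \<tau> x u v i, OF t f that] triv_fib_zero[OF t] that by simp
    then have "\<tau> x (u x) = \<tau> x (v x)"
      using triv_carrier[OF t f(1)] triv_carrier[OF t f(2)] by (intro eq_vecI) auto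
    then show ?thesis using triv_eqI[OF t f] by blast
  qed
  show ?thesis by (rule AE_mp[OF z]) (auto simp: space_MD intro!: AE_I2 eq)
qed

lemma nrm_diff_ae:
  assumes "u \<in> L2 dx D E" "v \<in> L2 dx D E" "AE x in MD. u x = v x"
  shows "nrm (sec_diff E u v) = 0"
proof -
  have "ip dx D E u w = ip dx D E v w" if "w \<in> L2 dx D E" for w
    unfolding ip_MD using assms(3) met_integrable[OF assms(1) that] met_integrable[OF assms(2) that]
    by (intro integral_cong_AE) (auto dest: borel_measurable_integrable)
  then have "ip dx D E (sec_diff E u v) (sec_diff E u v) = 0"
    using inn_dif[OF assms(1,2) L2_diff[OF assms(1,2)]] L2_diff[OF assms(1,2)] by simp
  then show ?thesis by (simp add: nrm_def)
qed

subsection \<open>Smooth sections and multiplication by bounded functions\<close>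

text \<open>
  The hypotheses cover both kinds of smooth sections that occur: those smooth in a neighbourhood of
  \<open>closure D\<close>, with \<open>K = closure D\<close>, and the test sections, with \<open>W = D\<close>. In either case the length is
  bounded, by its maximum on \<open>K\<close>, and \<open>D\<close> has finite measure.
\<close>

lemma smooth_section_L2:
  assumes "smooth_section \<A> E W u" "open W" "W \<subseteq> X" "D \<subseteq> W" "compact K" "K \<subseteq> W"
    and "\<And>x. x \<in> D - K \<Longrightarrow> u x = fib_zero E x"
  shows "u \<in> L2 dx D E"
  unfolding L2_iff
proof
  have uf: "u x \<in> fib E x" if "x \<in> W" for x using smooth_section_fib[OF assms(1) that] .
  have c: "continuous_on (V \<inter> W) (\<lambda>x. \<tau> x (u x) $ i)" if "(V, \<tau>) \<in> trv E" "i < rnk E" for V \<tau> i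
    by (rule smooth_on_open_continuous[OF mfd smooth_section_comp[OF assms(1-3) that]])
  show m: "measurable_section E D u"
  proof (rule measurable_sectionI)
    fix V \<tau> i assume "(V, \<tau>) \<in> trv E" "i < rnk E"
    then show "(\<lambda>x. \<tau> x (u x) $ i) \<in> borel_measurable (restrict_space borel (V \<inter> D))"
      by (intro borel_measurable_continuous_on_restrict continuous_on_subset[OF c]) (use assms(4) in auto)
  qed (use uf assms(4) in auto)
  have cont: "continuous_on W (sq u)"
    by (intro continuous_on_Re met_continuous assms(1-3))
  have "compact (sq u ` K)" by (intro compact_continuous_image continuous_on_subset[OF cont] assms)
  then have "bounded (sq u ` K)" by (rule compact_imp_bounded)
  then obtain b where "\<forall>y\<in>sq u ` K. norm y \<le> b" unfolding bounded_iff by (rule exE)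
  then have b: "\<bar>sq u x\<bar> \<le> b" if "x \<in> K" for x using that by auto
  interpret finite_measure MD by (rule finite_MD)
  show "integrable MD (sq u)"
  proof (rule integrable_const_bound[where B = "max b 0"])
    show "AE x in MD. norm (sq u x) \<le> max b 0"
    proof (rule AE_I2)
      fix x assume "x \<in> space MD"
      then have x: "x \<in> D" by (simp add: space_MD)
      show "norm (sq u x) \<le> max b 0"
      proof (cases "x \<in> K")
        case True
        then show ?thesis using b[of x] by simp
      next
        case False
        then have "u x = fib_zero E x" using assms(7) x by simp
        then show ?thesis using met_zero_left[OF D_X[OF x], of "u x"] uf[of x] assms(4) x by auto
      qed
    qed
  qed (rule sq_measurable[OF m])
qed

lemma smooth_closure_sections_L2: "smooth_closure_sections \<A> X D E \<subseteq> L2 dx D E"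
proof
  fix u assume "u \<in> smooth_closure_sections \<A> X D E"
  then obtain W where W: "open W" "closure D \<subseteq> W" "W \<subseteq> X" "smooth_section \<A> E W u"
    by (auto simp: smooth_closure_sections_def)
  show "u \<in> L2 dx D E"
    by (rule smooth_section_L2[OF W(4,1,3) _ D_compact W(2)]) (use W(2) closure_subset in auto)
qed

lemma test_sections_L2: "test_sections \<A> D E \<subseteq> L2 dx D E"
proof
  fix u assume "u \<in> test_sections \<A> D E"
  then obtain K where K: "smooth_section \<A> E D u" "compact K" "K \<subseteq> D" "\<forall>x\<in>D - K. u x = fib_zero E x"
    by (auto simp: test_sections_def)
  show "u \<in> L2 dx D E"
    by (rule smooth_section_L2[OF K(1) D_open D_subset_X order_refl K(2,3)]) (use K(4) in auto)
qed

lemma L2_scale: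
  assumes "u \<in> L2 dx D E" "h \<in> borel_measurable MD" "\<And>x. x \<in> D \<Longrightarrow> cmod (h x) \<le> 1"
  shows "sec_scale E h u \<in> L2 dx D E"
  unfolding L2_iff
proof
  show m: "measurable_section E D (sec_scale E h u)"
    by (intro measurable_section_scale L2_meas assms)
  show "integrable MD (sq (sec_scale E h u))"
  proof (rule Bochner_Integration.integrable_bound[OF L2_int[OF assms(1)] sq_measurable[OF m]])
    show "AE x in MD. norm (sq (sec_scale E h u) x) \<le> norm (sq u x)"
    proof (rule AE_I2)
      fix x assume "x \<in> space MD"
      then have x: "x \<in> D" by (simp add: space_MD)
      note X = D_X[OF x] and f = L2_fib[OF assms(1) x]
      have "met E x (sec_scale E h u x) (sec_scale E h u x) = h x * cnj (h x) * met E x (u x) (u x)"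
        using met_scale_left[of x u "sec_scale E h u x" h, OF X f] met_scale_right[of x u "u x" h, OF X f f]
          sec_in_fib(2)[of x u h, OF X f] by simp
      then have "sq (sec_scale E h u) x = (cmod (h x))\<^sup>2 * sq u x"
        by (simp add: complex_norm_square[symmetric] del: of_real_power)
      also have "\<dots> \<le> 1 * sq u x"
        using assms(3)[OF x] sq_nonneg[OF L2_meas[OF assms(1)] x]
        by (intro mult_right_mono) (auto simp: power_le_one)
      finally show "norm (sq (sec_scale E h u) x) \<le> norm (sq u x)"
        using sq_nonneg[OF m x] by simp
    qed
  qed
qed

lemma ip_scale:
  assumes "u \<in> L2 dx D E" "v \<in> L2 dx D E"
  shows "ip dx D E (sec_scale E h u) v = (LINT x|MD. h x * met E x (u x) (v x))"
  unfolding ip_MD by (rule Bochner_Integration.integral_cong)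
    (use assms[THEN L2_fib] in \<open>auto simp: space_MD intro!: met_scale_left D_X\<close>)

lemma ip_scale_right:
  assumes "u \<in> L2 dx D E" "v \<in> L2 dx D E" "\<And>x. x \<in> D \<Longrightarrow> cnj (h x) = h x"
  shows "ip dx D E u (sec_scale E h v) = ip dx D E (sec_scale E h u) v"
  unfolding ip_scale[OF assms(1,2)] unfolding ip_MD by (rule Bochner_Integration.integral_cong)
    (use assms(1,2)[THEN L2_fib] assms(3) in \<open>auto simp: space_MD met_scale_right D_X\<close>)

end

context L2_sections
begin

subsection \<open>Completeness\<close>

lemma sq_measurable_nn: "measurable_section E D u \<Longrightarrow> (\<lambda>x. ennreal (sq u x)) \<in> borel_measurable MD"
  by (intro measurable_compose[OF sq_measurable measurable_ennreal])

text \<open>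
  As \<open>\<parallel>d\<^sub>k\<parallel>\<^sup>2 \<le> 4\<^sup>-\<^sup>k\<close> for the successive differences \<open>d\<^sub>k\<close>, the function \<open>\<Sum>\<^sub>k 2\<^sup>k |d\<^sub>k|\<^sup>2\<close> has finite integral and
  is finite almost everywhere. Where it is finite, \<open>|d\<^sub>k|\<close> decays like \<open>2\<^sup>-\<^sup>k\<^sup>/\<^sup>2\<close>, and the coordinates, which are
  dominated by the length, form convergent series.
\<close>

lemma fast_Cauchy_converges_AE:
  assumes v: "\<And>k. v k \<in> L2 dx D E" and fast: "\<And>k. nrm (sec_diff E (v (Suc k)) (v k)) \<le> (1 / 2) ^ k"
  obtains Gd where "Gd \<in> sets MD" "AE x in MD. x \<in> Gd"
    "\<And>V \<tau> i x. (V, \<tau>) \<in> trv E \<Longrightarrow> x \<in> V \<inter> Gd \<Longrightarrow> i < rnk E \<Longrightarrow> convergent (\<lambda>k. \<tau> x (v k x) $ i)"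
proof -
  let ?d = "\<lambda>k. sec_diff E (v (Suc k)) (v k)"
  have d: "?d k \<in> L2 dx D E" for k by (rule L2_diff[OF v v])
  let ?S = "\<lambda>x. \<Sum>k. ennreal (2 ^ k * sq (?d k) x)"
  have m: "(\<lambda>x. ennreal (2 ^ k * sq (?d k) x)) \<in> borel_measurable MD" for k
    by (intro measurable_compose[OF _ measurable_ennreal] borel_measurable_times borel_measurable_const
        sq_measurable L2_meas d)
  have mS: "?S \<in> borel_measurable MD" by (intro borel_measurable_suminf_order m)
  have "(\<integral>\<^sup>+x. ?S x \<partial>MD) = (\<Sum>k. \<integral>\<^sup>+x. ennreal (2 ^ k * sq (?d k) x) \<partial>MD)"
    by (rule nn_integral_suminf[OF m])
  also have "\<dots> \<le> (\<Sum>k. ennreal ((1 / 2) ^ k))"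
  proof (rule suminf_le)
    fix k
    have "(\<integral>\<^sup>+x. ennreal (2 ^ k * sq (?d k) x) \<partial>MD) = (\<integral>\<^sup>+x. ennreal (2 ^ k) * ennreal (sq (?d k) x) \<partial>MD)"
      by (intro nn_integral_cong) (simp add: ennreal_mult' space_MD)
    also have "\<dots> = ennreal (2 ^ k) * (\<integral>\<^sup>+x. ennreal (sq (?d k) x) \<partial>MD)"
      by (rule nn_integral_cmult[OF sq_measurable_nn[OF L2_meas[OF d]]])
    also have "\<dots> = ennreal (2 ^ k * (nrm (?d k))\<^sup>2)"
      by (simp add: nrm_sq_nn_integral[OF d, symmetric] ennreal_mult')
    also have "\<dots> \<le> ennreal (2 ^ k * ((1 / 2) ^ k)\<^sup>2)"
      by (intro ennreal_leI mult_left_mono power_mono fast nrm_nonneg d) auto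
    also have "2 ^ k * ((1 / 2) ^ k)\<^sup>2 = (1 / 2 :: real) ^ k"
      by (simp add: power2_eq_square power_divide)
    finally show "(\<integral>\<^sup>+x. ennreal (2 ^ k * sq (?d k) x) \<partial>MD) \<le> ennreal ((1 / 2) ^ k)" .
  qed auto
  also have "\<dots> < \<infinity>"
    unfolding infinity_ennreal_def less_top[symmetric]
    by (rule ennreal_suminf_neq_top) (auto intro: summable_geometric)
  finally have fin: "(\<integral>\<^sup>+x. ?S x \<partial>MD) \<noteq> \<infinity>" by (rule less_imp_neq)
  define Gd where "Gd = {x \<in> space MD. ?S x \<noteq> \<infinity>}"
  have G1: "Gd \<in> sets MD" unfolding Gd_def using mS by measurable
  have G2: "AE x in MD. x \<in> Gd"
    using nn_integral_PInf_AE[OF mS fin] by (rule AE_mp) (auto simp: Gd_def intro!: AE_I2)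
  have G3: "convergent (\<lambda>k. \<tau> x (v k x) $ i)"
    if t: "(V, \<tau>) \<in> trv E" and x: "x \<in> V \<inter> Gd" and i: "i < rnk E" for V \<tau> i x
  proof -
    have xD: "x \<in> D" and xV: "x \<in> V" and finx: "?S x \<noteq> \<infinity>" using x by (auto simp: Gd_def space_MD)
    note nn = sq_nonneg[OF L2_meas[OF d] xD]
    have "summable (\<lambda>k. 2 ^ k * sq (?d k) x)"
      by (rule summable_suminf_not_top[OF _ finx[unfolded infinity_ennreal_def]]) (simp add: nn)
    then have "(\<lambda>k. 2 ^ k * sq (?d k) x) \<longlonglongrightarrow> 0" by (rule summable_LIMSEQ_zero)
    then have "Bseq (\<lambda>k. 2 ^ k * sq (?d k) x)" using convergent_imp_Bseq convergentI by blast
    then obtain C where C: "C > 0" "\<And>k. \<bar>2 ^ k * sq (?d k) x\<bar> \<le> C" by (auto simp: Bseq_def)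
    obtain B where B: "B \<ge> 0" "\<And>a. a \<in> fib E x \<Longrightarrow> cmod (\<tau> x a $ i) \<le> B * sqrt (Re (met E x a a))"
      using coord_bound[OF t xV i] by blast
    have bd: "cmod (\<tau> x (v (Suc k) x) $ i - \<tau> x (v k x) $ i) \<le> (B * sqrt C) * (sqrt (1 / 2)) ^ k" for k
    proof -
      have "sq (?d k) x \<le> C * (1 / 2) ^ k"
        using C(2)[of k] nn[of k] by (simp add: field_simps)
      then have "sqrt (sq (?d k) x) \<le> sqrt C * (sqrt (1 / 2)) ^ k"
        by (metis real_sqrt_le_mono real_sqrt_mult real_sqrt_power)
      moreover have "cmod (\<tau> x (?d k x) $ i) \<le> B * sqrt (sq (?d k) x)"
        by (rule B(2)[OF L2_fib[OF d xD]])
      ultimately have "cmod (\<tau> x (?d k x) $ i) \<le> B * (sqrt C * (sqrt (1 / 2)) ^ k)"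
        using B(1) by (meson mult_left_mono order_trans)
      then show ?thesis
        using sec_diff_comp[of V \<tau> x "v (Suc k)" "v k" i, OF t xV L2_fib[OF v xD] L2_fib[OF v xD] i]
        by (simp add: mult.assoc)
    qed
    have "summable (\<lambda>k. \<tau> x (v (Suc k) x) $ i - \<tau> x (v k x) $ i)"
    proof (rule summable_comparison_test'[where N = 0])
      show "summable (\<lambda>k. (B * sqrt C) * (sqrt (1 / 2)) ^ k)"
        by (intro summable_mult summable_geometric) (simp add: real_sqrt_divide)
    qed (rule bd)
    then have "convergent (\<lambda>n. \<Sum>k<n. \<tau> x (v (Suc k) x) $ i - \<tau> x (v k x) $ i)"
      by (simp add: summable_iff_convergent)
    then have "convergent (\<lambda>n. \<tau> x (v n x) $ i - \<tau> x (v 0 x) $ i)"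
      using sum_lessThan_telescope[of "\<lambda>k. \<tau> x (v k x) $ i"] by simp
    then show ?thesis using convergent_diff_const_right_iff by blast
  qed
  show ?thesis by (rule that, rule G1, rule G2, erule (2) G3)
qed

text \<open>
  Changes of trivialisation are linear on each fibre and therefore compatible with pointwise limits of
  coordinates. Measurability of the limit can be checked in each trivialisation.
\<close>

lemma pointwise_limit_section:
  assumes v: "\<And>k. v k \<in> L2 dx D E" and G: "Gd \<in> sets MD"
    and conv: "\<And>V \<tau> i x. (V, \<tau>) \<in> trv E \<Longrightarrow> x \<in> V \<inter> Gd \<Longrightarrow> i < rnk E \<Longrightarrow>
      convergent (\<lambda>k. \<tau> x (v k x) $ i)"
  obtains l where "measurable_section E D l"
    "\<And>V \<tau> i x. (V, \<tau>) \<in> trv E \<Longrightarrow> x \<in> V \<inter> Gd \<Longrightarrow> i < rnk E \<Longrightarrow>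
      (\<lambda>k. \<tau> x (v k x) $ i) \<longlonglongrightarrow> \<tau> x (l x) $ i"
proof -
  have GD: "Gd \<subseteq> D" using sets.sets_into_space[OF G] by (simp add: space_MD)
  define l where "l x = (if x \<in> Gd
      then inv_into (fib E x) (fib_coord E x) (vec (rnk E) (\<lambda>i. lim (\<lambda>k. fib_coord E x (v k x) $ i)))
      else fib_zero E x)" for x
  have lf: "l x \<in> fib E x" if x: "x \<in> D" for x
  proof -
    obtain V \<tau> where t: "(V, \<tau>) \<in> trv E" "x \<in> V" using triv_cover[OF D_X[OF x]] by blast
    show ?thesis using fib_vec_in[OF D_X[OF x]] fib_zero_in[OF t] by (simp add: l_def)
  qed
  have lim: "(\<lambda>k. \<tau> x (v k x) $ i) \<longlonglongrightarrow> \<tau> x (l x) $ i"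
    if t: "(V, \<tau>) \<in> trv E" and x: "x \<in> V \<inter> Gd" and i: "i < rnk E" for V \<tau> i x
  proof -
    have xD: "x \<in> D" and xV: "x \<in> V" using x GD by auto
    obtain V0 \<tau>0 where t0: "(V0, \<tau>0) \<in> trv E" "x \<in> V0" "fib_coord E x = \<tau>0 x"
      using fib_coord_triv[OF D_X[OF xD]] by blast
    obtain g where g: "g \<in> carrier_mat (rnk E) (rnk E)"
      "\<And>a. a \<in> fib E x \<Longrightarrow> \<tau> x a = g *\<^sub>v fib_coord E x a"
      using triv_change_coord[OF t xV] by blast
    have exp: "\<tau> x a $ i = (\<Sum>j<rnk E. g $$ (i, j) * fib_coord E x a $ j)" if "a \<in> fib E x" for a
      using g(2)[OF that] g(1) i fib_coord_carrier[OF D_X[OF xD] that]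
      by (simp add: scalar_prod_def lessThan_atLeast0)
    have lc: "fib_coord E x (l x) $ j = lim (\<lambda>k. fib_coord E x (v k x) $ j)" if "j < rnk E" for j
    proof -
      have "fib_coord E x (l x) = vec (rnk E) (\<lambda>i. lim (\<lambda>k. fib_coord E x (v k x) $ i))"
        using x fib_vec_coord[OF D_X[OF xD]] by (simp add: l_def)
      then show ?thesis using that by simp
    qed
    have "(\<lambda>k. fib_coord E x (v k x) $ j) \<longlonglongrightarrow> fib_coord E x (l x) $ j" if "j < rnk E" for j
      unfolding lc[OF that] using conv[OF t0(1) _ that, of x] x t0(2,3) convergent_LIMSEQ_iff by auto
    then have "(\<lambda>k. \<Sum>j<rnk E. g $$ (i, j) * fib_coord E x (v k x) $ j)
        \<longlonglongrightarrow> (\<Sum>j<rnk E. g $$ (i, j) * fib_coord E x (l x) $ j)"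
      by (intro tendsto_sum tendsto_mult tendsto_const) auto
    then show ?thesis using exp[OF lf[OF xD]] exp[OF L2_fib[OF v xD]] by simp
  qed
  have "measurable_section E D l"
  proof (rule measurable_sectionI[OF lf])
    fix V \<tau> i assume t: "(V, \<tau>) \<in> trv E" "i < rnk E"
    let ?M = "restrict_space borel (V \<inter> D)"
    have ind: "(\<lambda>x. indicator Gd x :: complex) \<in> borel_measurable ?M"
      by (rule measurable_triv_restrict[OF _ t(1)]) (use G in auto)
    show "(\<lambda>x. \<tau> x (l x) $ i) \<in> borel_measurable ?M"
    proof (rule borel_measurable_LIMSEQ_metric)
      show "(\<lambda>x. indicator Gd x * \<tau> x (v k x) $ i) \<in> borel_measurable ?M" for k
        by (intro borel_measurable_times ind measurable_section_comp[OF L2_meas[OF v] t])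
      fix x assume "x \<in> space ?M"
      then have x: "x \<in> V" "x \<in> D" by (auto simp: space_VD)
      show "(\<lambda>k. indicator Gd x * \<tau> x (v k x) $ i) \<longlonglongrightarrow> \<tau> x (l x) $ i"
      proof (cases "x \<in> Gd")
        case True
        then show ?thesis using lim[OF t(1) _ t(2), of x] x(1) by simp
      next
        case False
        then have "\<tau> x (l x) $ i = 0" using triv_fib_zero[OF t(1) x(1)] t(2) by (simp add: l_def)
        then show ?thesis using False by simp
      qed
    qed
  qed
  then show ?thesis by (rule that) (erule (2) lim)
qed

text \<open>
  The Riesz-Fischer argument: a rapidly convergent subsequence converges almost everywhere in all
  coordinates, and Fatou's lemma shows that its pointwise limit is also the limit in norm.
\<close>

theorem L2_complete:
  assumes s: "\<And>k. s k \<in> L2 dx D E"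
    and Cauchy: "\<And>e. e > 0 \<Longrightarrow> \<exists>N. \<forall>m\<ge>N. \<forall>n\<ge>N. nrm (sec_diff E (s m) (s n)) < e"
  shows "\<exists>l\<in>L2 dx D E. (\<lambda>k::nat. nrm (sec_diff E (s k) l)) \<longlonglongrightarrow> 0"
proof -
  have "\<forall>k. \<exists>N. \<forall>m\<ge>N. \<forall>n\<ge>N. nrm (sec_diff E (s m) (s n)) < (1 / 2) ^ k" using Cauchy by simp
  then obtain N where N: "\<And>k m n. m \<ge> N k \<Longrightarrow> n \<ge> N k \<Longrightarrow> nrm (sec_diff E (s m) (s n)) < (1 / 2) ^ k"
    by metis
  \<comment> \<open>The sum is at least each of \<open>N 0, \<dots>, N k\<close>, so \<open>n k\<close> is admissible for all earlier indices as well.\<close>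
  define n where "n k = (\<Sum>i\<le>k. N i)" for k
  have n: "N j \<le> n k" if "j \<le> k" for j k
    unfolding n_def by (rule member_le_sum) (use that in auto)
  define v where "v k = s (n k)" for k
  have v: "v k \<in> L2 dx D E" for k by (simp add: v_def s)
  have fast: "nrm (sec_diff E (v (Suc k)) (v k)) \<le> (1 / 2) ^ k" for k
    using N[of k "n (Suc k)" "n k"] n[of k k] n[of k "Suc k"] by (simp add: v_def)
  obtain Gd where G: "Gd \<in> sets MD" "AE x in MD. x \<in> Gd"
    and conv: "\<And>V \<tau> i x. (V, \<tau>) \<in> trv E \<Longrightarrow> x \<in> V \<inter> Gd \<Longrightarrow> i < rnk E \<Longrightarrow> convergent (\<lambda>k. \<tau> x (v k x) $ i)"
    by (rule fast_Cauchy_converges_AE[OF v fast]) (rule that)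
  obtain l where l: "measurable_section E D l"
    and lim: "\<And>V \<tau> i x. (V, \<tau>) \<in> trv E \<Longrightarrow> x \<in> V \<inter> Gd \<Longrightarrow> i < rnk E \<Longrightarrow>
      (\<lambda>k. \<tau> x (v k x) $ i) \<longlonglongrightarrow> \<tau> x (l x) $ i"
    by (rule pointwise_limit_section[of v Gd], rule v, rule G(1), erule (2) conv, rule that)
  have GD: "Gd \<subseteq> D" using sets.sets_into_space[OF G(1)] by (simp add: space_MD)
  have sq_lim: "(\<lambda>k. sq (sec_diff E (s m) (v k)) x) \<longlonglongrightarrow> sq (sec_diff E (s m) l) x" if x: "x \<in> Gd" for m x
  proof -
    have xD: "x \<in> D" using x GD by auto
    obtain V \<tau> where t: "(V, \<tau>) \<in> trv E" "x \<in> V" using triv_cover D_X[OF xD] by blast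
    let ?c = "\<lambda>w i. \<tau> x (s m x) $ i - \<tau> x (w x) $ i"
    have e: "sq (sec_diff E (s m) w) x = Re (\<Sum>i<rnk E. (\<Sum>j<rnk E. gram (V, \<tau>) x $$ (i, j) * ?c w j) * cnj (?c w i))"
      if w: "measurable_section E D w" for w
    proof -
      note f = L2_fib[OF s xD, of m] measurable_section_fib[OF w xD]
      show ?thesis
        using sec_diff_comp[of V \<tau> x "s m" w, OF t f] met_expand[OF t, of "sec_diff E (s m) w x" "sec_diff E (s m) w x"]
          sec_in_fib(1)[of x "s m" w, OF D_X[OF xD] f] by simp
    qed
    have "(\<lambda>k. Re (\<Sum>i<rnk E. (\<Sum>j<rnk E. gram (V, \<tau>) x $$ (i, j) * ?c (v k) j) * cnj (?c (v k) i)))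
      \<longlonglongrightarrow> Re (\<Sum>i<rnk E. (\<Sum>j<rnk E. gram (V, \<tau>) x $$ (i, j) * ?c l j) * cnj (?c l i))"
      by (intro tendsto_Re tendsto_sum tendsto_mult tendsto_const tendsto_cnj tendsto_diff lim[OF t(1)])
        (use t x in auto)
    then show ?thesis unfolding e[OF l] e[OF L2_meas[OF v]] .
  qed
  have dm: "measurable_section E D (sec_diff E (s m) l)" for m
    by (rule measurable_section_diff[OF L2_meas[OF s] l])
  have est: "(\<integral>\<^sup>+x. ennreal (sq (sec_diff E (s m) l) x) \<partial>MD) \<le> ennreal (((1 / 2) ^ j)\<^sup>2)" if m: "m \<ge> N j" for m j
  proof -
    let ?g = "\<lambda>k x. ennreal (sq (sec_diff E (s m) (v k)) x)"
    have dk: "sec_diff E (s m) (v k) \<in> L2 dx D E" for k by (rule L2_diff[OF s v])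
    have "(\<integral>\<^sup>+x. ennreal (sq (sec_diff E (s m) l) x) \<partial>MD) = (\<integral>\<^sup>+x. liminf (\<lambda>k. ?g k x) \<partial>MD)"
    proof (rule nn_integral_cong_AE, rule AE_mp[OF G(2)], rule AE_I2, rule impI)
      fix x assume "x \<in> Gd"
      then have "(\<lambda>k. ?g k x) \<longlonglongrightarrow> ennreal (sq (sec_diff E (s m) l) x)"
        by (intro tendsto_ennrealI sq_lim)
      then show "ennreal (sq (sec_diff E (s m) l) x) = liminf (\<lambda>k. ?g k x)"
        by (simp add: lim_imp_Liminf)
    qed
    also have "\<dots> \<le> liminf (\<lambda>k. \<integral>\<^sup>+x. ?g k x \<partial>MD)"
      by (rule nn_integral_liminf) (rule sq_measurable_nn[OF L2_meas[OF dk]])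
    also have "\<dots> \<le> ennreal (((1 / 2) ^ j)\<^sup>2)"
    proof (rule Liminf_le)
      have "(\<integral>\<^sup>+x. ?g k x \<partial>MD) \<le> ennreal (((1 / 2) ^ j)\<^sup>2)" if "k \<ge> j" for k
      proof -
        have "nrm (sec_diff E (s m) (v k)) \<le> (1 / 2) ^ j"
          unfolding v_def by (rule less_imp_le[OF N[OF m n[OF that]]])
        then show ?thesis
          by (subst nrm_sq_nn_integral[OF dk, symmetric]) (intro ennreal_leI power_mono nrm_nonneg dk)
      qed
      then show "\<forall>\<^sub>F k in sequentially. (\<integral>\<^sup>+x. ?g k x \<partial>MD) \<le> ennreal (((1 / 2) ^ j)\<^sup>2)"
        using eventually_sequentially by blast
    qed simp
    finally show ?thesis .
  qed
  have dL2: "sec_diff E (s m) l \<in> L2 dx D E" if "m \<ge> N j" for m j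
    unfolding L2_iff
  proof
    have "(\<integral>\<^sup>+x. ennreal (norm (sq (sec_diff E (s m) l) x)) \<partial>MD) = (\<integral>\<^sup>+x. ennreal (sq (sec_diff E (s m) l) x) \<partial>MD)"
      by (intro nn_integral_cong) (simp add: space_MD sq_nonneg[OF dm])
    also have "\<dots> < \<infinity>" using est[OF that] by (metis ennreal_less_top infinity_ennreal_def le_less_trans)
    finally show "integrable MD (sq (sec_diff E (s m) l))"
      using sq_measurable[OF dm] by (intro integrableI_bounded)
  qed (rule dm)
  have l2: "l \<in> L2 dx D E"
  proof -
    \<comment> \<open>\<open>l = s - (s - l)\<close> exhibits \<open>l\<close> as a difference of square integrable sections.\<close>
    define z where "z = sec_diff E (s (N 0)) (sec_diff E (s (N 0)) l)"
    have z: "z \<in> L2 dx D E" unfolding z_def by (rule L2_diff[OF s dL2[of 0]]) simp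
    have "z x = l x" if x: "x \<in> D" for x
    proof -
      obtain V \<tau> where t: "(V, \<tau>) \<in> trv E" "x \<in> V" using triv_cover D_X[OF x] by blast
      note f = L2_fib[OF s x, of "N 0"] measurable_section_fib[OF l x]
      have fd: "sec_diff E (s (N 0)) l x \<in> fib E x" by (rule measurable_section_fib[OF dm x])
      have "\<tau> x (z x) $ i = \<tau> x (l x) $ i" if "i < rnk E" for i
        using sec_diff_comp[of V \<tau> x "s (N 0)" l i, OF t f that]
          sec_diff_comp[of V \<tau> x "s (N 0)" "sec_diff E (s (N 0)) l" i, OF t f(1) fd that]
        by (simp add: z_def)
      then have "\<tau> x (z x) = \<tau> x (l x)"
        using triv_carrier[OF t L2_fib[OF z x]] triv_carrier[OF t f(2)] by (intro eq_vecI) auto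
      then show ?thesis using triv_eqI[OF t L2_fib[OF z x] f(2)] by blast
    qed
    then have "integrable MD (sq l) \<longleftrightarrow> integrable MD (sq z)"
      by (intro Bochner_Integration.integrable_cong) (auto simp: space_MD)
    then show ?thesis using l L2_int[OF z] by (simp add: L2_iff)
  qed
  have "(\<lambda>k. nrm (sec_diff E (s k) l)) \<longlonglongrightarrow> 0"
  proof (rule LIMSEQ_I)
    fix e :: real assume "e > 0"
    then obtain j where j: "(1 / 2 :: real) ^ j < e" using real_arch_pow_inv[of e "1 / 2"] by auto
    have "norm (nrm (sec_diff E (s k) l) - 0) < e" if k: "k \<ge> N j" for k
    proof -
      have d: "sec_diff E (s k) l \<in> L2 dx D E" by (rule dL2[OF k])
      have "ennreal ((nrm (sec_diff E (s k) l))\<^sup>2) \<le> ennreal (((1 / 2) ^ j)\<^sup>2)"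
        using est[OF k] by (simp add: nrm_sq_nn_integral[OF d])
      then have "(nrm (sec_diff E (s k) l))\<^sup>2 \<le> ((1 / 2) ^ j)\<^sup>2" by (simp add: ennreal_le_iff)
      then have "nrm (sec_diff E (s k) l) \<le> (1 / 2) ^ j" by (rule power2_le_imp_le) simp
      then show ?thesis using j nrm_nonneg[OF d] by simp
    qed
    then show "\<exists>M. \<forall>k\<ge>M. norm (nrm (sec_diff E (s k) l) - 0) < e" by blast
  qed
  with l2 show ?thesis by blast
qed

end

section \<open>Differential operators\<close>

lemma diff_operator_fib:
  assumes "diff_operator \<A> Q k E G P" "open W" "W \<subseteq> Q" "smooth_section \<A> E W u" "x \<in> W"
  shows "P u x \<in> fib G x"
proof -
  have "openin (top_of_set Q) W"
    using openin_open_Int[OF assms(2), of Q] assms(3) by (simp add: Int_absorb1)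
  then show ?thesis using assms(1,4,5) unfolding diff_operator_def by (elim conjE) blast
qed

text \<open>
  On an open set the coordinates of a smooth section are smooth themselves and may serve as
  the extensions that occur in the local representation of an operator.
\<close>

lemma diff_operator_expansion:
  assumes E: "vbundle_over \<A> X E" and Q: "Q \<subseteq> X" and P: "diff_operator \<A> Q k E G P"
    and c: "(U, \<phi>) \<in> \<A>" and s: "(V, \<tau>) \<in> trv E" and t: "(V', \<sigma>) \<in> trv G"
  obtains a where
    "\<And>\<alpha> i j. mdeg \<alpha> \<le> k \<Longrightarrow> i < rnk G \<Longrightarrow> j < rnk E \<Longrightarrow>
      smooth_on \<A> (U \<inter> V \<inter> V' \<inter> Q) (\<lambda>x. a \<alpha> x $$ (i, j))"
    "\<And>W u y i. open W \<Longrightarrow> W \<subseteq> Q \<Longrightarrow> smooth_section \<A> E W u \<Longrightarrow> y \<in> W \<inter> U \<inter> V \<inter> V' \<Longrightarrow>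
      i < rnk G \<Longrightarrow> \<sigma> y (P u y) $ i = (\<Sum>\<alpha> | mdeg \<alpha> \<le> k. \<Sum>j<rnk E. a \<alpha> y $$ (i, j) *
        mderiv \<alpha> ((\<lambda>x. \<tau> x (u x) $ j) \<circ> inv_into U \<phi>) (\<phi> y))"
proof -
  interpret E: vbundle_over \<A> X E by fact
  have "\<forall>c\<in>\<A>. \<forall>s\<in>trv E. \<forall>t\<in>trv G. \<exists>a. local_rep \<A> Q k E G P c s t a"
    using P unfolding diff_operator_def by (elim conjE)
  then obtain a where "local_rep \<A> Q k E G P (U, \<phi>) (V, \<tau>) (V', \<sigma>) a" using c s t by blast
  note lr = this[unfolded local_rep_def prod.case Let_def]
  show ?thesis
  proof (rule that[of a])
    fix \<alpha> :: "'b \<Rightarrow> nat" and i j assume "mdeg \<alpha> \<le> k" "i < rnk G" "j < rnk E"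
    then show "smooth_on \<A> (U \<inter> V \<inter> V' \<inter> Q) (\<lambda>x. a \<alpha> x $$ (i, j))"
      using conjunct1[OF lr, rule_format, of \<alpha>] by simp
  next
    fix W u y i assume W: "open W" "W \<subseteq> Q" and u: "smooth_section \<A> E W u"
      and y: "y \<in> W \<inter> U \<inter> V \<inter> V'" and i: "i < rnk G"
    have WX: "W \<subseteq> X" using W(2) Q by blast
    let ?O = "U \<inter> (V \<inter> W)"
    have "openin (top_of_set Q) W"
      using openin_open_Int[OF W(1), of Q] W(2) by (simp add: Int_absorb1)
    moreover have o: "open ?O" using chart_open[OF E.mfd c] E.triv_open[OF s W(1) WX] by auto
    moreover have "smooth_on_open \<A> ?O (\<lambda>x. \<tau> x (u x) $ j)" if "j < rnk E" for j
      by (rule smooth_on_open_subset[OF E.mfd E.smooth_section_comp[OF u W(1) WX s that] o]) auto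
    ultimately show "\<sigma> y (P u y) $ i = (\<Sum>\<alpha> | mdeg \<alpha> \<le> k. \<Sum>j<rnk E. a \<alpha> y $$ (i, j) *
        mderiv \<alpha> ((\<lambda>x. \<tau> x (u x) $ j) \<circ> inv_into U \<phi>) (\<phi> y))"
      using y i u W(2)
      by (intro conjunct2[OF lr, rule_format, of W u y ?O "\<lambda>j x. \<tau> x (u x) $ j"]) auto
  qed
qed

text \<open>
  In coordinates the operator is a sum of derivatives with fixed coefficients, hence additive. The base \<open>Q\<close> of the operator may be smaller than that of \<open>E\<close>,
  because the boundary operators live near \<open>\<partial>D\<close> only.
\<close>

lemma diff_operator_diff:
  assumes E: "vbundle_over \<A> X E" and G: "vbundle_over \<A> Q G" and Q: "Q \<subseteq> X"
    and P: "diff_operator \<A> Q k E G P"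
    and W: "open W" "W \<subseteq> Q" and u: "smooth_section \<A> E W u" and v: "smooth_section \<A> E W v"
    and y: "y \<in> W"
  shows "P (sec_diff E u v) y = sec_diff G (P u) (P v) y"
proof -
  interpret E: vbundle_over \<A> X E by fact
  interpret G: vbundle_over \<A> Q G by fact
  have WX: "W \<subseteq> X" using W(2) Q by blast
  obtain U \<phi> where c: "(U, \<phi>) \<in> \<A>" "y \<in> U" using chart_cover[OF E.mfd] by blast
  obtain V \<tau> where s: "(V, \<tau>) \<in> trv E" "y \<in> V" using E.triv_cover y WX by blast
  obtain V' \<sigma> where t: "(V', \<sigma>) \<in> trv G" "y \<in> V'" using G.triv_cover y W(2) by blast
  obtain a where a: "\<And>u i. smooth_section \<A> E W u \<Longrightarrow> i < rnk G \<Longrightarrow>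
      \<sigma> y (P u y) $ i = (\<Sum>\<alpha> | mdeg \<alpha> \<le> k. \<Sum>j<rnk E. a \<alpha> y $$ (i, j) *
        mderiv \<alpha> ((\<lambda>x. \<tau> x (u x) $ j) \<circ> inv_into U \<phi>) (\<phi> y))"
    using y c s t W by (rule_tac diff_operator_expansion[OF E Q P c(1) s(1) t(1)]) blast
  have d: "smooth_section \<A> E W (sec_diff E u v)" by (rule E.smooth_section_diff[OF u v W(1) WX])
  note f = diff_operator_fib[OF P W u y] diff_operator_fib[OF P W v y] diff_operator_fib[OF P W d y]
  let ?O = "U \<inter> (V \<inter> W)"
  have o: "open ?O" using chart_open[OF E.mfd c(1)] E.triv_open[OF s(1) W(1) WX] by auto
  have \<phi>O: "open (\<phi> ` ?O)" by (rule chart_open_image[OF E.mfd c(1) o]) auto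
  have sm: "Cinf_on (\<phi> ` ?O) ((\<lambda>x. \<tau> x (w x) $ j) \<circ> inv_into U \<phi>)"
    if "smooth_section \<A> E W w" "j < rnk E" for w j
    by (rule smooth_on_open_chart[OF E.smooth_section_comp[OF that(1) W(1) WX s(1) that(2)] c(1)]) auto
  have m: "mderiv \<alpha> ((\<lambda>x. \<tau> x (sec_diff E u v x) $ j) \<circ> inv_into U \<phi>) (\<phi> y)
      = mderiv \<alpha> ((\<lambda>x. \<tau> x (u x) $ j) \<circ> inv_into U \<phi>) (\<phi> y)
        - mderiv \<alpha> ((\<lambda>x. \<tau> x (v x) $ j) \<circ> inv_into U \<phi>) (\<phi> y)" if j: "j < rnk E" for \<alpha> j
  proof (rule mderiv_diff_cong[OF \<phi>O sm[OF u j] sm[OF v j]])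
    fix z assume "z \<in> \<phi> ` ?O"
    then have "inv_into U \<phi> z \<in> ?O" using chart_inj[OF E.mfd c(1)] by auto
    then show "((\<lambda>x. \<tau> x (sec_diff E u v x) $ j) \<circ> inv_into U \<phi>) z
        = ((\<lambda>x. \<tau> x (u x) $ j) \<circ> inv_into U \<phi>) z - ((\<lambda>x. \<tau> x (v x) $ j) \<circ> inv_into U \<phi>) z"
      using E.sec_diff_comp[OF s(1) _ _ _ j, of _ u v] E.smooth_section_fib[OF u] E.smooth_section_fib[OF v]
      by auto
  qed (use y c s in auto)
  have "\<sigma> y (P (sec_diff E u v) y) $ i = \<sigma> y (sec_diff G (P u) (P v) y) $ i" if i: "i < rnk G" for i
    unfolding G.sec_diff_comp[of V' \<sigma> y "P u" "P v" i, OF t f(1,2) i] a[OF d i] a[OF u i] a[OF v i]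
    by (simp add: m right_diff_distrib sum_subtractf)
  moreover note g = G.sec_diff_fib[of V' \<sigma> y "P u" "P v", OF t f(1,2)]
  ultimately have "\<sigma> y (P (sec_diff E u v) y) = \<sigma> y (sec_diff G (P u) (P v) y)"
    using G.triv_carrier[OF t f(3)] G.triv_carrier[OF t g] by (intro eq_vecI) auto
  then show ?thesis by (rule G.triv_eqI[OF t f(3) g])
qed

lemma diff_operator_smooth:
  assumes E: "vbundle_over \<A> X E" and G: "vbundle_over \<A> X G" and P: "diff_operator \<A> X k E G P"
    and W: "open W" "W \<subseteq> X" and u: "smooth_section \<A> E W u"
  shows "smooth_section \<A> G W (P u)"
proof -
  interpret E: vbundle_over \<A> X E by fact
  interpret G: vbundle_over \<A> X G by fact
  show ?thesis
  proof (rule G.smooth_section_local[OF W])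
    show "P u x \<in> fib G x" if "x \<in> W" for x by (rule diff_operator_fib[OF P W u that])
    fix y assume y: "y \<in> W"
    obtain U \<phi> where c: "(U, \<phi>) \<in> \<A>" "y \<in> U" using chart_cover[OF E.mfd] by blast
    obtain V \<tau> where s: "(V, \<tau>) \<in> trv E" "y \<in> V" using E.triv_cover y W(2) by blast
    obtain V' \<sigma> where t: "(V', \<sigma>) \<in> trv G" "y \<in> V'" using G.triv_cover y W(2) by blast
    obtain a where a: "\<And>\<alpha> i j. mdeg \<alpha> \<le> k \<Longrightarrow> i < rnk G \<Longrightarrow> j < rnk E \<Longrightarrow>
        smooth_on \<A> (U \<inter> V \<inter> V' \<inter> X) (\<lambda>x. a \<alpha> x $$ (i, j))"
      "\<And>y i. y \<in> W \<inter> U \<inter> V \<inter> V' \<Longrightarrow> i < rnk G \<Longrightarrow>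
        \<sigma> y (P u y) $ i = (\<Sum>\<alpha> | mdeg \<alpha> \<le> k. \<Sum>j<rnk E. a \<alpha> y $$ (i, j) *
          mderiv \<alpha> ((\<lambda>x. \<tau> x (u x) $ j) \<circ> inv_into U \<phi>) (\<phi> y))"
      by (rule diff_operator_expansion[OF E order_refl P c(1) s(1) t(1)]) (use W u in blast)
    let ?O = "U \<inter> (V \<inter> W) \<inter> (V' \<inter> W)"
    have o: "open ?O"
      using chart_open[OF E.mfd c(1)] E.triv_open[OF s(1) W] G.triv_open[OF t(1) W] by auto
    have "smooth_on_open \<A> ?O (\<lambda>x. \<sigma> x (P u x) $ i)" if i: "i < rnk G" for i
    proof (rule smooth_on_open_cong[OF E.mfd])
      show "smooth_on_open \<A> ?O (\<lambda>x. \<Sum>\<alpha> | mdeg \<alpha> \<le> k. \<Sum>j<rnk E. a \<alpha> x $$ (i, j) *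
          mderiv \<alpha> ((\<lambda>x. \<tau> x (u x) $ j) \<circ> inv_into U \<phi>) (\<phi> x))"
      proof (intro smooth_on_open_sum[OF E.mfd o] smooth_on_open_mult[OF E.mfd])
        fix \<alpha> :: "'b \<Rightarrow> nat" and j assume \<alpha>: "\<alpha> \<in> {\<alpha>. mdeg \<alpha> \<le> k}" and j: "j \<in> {..<rnk E}"
        show "smooth_on_open \<A> ?O (\<lambda>x. a \<alpha> x $$ (i, j))"
          by (rule smooth_on_imp_open[OF E.mfd a(1)[OF _ i] o]) (use \<alpha> j W(2) in auto)
        have cf: "Cinf_on (\<phi> ` ?O) ((\<lambda>x. \<tau> x (u x) $ j) \<circ> inv_into U \<phi>)"
          by (rule smooth_on_open_chart[OF E.smooth_section_comp[OF u W s(1)] c(1)]) (use j in auto)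
        show "smooth_on_open \<A> ?O (\<lambda>x. mderiv \<alpha> ((\<lambda>x. \<tau> x (u x) $ j) \<circ> inv_into U \<phi>) (\<phi> x))"
          by (rule smooth_on_open_in_chart[OF E.mfd c(1) o _ Cinf_on_mderiv[OF cf]]) auto
      qed
      show "(\<Sum>\<alpha> | mdeg \<alpha> \<le> k. \<Sum>j<rnk E. a \<alpha> x $$ (i, j) *
          mderiv \<alpha> ((\<lambda>x. \<tau> x (u x) $ j) \<circ> inv_into U \<phi>) (\<phi> x)) = \<sigma> x (P u x) $ i" if "x \<in> ?O" for x
        by (rule a(2)[OF _ i, symmetric]) (use that in auto)
    qed
    then show "\<exists>V \<tau> O'. (V, \<tau>) \<in> trv G \<and> y \<in> O' \<and> O' \<subseteq> V \<inter> W \<and>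
        (\<forall>i<rnk G. smooth_on_open \<A> O' (\<lambda>x. \<tau> x (P u x) $ i))"
      using t c s y by (intro exI[of _ V'] exI[of _ \<sigma>] exI[of _ ?O]) auto
  qed
qed

section \<open>The space \<open>\<D>\<^sub>T\<close>\<close>

text \<open>
  The boundary conditions are represented by the set \<open>C\<close> of the smooth sections that satisfy them;
  \<open>\<D>\<^sub>T\<close> is its completion.
\<close>

locale cauchy_setting = E: L2_sections \<A> X E dx D + F: L2_sections \<A> X F dx D
  for \<A> :: "('m::{t2_space, second_countable_topology}, 'n::finite) chart set" and X :: "'m set"
    and E :: "('m, 'e) hbundle" and F :: "('m, 'f) hbundle" and dx :: "'m measure" and D :: "'m set" +
  fixes m :: nat and A :: "('m \<Rightarrow> 'e) \<Rightarrow> ('m \<Rightarrow> 'f)" and C :: "('m \<Rightarrow> 'e) set"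
  assumes A: "diff_operator \<A> X m E F A"
    and C_smooth: "C \<subseteq> smooth_closure_sections \<A> X D E"
    and C_diff: "\<And>u v. u \<in> C \<Longrightarrow> v \<in> C \<Longrightarrow> sec_diff E u v \<in> C"
begin

definition DT :: "(('m \<Rightarrow> 'e) \<times> ('m \<Rightarrow> 'f)) set" where
  "DT = completion_T dx D E F A C"

lemma A_smooth: "u \<in> smooth_closure_sections \<A> X D E \<Longrightarrow> A u \<in> smooth_closure_sections \<A> X D F"
  unfolding smooth_closure_sections_def
  using diff_operator_smooth[OF E.vbundle_over_axioms F.vbundle_over_axioms A] by blast

lemma A_diff:
  assumes "u \<in> smooth_closure_sections \<A> X D E" "v \<in> smooth_closure_sections \<A> X D E" "x \<in> D"
  shows "A (sec_diff E u v) x = sec_diff F (A u) (A v) x"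
proof -
  obtain W1 where W1: "open W1" "closure D \<subseteq> W1" "W1 \<subseteq> X" "smooth_section \<A> E W1 u"
    using assms(1) by (auto simp: smooth_closure_sections_def)
  obtain W2 where W2: "open W2" "closure D \<subseteq> W2" "W2 \<subseteq> X" "smooth_section \<A> E W2 v"
    using assms(2) by (auto simp: smooth_closure_sections_def)
  show ?thesis
    by (rule diff_operator_diff[OF E.vbundle_over_axioms F.vbundle_over_axioms order_refl A, of "W1 \<inter> W2"])
      (use W1 W2 subsetD[OF closure_subset assms(3)] in \<open>auto intro: E.smooth_section_subset\<close>)
qed

lemma C_L2: "u \<in> C \<Longrightarrow> u \<in> L2 dx D E"
  using C_smooth E.smooth_closure_sections_L2 by blast

lemma AC_L2: "u \<in> C \<Longrightarrow> A u \<in> L2 dx D F"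
  using C_smooth A_smooth F.smooth_closure_sections_L2 by blast

lemma DT_iff: "v \<in> DT \<longleftrightarrow> fst v \<in> L2 dx D E \<and> snd v \<in> L2 dx D F \<and>
    (\<exists>s. (\<forall>k. s k \<in> C) \<and> (\<lambda>k::nat. E.nrm (sec_diff E (s k) (fst v))) \<longlonglongrightarrow> 0 \<and>
      (\<lambda>k. F.nrm (sec_diff F (A (s k)) (snd v))) \<longlonglongrightarrow> 0)"
  by (cases v) (simp add: DT_def completion_T_def E.L2norm_nrm F.L2norm_nrm)

lemma DT_L2: "v \<in> DT \<Longrightarrow> fst v \<in> L2 dx D E" "v \<in> DT \<Longrightarrow> snd v \<in> L2 dx D F"
  by (simp_all add: DT_iff)

lemma DT_approx:
  assumes "v \<in> DT"
  obtains s where "\<And>k. s k \<in> C" "(\<lambda>k::nat. E.nrm (sec_diff E (s k) (fst v))) \<longlonglongrightarrow> 0"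
    "(\<lambda>k. F.nrm (sec_diff F (A (s k)) (snd v))) \<longlonglongrightarrow> 0"
  using assms unfolding DT_iff by blast

lemma DT_diff:
  assumes "v \<in> DT" "w \<in> DT"
  shows "(sec_diff E (fst v) (fst w), sec_diff F (snd v) (snd w)) \<in> DT"
proof -
  obtain s where s: "\<And>k. s k \<in> C" "(\<lambda>k::nat. E.nrm (sec_diff E (s k) (fst v))) \<longlonglongrightarrow> 0"
    "(\<lambda>k. F.nrm (sec_diff F (A (s k)) (snd v))) \<longlonglongrightarrow> 0" by (rule DT_approx[OF assms(1)], rule that)
  obtain r where r: "\<And>k. r k \<in> C" "(\<lambda>k::nat. E.nrm (sec_diff E (r k) (fst w))) \<longlonglongrightarrow> 0"
    "(\<lambda>k. F.nrm (sec_diff F (A (r k)) (snd w))) \<longlonglongrightarrow> 0" by (rule DT_approx[OF assms(2)], rule that)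
  note L = DT_L2[OF assms(1)] DT_L2[OF assms(2)]
  let ?q = "\<lambda>k. sec_diff E (s k) (r k)"
  have q: "?q k \<in> C" for k by (rule C_diff[OF s(1) r(1)])
  have "(\<lambda>k. E.nrm (sec_diff E (?q k) (sec_diff E (fst v) (fst w)))) \<longlonglongrightarrow> 0"
  proof (rule tendsto_sandwich[OF _ _ tendsto_const tendsto_add_zero[OF s(2) r(2)]])
    show "\<forall>\<^sub>F k in sequentially. 0 \<le> E.nrm (sec_diff E (?q k) (sec_diff E (fst v) (fst w)))"
      by (intro always_eventually allI E.nrm_nonneg E.L2_diff C_L2[OF q] L)
    show "\<forall>\<^sub>F k in sequentially. E.nrm (sec_diff E (?q k) (sec_diff E (fst v) (fst w)))
        \<le> E.nrm (sec_diff E (s k) (fst v)) + E.nrm (sec_diff E (r k) (fst w))"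
      by (intro always_eventually allI E.nrm_dif_dif_le C_L2 s(1) r(1) L)
  qed
  moreover have "(\<lambda>k. F.nrm (sec_diff F (A (?q k)) (sec_diff F (snd v) (snd w)))) \<longlonglongrightarrow> 0"
  proof (rule tendsto_sandwich[OF _ _ tendsto_const tendsto_add_zero[OF s(3) r(3)]])
    show "\<forall>\<^sub>F k in sequentially. 0 \<le> F.nrm (sec_diff F (A (?q k)) (sec_diff F (snd v) (snd w)))"
      by (intro always_eventually allI F.nrm_nonneg F.L2_diff AC_L2[OF q] L)
    have "F.nrm (sec_diff F (A (?q k)) (sec_diff F (snd v) (snd w)))
        = F.nrm (sec_diff F (sec_diff F (A (s k)) (A (r k))) (sec_diff F (snd v) (snd w)))" for k
    proof -
      have "sec_diff F (A (?q k)) (sec_diff F (snd v) (snd w)) x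
          = sec_diff F (sec_diff F (A (s k)) (A (r k))) (sec_diff F (snd v) (snd w)) x" if "x \<in> D" for x
        using A_diff[OF subsetD[OF C_smooth s(1)] subsetD[OF C_smooth r(1)] that]
        by (simp add: sec_diff_def[of F "A (?q k)"] sec_diff_def[of F "sec_diff F (A (s k)) (A (r k))"])
      then show ?thesis
        unfolding F.nrm_def F.ip_MD
        by (intro arg_cong[of _ _ sqrt] arg_cong[of _ _ Re] Bochner_Integration.integral_cong)
          (auto simp: E.space_MD)
    qed
    then show "\<forall>\<^sub>F k in sequentially. F.nrm (sec_diff F (A (?q k)) (sec_diff F (snd v) (snd w)))
        \<le> F.nrm (sec_diff F (A (s k)) (snd v)) + F.nrm (sec_diff F (A (r k)) (snd w))"
      using F.nrm_dif_dif_le[OF AC_L2[OF s(1)] AC_L2[OF r(1)] L(2,4)]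
      by (intro always_eventually allI) simp
  qed
  ultimately show ?thesis using q L E.L2_diff F.L2_diff unfolding DT_iff by (auto intro!: exI[of _ ?q])
qed

text \<open>
  A diagonal argument: the \<open>k\<close>-th member of the sequence is replaced by a smooth section at distance less
  than \<open>1 / (k + 1)\<close> from it.
\<close>

lemma DT_closed:
  assumes v: "\<And>k::nat. v k \<in> DT" and a: "a \<in> L2 dx D E" and b: "b \<in> L2 dx D F"
    and lim: "(\<lambda>k. E.nrm (sec_diff E (fst (v k)) a)) \<longlonglongrightarrow> 0"
      "(\<lambda>k. F.nrm (sec_diff F (snd (v k)) b)) \<longlonglongrightarrow> 0"
  shows "(a, b) \<in> DT"
proof -
  have "\<exists>s. s \<in> C \<and> E.nrm (sec_diff E s (fst (v k))) < 1 / real (Suc k) \<and>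
      F.nrm (sec_diff F (A s) (snd (v k))) < 1 / real (Suc k)" for k
  proof -
    obtain s where s: "\<And>k. s k \<in> C" "(\<lambda>j::nat. E.nrm (sec_diff E (s j) (fst (v k)))) \<longlonglongrightarrow> 0"
      "(\<lambda>j. F.nrm (sec_diff F (A (s j)) (snd (v k)))) \<longlonglongrightarrow> 0" by (rule DT_approx[OF v], rule that)
    have "\<forall>\<^sub>F j in sequentially. E.nrm (sec_diff E (s j) (fst (v k))) < 1 / real (Suc k)"
      by (rule order_tendstoD(2)[OF s(2)]) simp
    moreover have "\<forall>\<^sub>F j in sequentially. F.nrm (sec_diff F (A (s j)) (snd (v k))) < 1 / real (Suc k)"
      by (rule order_tendstoD(2)[OF s(3)]) simp
    ultimately have "\<forall>\<^sub>F j in sequentially. E.nrm (sec_diff E (s j) (fst (v k))) < 1 / real (Suc k) \<and>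
        F.nrm (sec_diff F (A (s j)) (snd (v k))) < 1 / real (Suc k)" by (rule eventually_conj)
    then obtain j where "E.nrm (sec_diff E (s j) (fst (v k))) < 1 / real (Suc k) \<and>
        F.nrm (sec_diff F (A (s j)) (snd (v k))) < 1 / real (Suc k)"
      using eventually_happens by fastforce
    then show ?thesis using s(1) by blast
  qed
  then obtain s where s: "\<And>k. s k \<in> C" "\<And>k. E.nrm (sec_diff E (s k) (fst (v k))) < 1 / real (Suc k)"
      "\<And>k. F.nrm (sec_diff F (A (s k)) (snd (v k))) < 1 / real (Suc k)" by metis
  have t0: "(\<lambda>k. 1 / real (Suc k)) \<longlonglongrightarrow> 0"
    using LIMSEQ_inverse_real_of_nat by (simp add: inverse_eq_divide)
  have "(\<lambda>k. E.nrm (sec_diff E (s k) a)) \<longlonglongrightarrow> 0"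
  proof (rule tendsto_sandwich[OF _ _ tendsto_const tendsto_add_zero[OF t0 lim(1)]])
    show "\<forall>\<^sub>F k in sequentially. 0 \<le> E.nrm (sec_diff E (s k) a)"
      by (intro always_eventually allI E.nrm_nonneg E.L2_diff C_L2 s(1) a)
    have "E.nrm (sec_diff E (s k) a) \<le> 1 / real (Suc k) + E.nrm (sec_diff E (fst (v k)) a)" for k
      using E.nrm_triangle[OF C_L2[OF s(1)] DT_L2(1)[OF v] a, of k k] s(2)[of k] by linarith
    then show "\<forall>\<^sub>F k in sequentially. E.nrm (sec_diff E (s k) a) \<le> 1 / real (Suc k) + E.nrm (sec_diff E (fst (v k)) a)"
      by (intro always_eventually allI)
  qed
  moreover have "(\<lambda>k. F.nrm (sec_diff F (A (s k)) b)) \<longlonglongrightarrow> 0"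
  proof (rule tendsto_sandwich[OF _ _ tendsto_const tendsto_add_zero[OF t0 lim(2)]])
    show "\<forall>\<^sub>F k in sequentially. 0 \<le> F.nrm (sec_diff F (A (s k)) b)"
      by (intro always_eventually allI F.nrm_nonneg F.L2_diff AC_L2 s(1) b)
    have "F.nrm (sec_diff F (A (s k)) b) \<le> 1 / real (Suc k) + F.nrm (sec_diff F (snd (v k)) b)" for k
      using F.nrm_triangle[OF AC_L2[OF s(1)] DT_L2(2)[OF v] b, of k k] s(3)[of k] by linarith
    then show "\<forall>\<^sub>F k in sequentially. F.nrm (sec_diff F (A (s k)) b) \<le> 1 / real (Suc k) + F.nrm (sec_diff F (snd (v k)) b)"
      by (intro always_eventually allI)
  qed
  ultimately show ?thesis using s(1) a b unfolding DT_iff by auto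
qed

end

text \<open>
  The boundary operators are differential operators, hence additive on smooth sections.
\<close>

lemma smooth_T_diff:
  assumes mfd: "closed_manifold \<A>" and E: "vbundle_over \<A> X E" and ds: "dirichlet_system \<A> X D E m N mo Fj B"
    and \<Gamma>: "\<Gamma> \<subseteq> frontier D"
    and u: "u \<in> smooth_T \<A> X D E m Fj B \<Gamma>" and v: "v \<in> smooth_T \<A> X D E m Fj B \<Gamma>"
  shows "sec_diff E u v \<in> smooth_T \<A> X D E m Fj B \<Gamma>"
proof -
  interpret E: vbundle_over \<A> X E by fact
  obtain W1 where W1: "open W1" "closure D \<subseteq> W1" "W1 \<subseteq> X" "smooth_section \<A> E W1 u"
    using u by (auto simp: smooth_T_def smooth_closure_sections_def)
  obtain W2 where W2: "open W2" "closure D \<subseteq> W2" "W2 \<subseteq> X" "smooth_section \<A> E W2 v"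
    using v by (auto simp: smooth_T_def smooth_closure_sections_def)
  let ?W = "W1 \<inter> W2"
  have uW: "smooth_section \<A> E ?W u" "smooth_section \<A> E ?W v"
    using W1(4) W2(4) by (auto intro: E.smooth_section_subset)
  have "smooth_section \<A> E ?W (sec_diff E u v)"
    by (rule E.smooth_section_diff[OF uW]) (use W1 W2 in auto)
  then have "sec_diff E u v \<in> smooth_closure_sections \<A> X D E"
    unfolding smooth_closure_sections_def using W1 W2 by (auto intro!: exI[of _ ?W])
  moreover have "B j (sec_diff E u v) x = fib_zero (Fj j) x" if j: "j < m" and x: "x \<in> \<Gamma>" for j x
  proof -
    have N: "open N" "N \<subseteq> X" "x \<in> N" and vb: "vector_bundle \<A> N (Fj j)" and op: "diff_operator \<A> N (mo j) E (Fj j) (B j)"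
      using ds j x \<Gamma> interior_subset[of X] unfolding dirichlet_system_def by auto
    interpret G: vbundle_over \<A> N "Fj j" by unfold_locales (rule mfd, rule vb)
    have xW: "x \<in> ?W \<inter> N" using x \<Gamma> W1(2) W2(2) N(3) by (auto simp: frontier_def)
    have "B j (sec_diff E u v) x = sec_diff (Fj j) (B j u) (B j v) x"
      by (rule diff_operator_diff[OF E G.vbundle_over_axioms N(2) op _ _ _ _ xW])
        (use W1 W2 N uW in \<open>auto intro: E.smooth_section_subset\<close>)
    also have "\<dots> = fib_zero (Fj j) x"
    proof -
      have z: "B j u x = fib_zero (Fj j) x" "B j v x = fib_zero (Fj j) x"
        using u v j x by (auto simp: smooth_T_def)
      obtain V \<tau> where t: "(V, \<tau>) \<in> trv (Fj j)" "x \<in> V" using G.triv_cover[OF N(3)] by blast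
      note f = G.fib_zero_in[OF t]
      have fz: "B j u x \<in> fib (Fj j) x" "B j v x \<in> fib (Fj j) x" using f z by simp_all
      show ?thesis
        by (rule G.triv_eq_zero[OF t G.sec_diff_fib[of V \<tau> x "B j u" "B j v", OF t fz]])
          (simp add: G.sec_diff_comp[of V \<tau> x "B j u" "B j v", OF t fz] z)
    qed
    finally show ?thesis .
  qed
  ultimately show ?thesis by (simp add: smooth_T_def)
qed

section \<open>Weak solutions\<close>

lemma sum_swap_pairs:
  fixes t :: "'a \<Rightarrow> 'b \<Rightarrow> 'c \<Rightarrow> 'd \<Rightarrow> 'r::comm_monoid_add"
  shows "(\<Sum>i\<in>I. \<Sum>k\<in>K. \<Sum>\<alpha>\<in>S. \<Sum>j\<in>J. t i k \<alpha> j) = (\<Sum>\<alpha>\<in>S. \<Sum>j\<in>J. \<Sum>i\<in>I. \<Sum>k\<in>K. t i k \<alpha> j)"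
  using sum.swap[of "\<lambda>x y. t (fst x) (snd x) (fst y) (snd y)" "S \<times> J" "I \<times> K"]
  by (simp add: sum.cartesian_product')

lemma set_integral_sum_sum:
  fixes h :: "'i \<Rightarrow> 'j \<Rightarrow> 'a \<Rightarrow> complex"
  assumes "\<And>i j. i \<in> I \<Longrightarrow> j \<in> J \<Longrightarrow> set_integrable M S (h i j)"
  shows "(LINT x:S|M. \<Sum>i\<in>I. \<Sum>j\<in>J. h i j x) = (\<Sum>i\<in>I. \<Sum>j\<in>J. LINT x:S|M. h i j x)"
proof -
  have int: "integrable M (\<lambda>x. indicator S x *\<^sub>R h i j x)" if "i \<in> I" "j \<in> J" for i j
    using assms[OF that] by (simp add: set_integrable_def)
  have "(LINT x:S|M. \<Sum>i\<in>I. \<Sum>j\<in>J. h i j x) = (LINT x|M. (\<Sum>i\<in>I. \<Sum>j\<in>J. indicator S x *\<^sub>R h i j x))"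
    by (simp only: set_lebesgue_integral_def scaleR_sum_right)
  also have "\<dots> = (\<Sum>i\<in>I. LINT x|M. (\<Sum>j\<in>J. indicator S x *\<^sub>R h i j x))"
    by (intro Bochner_Integration.integral_sum Bochner_Integration.integrable_sum int)
  also have "\<dots> = (\<Sum>i\<in>I. \<Sum>j\<in>J. LINT x:S|M. h i j x)"
    unfolding set_lebesgue_integral_def
    by (intro sum.cong refl Bochner_Integration.integral_sum int)
  finally show ?thesis .
qed

locale cauchy_volume_setting = cauchy_setting \<A> X E F dx D m A C
  for \<A> :: "('m::{t2_space, second_countable_topology}, 'n::finite) chart set" and X :: "'m set"
    and E :: "('m, 'e) hbundle" and F :: "('m, 'f) hbundle" and dx :: "'m measure" and D :: "'m set"
    and m :: nat and A :: "('m \<Rightarrow> 'e) \<Rightarrow> ('m \<Rightarrow> 'f)" and C :: "('m \<Rightarrow> 'e) set" +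
  fixes \<omega> :: "('m, 'n) chart \<Rightarrow> 'm \<Rightarrow> real"
  assumes vf: "volume_form \<A> X \<omega>" and vm: "volume_measure \<A> X \<omega> dx"
begin

lemma density_smooth:
  assumes c: "(U, \<phi>) \<in> \<A>" and W: "open W" "W \<subseteq> U \<inter> D"
  shows "smooth_on_open \<A> W (\<lambda>x. complex_of_real \<bar>\<omega> (U, \<phi>) x\<bar>)"
    and "\<And>x. x \<in> W \<Longrightarrow> complex_of_real \<bar>\<omega> (U, \<phi>) x\<bar> \<noteq> 0"
    and "continuous_on W (\<omega> (U, \<phi>))"
proof -
  have "smooth_on \<A> (U \<inter> X) (\<omega> (U, \<phi>)) \<and> (\<forall>x\<in>U \<inter> X. \<omega> (U, \<phi>) x \<noteq> 0)"
    using vf c unfolding volume_form_def by (metis fst_conv)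
  then have sm: "smooth_on \<A> (U \<inter> X) (\<omega> (U, \<phi>))" and nz: "x \<in> W \<Longrightarrow> \<omega> (U, \<phi>) x \<noteq> 0" for x
    using W(2) E.D_subset_X by auto
  have o: "smooth_on_open \<A> W (\<omega> (U, \<phi>))"
    by (rule smooth_on_imp_open[OF E.mfd sm W(1)]) (use W(2) E.D_subset_X in auto)
  show "smooth_on_open \<A> W (\<lambda>x. complex_of_real \<bar>\<omega> (U, \<phi>) x\<bar>)"
    by (rule smooth_on_open_of_real[OF E.mfd smooth_on_open_abs[OF E.mfd o nz]])
  show "complex_of_real \<bar>\<omega> (U, \<phi>) x\<bar> \<noteq> 0" if "x \<in> W" for x using nz[OF that] by simp
  show "continuous_on W (\<omega> (U, \<phi>))" by (rule smooth_on_open_continuous[OF E.mfd o])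
qed

lemma integral_in_chart:
  fixes h :: "'m \<Rightarrow> complex"
  assumes c: "(U, \<phi>) \<in> \<A>" and W: "open W" "W \<subseteq> U \<inter> D"
    and h: "continuous_on W h" "\<And>x. x \<in> D - W \<Longrightarrow> h x = 0"
  shows "(LINT x:D|dx. h x)
    = (LINT z:\<phi> ` W|lborel. complex_of_real \<bar>\<omega> (U, \<phi>) (inv_into U \<phi> z)\<bar> * h (inv_into U \<phi> z))"
proof -
  have "(LINT x:D|dx. h x) = (LINT x:W|dx. h x)"
    unfolding set_lebesgue_integral_def
    by (rule Bochner_Integration.integral_cong) (use W(2) h(2) in \<open>auto simp: indicator_def\<close>)
  also have "\<dots> = (LINT z:\<phi> ` W|lborel. complex_of_real \<bar>\<omega> (U, \<phi>) (inv_into U \<phi> z)\<bar> * h (inv_into U \<phi> z))"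
    by (rule chart_integral[OF E.mfd vm c W(1) _ density_smooth(3)[OF c W] h(1)])
      (use W(2) E.D_subset_X in auto)
  finally show ?thesis .
qed

text \<open>
  In a chart, the pairing with \<open>A \<phi>\<close> is a sum of integrals of derivatives of the coordinates of \<open>\<phi>\<close>
  against smooth functions of compact support. Integration by parts moves all derivatives to the
  latter, and the inverse Gram matrix turns the resulting density into a section \<open>w\<close>.
\<close>

lemma local_formal_adjoint:
  assumes c: "(U, \<phi>) \<in> \<A>" and s: "(V, \<tau>) \<in> trv E" and t: "(V', \<sigma>) \<in> trv F"
    and g: "smooth_section \<A> F D g" and K: "compact K" "K \<subseteq> U \<inter> V \<inter> V' \<inter> D"
    and gK: "\<And>x. x \<in> D - K \<Longrightarrow> g x = fib_zero F x"
  obtains w where "adjoint_at \<A> X dx D E F A g w"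
proof -
  define W where "W = U \<inter> (V \<inter> D) \<inter> (V' \<inter> D)"
  have W: "open W" "W \<subseteq> U \<inter> D" "W \<subseteq> U"
    using chart_open[OF E.mfd c] E.triv_D_open[OF s] F.triv_D_open[OF t] by (auto simp: W_def)
  have WV: "W \<subseteq> V" "W \<subseteq> V'" "W \<subseteq> D" "K \<subseteq> W" using K(2) by (auto simp: W_def)
  let ?i = "inv_into U \<phi>" and ?S = "\<phi> ` W" and ?L = "\<phi> ` K"
  have inj: "inj_on \<phi> U" by (rule chart_inj[OF E.mfd c])
  have S: "open ?S" by (rule chart_open_image[OF E.mfd c W(1,3)])
  have L: "compact ?L" "?L \<subseteq> ?S"
    using compact_continuous_image[OF continuous_on_subset[OF chart_continuous[OF E.mfd c]] K(1)] K(2) WV(4) by auto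
  have i\<phi>: "?i (\<phi> x) = x" if "x \<in> W" for x using that inj W(3) by auto
  have iS: "?i z \<in> W" if "z \<in> ?S" for z using that i\<phi> by auto
  have iSL: "?i z \<in> W - K" if "z \<in> ?S - ?L" for z using that i\<phi> by auto
  define \<rho> where "\<rho> x = complex_of_real \<bar>\<omega> (U, \<phi>) x\<bar>" for x
  have \<rho>: "smooth_on_open \<A> W \<rho>" "\<And>x. x \<in> W \<Longrightarrow> \<rho> x \<noteq> 0"
    unfolding \<rho>_def using density_smooth[OF c W(1,2)] by auto
  obtain a where a: "\<And>\<alpha> i j. mdeg \<alpha> \<le> m \<Longrightarrow> i < rnk F \<Longrightarrow> j < rnk E \<Longrightarrow>
      smooth_on \<A> (U \<inter> V \<inter> V' \<inter> X) (\<lambda>x. a \<alpha> x $$ (i, j))"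
    "\<And>O' u y i. open O' \<Longrightarrow> O' \<subseteq> X \<Longrightarrow> smooth_section \<A> E O' u \<Longrightarrow> y \<in> O' \<inter> U \<inter> V \<inter> V' \<Longrightarrow> i < rnk F \<Longrightarrow>
      \<sigma> y (A u y) $ i = (\<Sum>\<alpha> | mdeg \<alpha> \<le> m. \<Sum>j<rnk E. a \<alpha> y $$ (i, j) *
        mderiv \<alpha> ((\<lambda>x. \<tau> x (u x) $ j) \<circ> ?i) (\<phi> y))"
    by (rule diff_operator_expansion[OF E.vbundle_over_axioms order_refl A c s t]) (rule that)
  have gW: "smooth_section \<A> F W g" by (rule F.smooth_section_subset[OF g WV(3)])
  have sec_comp: "smooth_on_open \<A> W (\<lambda>x. \<sigma> x (g x) $ i)" if "i < rnk F" for i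
    by (rule smooth_on_open_subset[OF E.mfd F.smooth_section_comp[OF g E.D_open E.D_subset_X t that] W(1)])
      (use WV in auto)
  \<comment> \<open>The coefficient of \<open>\<partial>\<^sup>\<alpha> u\<^sub>j\<close> when the pairing with \<open>g\<close> is written in coordinates.\<close>
  define b where "b \<alpha> j x = \<rho> x * (\<Sum>i<rnk F. (\<Sum>k<rnk F. F.gram (V', \<sigma>) x $$ (i, k) * a \<alpha> x $$ (k, j)) *
      cnj (\<sigma> x (g x) $ i))" for \<alpha> :: "'n \<Rightarrow> nat" and j x
  have b: "smooth_on_open \<A> W (b \<alpha> j)" if \<alpha>: "mdeg \<alpha> \<le> m" and j: "j < rnk E" for \<alpha> j
    unfolding b_def
  proof (intro smooth_on_open_mult[OF E.mfd] \<rho>(1) smooth_on_open_sum[OF E.mfd W(1)] smooth_on_open_cnj[OF E.mfd] sec_comp)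
    fix i k assume "i \<in> {..<rnk F}" "k \<in> {..<rnk F}"
    then show "smooth_on_open \<A> W (\<lambda>x. F.gram (V', \<sigma>) x $$ (i, k))"
      "smooth_on_open \<A> W (\<lambda>x. a \<alpha> x $$ (k, j))"
      using WV W(3) E.D_subset_X
      by (auto intro!: smooth_on_imp_open[OF E.mfd F.gram_smooth[OF t] W(1)] smooth_on_imp_open[OF E.mfd a(1)[OF \<alpha> _ j] W(1)])
  qed simp
  have b0: "b \<alpha> j x = 0" if x: "x \<in> W - K" for \<alpha> j x
  proof -
    have "g x = fib_zero F x" "x \<in> V'" using gK[of x] x WV by auto
    then show ?thesis using F.triv_fib_zero[OF t, of x] by (simp add: b_def)
  qed
  define transposes where "transposes \<alpha> j q \<longleftrightarrow> Cinf_on ?S q \<and> (\<forall>z\<in>?S - ?L. q z = 0) \<and>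
      (\<forall>h. Cinf_on ?S h \<longrightarrow> (LINT z:?S|lborel. mderiv \<alpha> h z * (b \<alpha> j \<circ> ?i) z) = (LINT z:?S|lborel. h z * q z))"
    for \<alpha> j q
  have "\<exists>q. transposes \<alpha> j q" if \<alpha>: "mdeg \<alpha> \<le> m" and j: "j < rnk E" for \<alpha> j
  proof -
    have bc: "Cinf_on ?S (b \<alpha> j \<circ> ?i)" by (rule smooth_on_open_chart[OF b[OF \<alpha> j] c]) (use W in auto)
    have bz: "(b \<alpha> j \<circ> ?i) z = 0" if "z \<in> ?S - ?L" for z using b0 iSL[OF that] by simp
    show ?thesis
    proof (rule mderiv_transpose[OF S L bc bz, where \<alpha> = \<alpha>])
      fix q assume "Cinf_on ?S q" "\<And>z. z \<in> ?S - ?L \<Longrightarrow> q z = 0" "\<And>h. Cinf_on ?S h \<Longrightarrow>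
        (LINT z:?S|lborel. mderiv \<alpha> h z * (b \<alpha> j \<circ> ?i) z) = (LINT z:?S|lborel. h z * q z)"
      then have "transposes \<alpha> j q" unfolding transposes_def by (intro conjI ballI allI impI)
      then show ?thesis by (intro exI[of _ q])
    qed
  qed
  then have "\<forall>\<alpha> j. \<exists>q. mdeg \<alpha> \<le> m \<longrightarrow> j < rnk E \<longrightarrow> transposes \<alpha> j q" by blast
  then obtain q where "\<forall>\<alpha> j. mdeg \<alpha> \<le> m \<longrightarrow> j < rnk E \<longrightarrow> transposes \<alpha> j (q \<alpha> j)" by metis
  then have q: "\<And>\<alpha> j. mdeg \<alpha> \<le> m \<Longrightarrow> j < rnk E \<Longrightarrow> Cinf_on ?S (q \<alpha> j)"
    "\<And>\<alpha> j z. mdeg \<alpha> \<le> m \<Longrightarrow> j < rnk E \<Longrightarrow> z \<in> ?S - ?L \<Longrightarrow> q \<alpha> j z = 0"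
    "\<And>\<alpha> j h. mdeg \<alpha> \<le> m \<Longrightarrow> j < rnk E \<Longrightarrow> Cinf_on ?S h \<Longrightarrow>
      (LINT z:?S|lborel. mderiv \<alpha> h z * (b \<alpha> j \<circ> ?i) z) = (LINT z:?S|lborel. h z * q \<alpha> j z)"
    unfolding transposes_def by simp_all
  define p where "p j x = (\<Sum>\<alpha> | mdeg \<alpha> \<le> m. q \<alpha> j (\<phi> x))" for j x
  have p: "smooth_on_open \<A> W (p j)" if "j < rnk E" for j
    unfolding p_def by (intro smooth_on_open_sum[OF E.mfd W(1)] smooth_on_open_in_chart[OF E.mfd c W(1,3)] q that) simp
  have p0: "p j x = 0" if "j < rnk E" "x \<in> W - K" for j x
  proof -
    have "\<phi> x \<in> ?S - ?L" using that(2) inj_on_image_mem_iff[OF inj, of x K] W(3) K(2) by auto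
    then show ?thesis unfolding p_def by (intro sum.neutral ballI q(2)) (use that in auto)
  qed
  \<comment> \<open>The inverse Gram matrix and the conjugation cancel those in the metric, and \<open>1/\<rho>\<close> cancels the volume density.\<close>
  define cw where "cw x = vec (rnk E) (\<lambda>l. cnj ((\<Sum>j<rnk E. E.gram_inv (V, \<tau>) x j l * p j x) * inverse (\<rho> x)))" for x
  define w where "w x = (if x \<in> W then inv_into (fib E x) (\<tau> x) (cw x) else fib_zero E x)" for x
  have w_in: "w x \<in> fib E x \<and> \<tau> x (w x) = cw x" if "x \<in> W" for x
  proof -
    have "cw x \<in> \<tau> x ` fib E x"
      using E.triv_bij[OF s, of x] that WV(1) by (auto simp: bij_betw_def cw_def)
    then show ?thesis using that by (simp add: w_def inv_into_into f_inv_into_f)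
  qed
  have wf: "w x \<in> fib E x" if x: "x \<in> D" for x
  proof (cases "x \<in> W")
    case False
    obtain V0 \<tau>0 where "(V0, \<tau>0) \<in> trv E" "x \<in> V0" using E.triv_cover[OF E.D_X[OF x]] by blast
    then show ?thesis using False E.fib_zero_in by (simp add: w_def)
  qed (use w_in in blast)
  have w0: "w x = fib_zero E x" if x: "x \<in> D - K" for x
  proof (cases "x \<in> W")
    case True
    show ?thesis
      by (rule E.triv_eq_zero[OF s _ wf]) (use True x WV w_in[OF True] p0 in \<open>auto simp: cw_def\<close>)
  qed (simp add: w_def)
  have wsm: "smooth_section \<A> E D w"
  proof (rule E.smooth_section_local[OF E.D_open E.D_subset_X wf])
    fix x assume x: "x \<in> D"
    show "\<exists>V \<tau> O'. (V, \<tau>) \<in> trv E \<and> x \<in> O' \<and> O' \<subseteq> V \<inter> D \<and> (\<forall>i<rnk E. smooth_on_open \<A> O' (\<lambda>x. \<tau> x (w x) $ i))"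
    proof (cases "x \<in> W")
      case True
      have "smooth_on_open \<A> W (\<lambda>x. \<tau> x (w x) $ l)" if l: "l < rnk E" for l
      proof (rule smooth_on_open_cong[OF E.mfd])
        show "smooth_on_open \<A> W (\<lambda>x. cnj ((\<Sum>j<rnk E. E.gram_inv (V, \<tau>) x j l * p j x) * inverse (\<rho> x)))"
          by (intro smooth_on_open_cnj[OF E.mfd] smooth_on_open_mult[OF E.mfd] smooth_on_open_sum[OF E.mfd W(1)]
              E.gram_inv_smooth[OF s W(1) WV(1)] smooth_on_open_inverse[OF E.mfd] \<rho> p l) auto
      qed (use w_in l in \<open>auto simp: cw_def\<close>)
      then show ?thesis using s True WV by (intro exI[of _ V] exI[of _ \<tau>] exI[of _ W]) auto
    next
      case False
      obtain V0 \<tau>0 where t0: "(V0, \<tau>0) \<in> trv E" "x \<in> V0" using E.triv_cover[OF E.D_X[OF x]] by blast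
      let ?O = "(V0 \<inter> D) - K"
      have o: "open ?O" using E.triv_D_open[OF t0(1)] compact_imp_closed[OF K(1)] by auto
      have "smooth_on_open \<A> ?O (\<lambda>x. \<tau>0 x (w x) $ i)" if "i < rnk E" for i
        by (rule smooth_on_open_cong[OF E.mfd smooth_on_open_const[OF E.mfd o, of 0]])
          (use w0 E.triv_fib_zero[OF t0(1)] that in auto)
      then show ?thesis using t0 x False WV by (intro exI[of _ V0] exI[of _ \<tau>0] exI[of _ ?O]) auto
    qed
  qed
  have wW: "smooth_section \<A> E W w" by (rule E.smooth_section_subset[OF wsm WV(3)])
  have wt: "w \<in> test_sections \<A> D E"
    unfolding test_sections_def using wsm K w0 by auto
  have "ip dx D F (A u) g = ip dx D E u w" if u: "u \<in> smooth_closure_sections \<A> X D E" for u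
  proof -
    obtain W1 where W1: "open W1" "closure D \<subseteq> W1" "W1 \<subseteq> X" "smooth_section \<A> E W1 u"
      using u by (auto simp: smooth_closure_sections_def)
    have WW1: "W \<subseteq> W1" using WV(3) W1(2) closure_subset by blast
    have uD: "smooth_section \<A> E D u"
      by (rule E.smooth_section_subset[OF W1(4)]) (use W1(2) closure_subset in auto)
    have uW: "smooth_section \<A> E W u" by (rule E.smooth_section_subset[OF W1(4) WW1])
    have AW: "smooth_section \<A> F W (A u)"
      by (rule diff_operator_smooth[OF E.vbundle_over_axioms F.vbundle_over_axioms A W(1) _ uW])
        (use WV E.D_subset_X in auto)
    have AD: "smooth_section \<A> F D (A u)"
      by (rule diff_operator_smooth[OF E.vbundle_over_axioms F.vbundle_over_axioms A E.D_open E.D_subset_X uD])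
    have WX: "W \<subseteq> X" using WV(3) E.D_subset_X by auto
    define h where "h j = (\<lambda>x. \<tau> x (u x) $ j) \<circ> ?i" for j
    have h: "Cinf_on ?S (h j)" if "j < rnk E" for j
      unfolding h_def by (rule smooth_on_open_chart[OF E.smooth_section_comp[OF uD E.D_open E.D_subset_X s that] c])
        (use W WV in auto)
    have int1: "set_integrable lborel ?S (\<lambda>z. mderiv \<alpha> (h j) z * (b \<alpha> j \<circ> ?i) z)"
      if "mdeg \<alpha> \<le> m" "j < rnk E" for \<alpha> j
    proof (rule set_integrable_compact_support[OF S L])
      have "Cinf_on ?S (b \<alpha> j \<circ> ?i)" by (rule smooth_on_open_chart[OF b[OF that] c]) (use W in auto)
      then show "continuous_on ?S (\<lambda>z. mderiv \<alpha> (h j) z * (b \<alpha> j \<circ> ?i) z)"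
        by (intro continuous_on_mult Cinf_on_continuous Cinf_on_mderiv h that)
    qed (use b0 iSL in auto)
    have int2: "set_integrable lborel ?S (\<lambda>z. h j z * q \<alpha> j z)"
      if "mdeg \<alpha> \<le> m" "j < rnk E" for \<alpha> j
    proof (rule set_integrable_compact_support[OF S L])
      show "continuous_on ?S (\<lambda>z. h j z * q \<alpha> j z)"
        by (rule continuous_on_mult[OF h[OF that(2), THEN Cinf_on_continuous] q(1)[OF that, THEN Cinf_on_continuous]])
    qed (use q(2)[OF that] in auto)
    have "ip dx D F (A u) g = (LINT z:?S|lborel. \<rho> (?i z) * met F (?i z) (A u (?i z)) (g (?i z)))"
      unfolding ip_def \<rho>_def
    proof (rule integral_in_chart[OF c W(1,2)])
      show "continuous_on W (\<lambda>x. met F x (A u x) (g x))"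
        by (rule F.met_continuous[OF AW gW W(1) WX])
      fix x assume x: "x \<in> D - W"
      then have "g x = fib_zero F x" using gK[of x] WV(4) by auto
      then show "met F x (A u x) (g x) = 0"
        using F.met_zero_right[OF E.D_X, of x "A u x"] x F.smooth_section_fib[OF AD] by auto
    qed
    also have "\<dots> = (LINT z:?S|lborel. \<Sum>\<alpha> | mdeg \<alpha> \<le> m. \<Sum>j<rnk E. mderiv \<alpha> (h j) z * (b \<alpha> j \<circ> ?i) z)"
      unfolding set_lebesgue_integral_def
    proof (rule Bochner_Integration.integral_cong[OF refl])
      fix z
      show "indicator ?S z *\<^sub>R (\<rho> (?i z) * met F (?i z) (A u (?i z)) (g (?i z)))
        = indicator ?S z *\<^sub>R (\<Sum>\<alpha> | mdeg \<alpha> \<le> m. \<Sum>j<rnk E. mderiv \<alpha> (h j) z * (b \<alpha> j \<circ> ?i) z)"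
      proof (cases "z \<in> ?S")
        case True
        then obtain x where x: "x \<in> W" "z = \<phi> x" by blast
        have "met F x (A u x) (g x) = (\<Sum>i<rnk F. (\<Sum>k<rnk F. F.gram (V', \<sigma>) x $$ (i, k) * \<sigma> x (A u x) $ k) * cnj (\<sigma> x (g x) $ i))"
          by (rule F.met_expand[OF t]) (use x WV F.smooth_section_fib[OF AD] F.smooth_section_fib[OF g] in auto)
        also have "\<dots> = (\<Sum>i<rnk F. (\<Sum>k<rnk F. F.gram (V', \<sigma>) x $$ (i, k) *
            (\<Sum>\<alpha> | mdeg \<alpha> \<le> m. \<Sum>j<rnk E. a \<alpha> x $$ (k, j) * mderiv \<alpha> (h j) (\<phi> x))) * cnj (\<sigma> x (g x) $ i))"
          using a(2)[OF W1(1,3,4), of x] x(1) WV W(3) WW1 by (simp add: h_def subset_iff)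
        finally have M: "met F x (A u x) (g x) = (\<Sum>i<rnk F. (\<Sum>k<rnk F. F.gram (V', \<sigma>) x $$ (i, k) *
            (\<Sum>\<alpha> | mdeg \<alpha> \<le> m. \<Sum>j<rnk E. a \<alpha> x $$ (k, j) * mderiv \<alpha> (h j) (\<phi> x))) * cnj (\<sigma> x (g x) $ i))" .
        have "\<rho> x * met F x (A u x) (g x) = (\<Sum>\<alpha> | mdeg \<alpha> \<le> m. \<Sum>j<rnk E. mderiv \<alpha> (h j) (\<phi> x) * b \<alpha> j x)"
        proof -
          let ?t = "\<lambda>i k \<alpha> j. \<rho> x * (F.gram (V', \<sigma>) x $$ (i, k) * (a \<alpha> x $$ (k, j) * (mderiv \<alpha> (h j) (\<phi> x) * cnj (\<sigma> x (g x) $ i))))"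
          have "\<rho> x * (\<Sum>i<rnk F. (\<Sum>k<rnk F. F.gram (V', \<sigma>) x $$ (i, k) *
            (\<Sum>\<alpha> | mdeg \<alpha> \<le> m. \<Sum>j<rnk E. a \<alpha> x $$ (k, j) * mderiv \<alpha> (h j) (\<phi> x))) * cnj (\<sigma> x (g x) $ i))
            = (\<Sum>i<rnk F. \<Sum>k<rnk F. \<Sum>\<alpha> | mdeg \<alpha> \<le> m. \<Sum>j<rnk E. ?t i k \<alpha> j)"
            by (simp add: sum_distrib_left sum_distrib_right mult.assoc)
          also have "\<dots> = (\<Sum>\<alpha> | mdeg \<alpha> \<le> m. \<Sum>j<rnk E. \<Sum>i<rnk F. \<Sum>k<rnk F. ?t i k \<alpha> j)"
            by (rule sum_swap_pairs)
          also have "\<dots> = (\<Sum>\<alpha> | mdeg \<alpha> \<le> m. \<Sum>j<rnk E. mderiv \<alpha> (h j) (\<phi> x) * b \<alpha> j x)"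
            by (simp add: b_def sum_distrib_left sum_distrib_right mult_ac)
          finally show ?thesis by (simp only: M)
        qed
        then show ?thesis using x i\<phi>[OF x(1)] True by simp
      qed simp
    qed
    also have "\<dots> = (\<Sum>\<alpha> | mdeg \<alpha> \<le> m. \<Sum>j<rnk E. LINT z:?S|lborel. mderiv \<alpha> (h j) z * (b \<alpha> j \<circ> ?i) z)"
      by (rule set_integral_sum_sum) (use int1 in auto)
    also have "\<dots> = (\<Sum>\<alpha> | mdeg \<alpha> \<le> m. \<Sum>j<rnk E. LINT z:?S|lborel. h j z * q \<alpha> j z)"
      using q(3) h by (intro sum.cong refl) auto
    also have "\<dots> = (LINT z:?S|lborel. \<Sum>\<alpha> | mdeg \<alpha> \<le> m. \<Sum>j<rnk E. h j z * q \<alpha> j z)"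
      by (rule set_integral_sum_sum[symmetric]) (use int2 in auto)
    also have "\<dots> = (LINT z:?S|lborel. \<rho> (?i z) * met E (?i z) (u (?i z)) (w (?i z)))"
      unfolding set_lebesgue_integral_def
    proof (rule Bochner_Integration.integral_cong[OF refl])
      fix z
      show "indicator ?S z *\<^sub>R (\<Sum>\<alpha> | mdeg \<alpha> \<le> m. \<Sum>j<rnk E. h j z * q \<alpha> j z)
        = indicator ?S z *\<^sub>R (\<rho> (?i z) * met E (?i z) (u (?i z)) (w (?i z)))"
      proof (cases "z \<in> ?S")
        case True
        then obtain x where x: "x \<in> W" "z = \<phi> x" by blast
        let ?G = "E.gram (V, \<tau>) x" and ?R = "E.gram_inv (V, \<tau>) x" and ?u = "\<lambda>j. \<tau> x (u x) $ j"
        have distrib: "(\<Sum>l<rnk E. c l * ((\<Sum>j<rnk E. ?R j l * p j x) * r))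
            = r * (\<Sum>l<rnk E. \<Sum>j<rnk E. p j x * (?R j l * c l))" for c r
          by (simp add: sum_distrib_left sum_distrib_right mult_ac)
        have "met E x (u x) (w x) = (\<Sum>l<rnk E. (\<Sum>k<rnk E. ?G $$ (l, k) * ?u k) * cnj (\<tau> x (w x) $ l))"
          by (rule E.met_expand[OF s]) (use x WV E.smooth_section_fib[OF uD] wf in auto)
        also have "\<dots> = (\<Sum>l<rnk E. (\<Sum>k<rnk E. ?G $$ (l, k) * ?u k) * ((\<Sum>j<rnk E. ?R j l * p j x) * inverse (\<rho> x)))"
          using w_in[OF x(1)] by (simp add: cw_def)
        also have "\<dots> = inverse (\<rho> x) * (\<Sum>l<rnk E. \<Sum>j<rnk E. p j x * (?R j l * (\<Sum>k<rnk E. ?G $$ (l, k) * ?u k)))"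
          by (rule distrib)
        also have "\<dots> = inverse (\<rho> x) * (\<Sum>j<rnk E. p j x * (\<Sum>l<rnk E. ?R j l * (\<Sum>k<rnk E. ?G $$ (l, k) * ?u k)))"
          by (subst sum.swap) (simp only: sum_distrib_left)
        also have "\<dots> = inverse (\<rho> x) * (\<Sum>j<rnk E. p j x * ?u j)"
          using E.gram_inv_solve[OF s, of x _ ?u] x(1) WV(1) by (simp add: subset_iff)
        finally have "\<rho> x * met E x (u x) (w x) = (\<Sum>j<rnk E. p j x * ?u j)"
          using \<rho>(2)[OF x(1)] by simp
        also have "\<dots> = (\<Sum>\<alpha> | mdeg \<alpha> \<le> m. \<Sum>j<rnk E. h j (\<phi> x) * q \<alpha> j (\<phi> x))"
          using i\<phi>[OF x(1)] by (subst sum.swap) (simp add: p_def h_def sum_distrib_left sum_distrib_right mult.commute)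
        finally show ?thesis using x i\<phi>[OF x(1)] True by simp
      qed simp
    qed
    also have "\<dots> = ip dx D E u w"
      unfolding ip_def \<rho>_def
    proof (rule integral_in_chart[OF c W(1,2), symmetric])
      show "continuous_on W (\<lambda>x. met E x (u x) (w x))"
        by (rule E.met_continuous[OF uW wW W(1) WX])
      fix x assume x: "x \<in> D - W"
      then have "w x = fib_zero E x" by (simp add: w_def)
      then show "met E x (u x) (w x) = 0"
        using E.met_zero_right[OF E.D_X, of x "u x"] x E.smooth_section_fib[OF uD] by auto
    qed
    finally show ?thesis .
  qed
  then have "adjoint_at \<A> X dx D E F A g w" using wt by (simp add: adjoint_at_def)
  then show ?thesis by (rule that)
qed

text \<open>
  Both sides are continuous for the graph norm and agree on smooth sections.
\<close>

lemma adjoint_on_DT: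
  assumes v: "v \<in> DT" and g: "g \<in> test_sections \<A> D F" and ad: "adjoint_at \<A> X dx D E F A g w"
  shows "ip dx D F (snd v) g = ip dx D E (fst v) w"
proof -
  obtain s where s: "\<And>k. s k \<in> C" "(\<lambda>k::nat. E.nrm (sec_diff E (s k) (fst v))) \<longlonglongrightarrow> 0"
    "(\<lambda>k. F.nrm (sec_diff F (A (s k)) (snd v))) \<longlonglongrightarrow> 0" by (rule DT_approx[OF v], rule that)
  have w: "w \<in> L2 dx D E" using ad E.test_sections_L2 by (auto simp: adjoint_at_def)
  have g2: "g \<in> L2 dx D F" using g F.test_sections_L2 by blast
  have "(\<lambda>k. ip dx D F (A (s k)) g) \<longlonglongrightarrow> ip dx D F (snd v) g"
    by (rule F.tendsto_inn[OF _ DT_L2(2)[OF v] s(3) g2]) (simp add: AC_L2 s(1))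
  moreover have "(\<lambda>k. ip dx D E (s k) w) \<longlonglongrightarrow> ip dx D E (fst v) w"
    by (rule E.tendsto_inn[OF _ DT_L2(1)[OF v] s(2) w]) (simp add: C_L2 s(1))
  moreover have "ip dx D F (A (s k)) g = ip dx D E (s k) w" for k
    using ad C_smooth s(1)[of k] by (auto simp: adjoint_at_def)
  ultimately show ?thesis using LIMSEQ_unique by simp
qed

lemma weak_solution_if_zero:
  assumes v: "v \<in> DT" and z: "F.nrm (snd v) = 0"
  shows "fst v \<in> weak_solutions \<A> X dx D E F A"
proof -
  note v1 = DT_L2(1)[OF v]
  have "ip dx D E (fst v) w = 0" if g: "g \<in> test_sections \<A> D F" and ad: "adjoint_at \<A> X dx D E F A g w" for g w
  proof -
    have "g \<in> L2 dx D F" using g F.test_sections_L2 by blast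
    then have "ip dx D F (snd v) g = 0" using F.inn_le[OF DT_L2(2)[OF v], of g] z by simp
    then show ?thesis using adjoint_on_DT[OF v g ad] by simp
  qed
  moreover have "set_integrable dx K (\<lambda>x. sqrt (Re (met E x (fst v x) (fst v x))))"
    if K: "compact K" "K \<subseteq> D" for K
  proof -
    have "set_integrable dx D (\<lambda>x. sqrt (E.sq (fst v) x))"
      unfolding E.set_integrable_MD
    proof (rule Bochner_Integration.integrable_bound)
      interpret finite_measure E.MD by (rule E.finite_MD)
      show "integrable E.MD (\<lambda>x. 1 + E.sq (fst v) x)" using E.L2_int[OF v1] by simp
      show "(\<lambda>x. sqrt (E.sq (fst v) x)) \<in> borel_measurable E.MD"
        using E.sq_measurable[OF E.L2_meas[OF v1]] by simp
      show "AE x in E.MD. norm (sqrt (E.sq (fst v) x)) \<le> norm (1 + E.sq (fst v) x)"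
      proof (rule AE_I2)
        fix x assume "x \<in> space E.MD"
        then have nn: "0 \<le> E.sq (fst v) x" using E.sq_nonneg[OF E.L2_meas[OF v1]] by (simp add: E.space_MD)
        have "sqrt (1 * E.sq (fst v) x) \<le> (1 * 1 + E.sq (fst v) x / 1) / 2"
          by (rule arith_mean_sqrt) (use nn in auto)
        then show "norm (sqrt (E.sq (fst v) x)) \<le> norm (1 + E.sq (fst v) x)" using nn by simp
      qed
    qed
    then show ?thesis
      by (rule set_integrable_subset) (use K compact_imp_closed in \<open>auto simp: E.dx_sets intro: borel_closed\<close>)
  qed
  ultimately show ?thesis using E.L2_meas[OF v1] by (auto simp: weak_solutions_def)
qed

text \<open>
  Conversely, let \<open>u\<close> be a weak solution, \<open>g = A u\<close> in the sense of \<open>\<D>\<^sub>T\<close>, and \<open>s\<^sub>k \<rightarrow> u\<close>, \<open>A s\<^sub>k \<rightarrow> g\<close>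
  with smooth \<open>s\<^sub>k\<close>. For a bump function \<open>\<chi>\<close> the sections \<open>\<chi> A s\<^sub>k\<close> are themselves test sections, so
  \<open>(g, \<chi> A s\<^sub>k) = 0\<close>, and in the limit \<open>(g, \<chi> g) = 0\<close>, so \<open>g\<close> vanishes where \<open>\<chi> > 0\<close>.
\<close>

lemma weak_solution_vanishes_near:
  assumes v: "v \<in> DT" and weak: "fst v \<in> weak_solutions \<A> X dx D E F A" and p: "p \<in> D"
  obtains T where "open T" "p \<in> T" "AE x in E.MD. x \<in> T \<longrightarrow> snd v x = fib_zero F x"
proof -
  obtain U \<phi> where c: "(U, \<phi>) \<in> \<A>" "p \<in> U" using chart_cover[OF E.mfd] by blast
  obtain V \<tau> where s: "(V, \<tau>) \<in> trv E" "p \<in> V" using E.triv_cover[OF E.D_X[OF p]] by blast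
  obtain V' \<sigma> where t: "(V', \<sigma>) \<in> trv F" "p \<in> V'" using F.triv_cover[OF E.D_X[OF p]] by blast
  let ?W = "U \<inter> (V \<inter> D) \<inter> (V' \<inter> D)"
  have W: "open ?W" "?W \<subseteq> U"
    using chart_open[OF E.mfd c(1)] E.triv_D_open[OF s(1)] F.triv_D_open[OF t(1)] by auto
  have S: "open (\<phi> ` ?W)" by (rule chart_open_image[OF E.mfd c(1) W])
  have inj: "inj_on \<phi> U" by (rule chart_inj[OF E.mfd c(1)])
  have pW: "p \<in> ?W" using p c s t by auto
  obtain \<chi>0 :: "real^'n \<Rightarrow> real" and L where \<chi>0: "Cinf_on UNIV \<chi>0" "compact L" "L \<subseteq> \<phi> ` ?W"
    "\<And>z. z \<notin> L \<Longrightarrow> \<chi>0 z = 0" "0 < \<chi>0 (\<phi> p)" "\<And>z. 0 \<le> \<chi>0 z" "\<And>z. \<chi>0 z \<le> 1"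
    by (rule smooth_bump[OF S, of "\<phi> p"]) (use pW in auto)
  define K where "K = inv_into U \<phi> ` L"
  have "continuous_on L (inv_into U \<phi>)"
    by (rule continuous_on_subset[OF chart_inv_continuous[OF E.mfd c(1)]]) (use \<chi>0(3) in auto)
  then have K: "compact K" unfolding K_def by (rule compact_continuous_image[OF _ \<chi>0(2)])
  have KW: "K \<subseteq> ?W"
  proof
    fix x assume "x \<in> K"
    then obtain y where "y \<in> ?W" "x = inv_into U \<phi> (\<phi> y)" using \<chi>0(3) unfolding K_def by blast
    then show "x \<in> ?W" using inj by auto
  qed
  define \<chi> where "\<chi> x = (if x \<in> ?W then \<chi>0 (\<phi> x) else 0)" for x
  have \<chi>K: "\<chi> x = 0" if "x \<notin> K" for x
  proof (cases "x \<in> ?W")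
    case True
    have "\<phi> x \<notin> L"
    proof
      assume "\<phi> x \<in> L"
      then have "inv_into U \<phi> (\<phi> x) \<in> K" by (simp add: K_def)
      then show False using that True inj by simp
    qed
    then show ?thesis by (simp add: \<chi>_def \<chi>0(4))
  qed (auto simp: \<chi>_def)
  have \<chi>01: "0 \<le> \<chi> x" "\<chi> x \<le> 1" for x using \<chi>0(6,7) by (auto simp: \<chi>_def)
  let ?h = "\<lambda>x. complex_of_real (\<chi> x)"
  have \<chi>W: "smooth_on_open \<A> ?W \<chi>"
    by (rule smooth_on_open_cong[OF E.mfd smooth_on_open_in_chart[OF E.mfd c(1) W Cinf_on_subset[OF \<chi>0(1)]]])
      (auto simp: \<chi>_def)
  have \<chi>_smooth: "smooth_on_open \<A> D \<chi>"
  proof (rule smooth_on_open_local[OF E.mfd _ E.D_open])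
    fix x assume x: "x \<in> D"
    have o: "open (- K)" using compact_imp_closed[OF K] by auto
    have "smooth_on_open \<A> (- K) \<chi>"
      by (rule smooth_on_open_cong[OF E.mfd smooth_on_open_const[OF E.mfd o, of 0]]) (simp add: \<chi>K)
    then show "\<exists>W. x \<in> W \<and> smooth_on_open \<A> W \<chi>" using \<chi>W KW by (cases "x \<in> K") blast+
  qed
  have h_smooth: "smooth_on_open \<A> D ?h" by (rule smooth_on_open_of_real[OF E.mfd \<chi>_smooth])
  have h_meas: "?h \<in> borel_measurable E.MD"
    unfolding E.MD_measurable
    by (rule borel_measurable_continuous_on_restrict[OF smooth_on_open_continuous[OF E.mfd h_smooth]])
  have h1: "cmod (?h x) \<le> 1" for x using \<chi>01[of x] by simp
  obtain r where r: "\<And>k. r k \<in> C" "(\<lambda>k::nat. E.nrm (sec_diff E (r k) (fst v))) \<longlonglongrightarrow> 0"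
    "(\<lambda>k. F.nrm (sec_diff F (A (r k)) (snd v))) \<longlonglongrightarrow> 0" by (rule DT_approx[OF v], rule that)
  note v2 = DT_L2(2)[OF v]
  let ?g = "snd v"
  have gs: "sec_scale F ?h ?g \<in> L2 dx D F" by (rule F.L2_scale[OF v2 h_meas h1])
  have zero: "ip dx D F (sec_scale F ?h ?g) (A (r k)) = 0" for k
  proof -
    let ?t = "sec_scale F ?h (A (r k))"
    have rk: "r k \<in> smooth_closure_sections \<A> X D E" using C_smooth r(1) by blast
    obtain W1 where "closure D \<subseteq> W1" "smooth_section \<A> F W1 (A (r k))"
      using A_smooth[OF rk] by (auto simp: smooth_closure_sections_def)
    then have Ar: "smooth_section \<A> F D (A (r k))"
      using closure_subset by (blast intro: F.smooth_section_subset)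
    have ts: "smooth_section \<A> F D ?t"
    proof (rule F.smooth_sectionI[OF E.D_open E.D_subset_X])
      show "?t x \<in> fib F x" if "x \<in> D" for x
        by (rule F.sec_in_fib(2)[of x "A (r k)" ?h, OF E.D_X[OF that] F.smooth_section_fib[OF Ar that]])
      fix V'' \<sigma>' i assume t': "(V'', \<sigma>') \<in> trv F" "i < rnk F"
      show "smooth_on_open \<A> (V'' \<inter> D) (\<lambda>x. \<sigma>' x (?t x) $ i)"
      proof (rule smooth_on_open_cong[OF E.mfd])
        show "smooth_on_open \<A> (V'' \<inter> D) (\<lambda>x. ?h x * \<sigma>' x (A (r k) x) $ i)"
          by (rule smooth_on_open_mult[OF E.mfd smooth_on_open_subset[OF E.mfd h_smooth F.triv_D_open[OF t'(1)]]
                F.smooth_section_comp[OF Ar E.D_open E.D_subset_X t']]) simp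
        show "?h x * \<sigma>' x (A (r k) x) $ i = \<sigma>' x (?t x) $ i" if "x \<in> V'' \<inter> D" for x
          using that F.sec_scale_comp[of V'' \<sigma>' x "A (r k)" i ?h] t' F.smooth_section_fib[OF Ar] by auto
      qed
    qed
    have tz: "?t x = fib_zero F x" if x: "x \<in> D - K" for x
    proof -
      obtain V0 \<tau>0 where t0: "(V0, \<tau>0) \<in> trv F" "x \<in> V0" using F.triv_cover E.D_X x by blast
      have f: "A (r k) x \<in> fib F x" using F.smooth_section_fib[OF Ar] x by auto
      show ?thesis
        by (rule F.triv_eq_zero[OF t0 F.sec_scale_fib[of V0 \<tau>0 x "A (r k)" ?h, OF t0 f]])
          (use F.sec_scale_comp[of V0 \<tau>0 x "A (r k)" _ ?h, OF t0 f] \<chi>K x in auto)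
    qed
    have tt: "?t \<in> test_sections \<A> D F"
      unfolding test_sections_def using ts K KW tz by auto
    obtain w where w: "adjoint_at \<A> X dx D E F A ?t w"
      by (rule local_formal_adjoint[OF c(1) s(1) t(1) ts K]) (use KW tz in auto)
    have "ip dx D F ?g ?t = ip dx D E (fst v) w" by (rule adjoint_on_DT[OF v tt w])
    also have "\<dots> = 0" using weak tt w by (auto simp: weak_solutions_def)
    finally show ?thesis using F.ip_scale_right[OF v2 AC_L2[OF r(1)], of ?h k] by simp
  qed
  have "(\<lambda>k. ip dx D F (A (r k)) (sec_scale F ?h ?g)) \<longlonglongrightarrow> ip dx D F ?g (sec_scale F ?h ?g)"
    by (rule F.tendsto_inn[OF _ v2 r(3) gs]) (simp add: AC_L2 r(1))
  moreover have "ip dx D F (A (r k)) (sec_scale F ?h ?g) = 0" for k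
    using F.inn_sym[OF gs AC_L2[OF r(1)], of k] zero[of k] by simp
  ultimately have "ip dx D F ?g (sec_scale F ?h ?g) = 0" by (simp add: LIMSEQ_const_iff)
  then have "(LINT x|E.MD. ?h x * met F x (?g x) (?g x)) = 0"
    using F.ip_scale_right[OF v2 v2, of ?h] F.ip_scale[OF v2 v2, of ?h] by simp
  also have "(LINT x|E.MD. ?h x * met F x (?g x) (?g x)) = (LINT x|E.MD. complex_of_real (\<chi> x * F.sq ?g x))"
    by (rule Bochner_Integration.integral_cong)
      (use F.met_Im[OF E.D_X F.L2_fib[OF v2]] in \<open>auto simp: E.space_MD\<close>)
  finally have "complex_of_real (LINT x|E.MD. \<chi> x * F.sq ?g x) = 0" by (simp only: integral_complex_of_real)
  then have I0: "(LINT x|E.MD. \<chi> x * F.sq ?g x) = 0" by (simp only: of_real_eq_0_iff)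
  have int: "integrable E.MD (\<lambda>x. \<chi> x * F.sq ?g x)"
  proof (rule Bochner_Integration.integrable_bound[OF F.L2_int[OF v2]])
    have "\<chi> \<in> borel_measurable E.MD"
      unfolding E.MD_measurable
      by (rule borel_measurable_continuous_on_restrict[OF smooth_on_open_continuous[OF E.mfd \<chi>_smooth]])
    then show "(\<lambda>x. \<chi> x * F.sq ?g x) \<in> borel_measurable E.MD"
      using F.sq_measurable[OF F.L2_meas[OF v2]] by (rule borel_measurable_times)
    show "AE x in E.MD. norm (\<chi> x * F.sq ?g x) \<le> norm (F.sq ?g x)"
      using \<chi>01 by (intro AE_I2) (simp add: abs_mult mult_left_le_one_le)
  qed
  have "AE x in E.MD. \<chi> x * F.sq ?g x = 0"
    using I0 by (subst (asm) integral_nonneg_eq_0_iff_AE[OF int])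
      (auto simp: E.space_MD intro!: AE_I2 mult_nonneg_nonneg \<chi>01 F.sq_nonneg[OF F.L2_meas[OF v2]])
  then have ae: "AE x in E.MD. x \<in> {x \<in> ?W. 0 < \<chi> x} \<longrightarrow> ?g x = fib_zero F x"
  proof (rule AE_mp, intro AE_I2 impI)
    fix x assume "x \<in> space E.MD" "\<chi> x * F.sq ?g x = 0" "x \<in> {x \<in> ?W. 0 < \<chi> x}"
    then show "?g x = fib_zero F x"
      using F.met_definite[OF E.D_X F.L2_fib[OF v2]] by (auto simp: E.space_MD)
  qed
  have "open (?W \<inter> \<chi> -` {0<..})"
    by (rule continuous_open_preimage[OF smooth_on_open_continuous[OF E.mfd \<chi>W] W(1)]) simp
  moreover have "?W \<inter> \<chi> -` {0<..} = {x \<in> ?W. 0 < \<chi> x}" by auto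
  ultimately have o: "open {x \<in> ?W. 0 < \<chi> x}" by simp
  show ?thesis by (rule that[OF o _ ae]) (use pW \<chi>0(5) in \<open>auto simp: \<chi>_def\<close>)
qed

text \<open>
  A weak solution in \<open>\<D>\<^sub>T\<close> has \<open>A u = 0\<close> almost everywhere near each point, hence, by second countability,
  almost everywhere in \<open>D\<close>.
\<close>

theorem weak_solution_iff:
  assumes v: "v \<in> DT"
  shows "fst v \<in> weak_solutions \<A> X dx D E F A \<longleftrightarrow> F.nrm (snd v) = 0"
proof
  assume weak: "fst v \<in> weak_solutions \<A> X dx D E F A"
  have "\<forall>p\<in>D. \<exists>T. open T \<and> p \<in> T \<and> (AE x in E.MD. x \<in> T \<longrightarrow> snd v x = fib_zero F x)"
  proof
    fix p assume "p \<in> D"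
    then show "\<exists>T. open T \<and> p \<in> T \<and> (AE x in E.MD. x \<in> T \<longrightarrow> snd v x = fib_zero F x)"
      by (rule weak_solution_vanishes_near[OF v weak]) blast
  qed
  then obtain T where T: "\<And>p. p \<in> D \<Longrightarrow> open (T p) \<and> p \<in> T p \<and> (AE x in E.MD. x \<in> T p \<longrightarrow> snd v x = fib_zero F x)"
    by metis
  have "\<And>S. S \<in> T ` D \<Longrightarrow> open S" using T by auto
  then obtain \<C> where \<C>: "\<C> \<subseteq> T ` D" "countable \<C>" "\<Union>\<C> = \<Union>(T ` D)" using Lindelof by metis
  have "AE x in E.MD. \<forall>S\<in>\<C>. x \<in> S \<longrightarrow> snd v x = fib_zero F x"
    unfolding AE_ball_countable[OF \<C>(2)] using \<C>(1) T by auto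
  then have ae: "AE x in E.MD. F.sq (snd v) x = 0"
  proof (rule AE_mp, intro AE_I2 impI)
    fix x assume x: "x \<in> space E.MD" and z: "\<forall>S\<in>\<C>. x \<in> S \<longrightarrow> snd v x = fib_zero F x"
    have xD: "x \<in> D" using x by (simp add: E.space_MD)
    then have "x \<in> \<Union>\<C>" using T unfolding \<C>(3) by auto
    then have "snd v x = fib_zero F x" using z by auto
    then show "F.sq (snd v) x = 0"
      using F.met_zero_left[OF E.D_X[OF xD], of "snd v x"] F.L2_fib[OF DT_L2(2)[OF v] xD] by simp
  qed
  have "(F.nrm (snd v))\<^sup>2 = 0"
    unfolding F.nrm_sq_integral[OF DT_L2(2)[OF v]] by (rule integral_eq_zero_AE[OF ae])
  then show "F.nrm (snd v) = 0" by simp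
qed (rule weak_solution_if_zero[OF v])

end

section \<open>The Cauchy problem\<close>

text \<open>
  The pieces are put together for \<open>C\<close> the smooth sections with \<open>t(u) = 0\<close> on \<open>\<Gamma>\<close>. The limit \<open>(a, f)\<close> of the
  regularised solutions is the required solution. It is unique because the difference of two candidates
  lies in the kernel of \<open>A\<close> and is orthogonal to it.
\<close>

theorem corollary4p4:
  fixes \<A> :: "('m::{t2_space, second_countable_topology}, 'n::finite) chart set"
    and X D N \<Gamma> :: "'m set"
    and \<omega> :: "('m, 'n) chart \<Rightarrow> 'm \<Rightarrow> real" and dx :: "'m measure"
    and E :: "('m, 'e) hbundle" and F :: "('m, 'f) hbundle"
    and m :: nat and A :: "('m \<Rightarrow> 'e) \<Rightarrow> ('m \<Rightarrow> 'f)"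
    and mo :: "nat \<Rightarrow> nat" and Fj :: "nat \<Rightarrow> ('m, 'g) vbundle"
    and B :: "nat \<Rightarrow> ('m \<Rightarrow> 'e) \<Rightarrow> ('m \<Rightarrow> 'g)"
    and DT :: "(('m \<Rightarrow> 'e) \<times> ('m \<Rightarrow> 'f)) set"
    and f :: "'m \<Rightarrow> 'f" and u :: "real \<Rightarrow> ('m \<Rightarrow> 'e) \<times> ('m \<Rightarrow> 'f)"
  assumes "closed_manifold \<A>"
    and "submanifold_with_boundary \<A> X"
    and "volume_form \<A> X \<omega>" and "volume_measure \<A> X \<omega> dx"
    and "hermitian_bundle \<A> X E" and "hermitian_bundle \<A> X F"
    and "diff_operator \<A> X m E F A" and "injective_symbol \<A> X m E F A"
    and "smooth_domain \<A> X D"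
    and "closed \<Gamma>" and "\<Gamma> \<subseteq> frontier D"
    and "dirichlet_system \<A> X D E m N mo Fj B"
    and "DT = completion_T dx D E F A (smooth_T \<A> X D E m Fj B \<Gamma>)"
    and "f \<in> L2 dx D F"
    and "\<forall>\<delta>>0. \<exists>v\<in>DT. L2norm dx D F (sec_diff F (snd v) f) < \<delta>"
    and "\<forall>\<epsilon>>0. is_u_eps dx D E F DT f \<epsilon> (u \<epsilon>)"
  shows "((\<exists>C. \<forall>\<epsilon>>0. Dnorm dx D E F (u \<epsilon>) \<le> C) \<longleftrightarrow> (\<exists>w. cauchy_solution dx D DT f w)) \<and>
    ((\<lambda>\<epsilon>. L2norm dx D F (sec_diff F (snd (u \<epsilon>)) f)) \<longlongrightarrow> 0) (at_right 0) \<and>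
    ((\<exists>w. cauchy_solution dx D DT f w) \<longrightarrow>
      (\<exists>w. cauchy_solution dx D DT f w \<and>
        (\<forall>v\<in>DT. fst v \<in> weak_solutions \<A> X dx D E F A \<longrightarrow> ip dx D E (fst w) (fst v) = 0) \<and>
        (\<forall>w'. cauchy_solution dx D DT f w' \<and>
           (\<forall>v\<in>DT. fst v \<in> weak_solutions \<A> X dx D E F A \<longrightarrow> ip dx D E (fst w') (fst v) = 0) \<longrightarrow>
           ae_eq dx D (fst w') (fst w) \<and> ae_eq dx D (snd w') (snd w)) \<and>
        (\<forall>v\<in>DT. ((\<lambda>\<epsilon>. Dip dx D E F (u \<epsilon>) v) \<longlongrightarrow> Dip dx D E F w v) (at_right 0))))"
proof -
  note vol = assms(3,4) and f = assms(14)
  have sub: "closure D \<subseteq> interior X" and oD: "open D" and cD: "compact (closure D)"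
    using assms(9) by (auto simp: smooth_domain_def)
  have dx: "sets dx = sets borel" using vol(2) by (simp add: volume_measure_def)
  have fin: "emeasure dx D < \<infinity>"
    by (rule volume_finite_on_compact[OF assms(1) vol cD sub borel_open[OF oD] closure_subset])
  interpret E: L2_sections \<A> X E dx D
    by unfold_locales (use assms oD cD sub dx fin in auto)
  interpret F: L2_sections \<A> X F dx D
    by unfold_locales (use assms oD cD sub dx fin in auto)
  interpret S: cauchy_volume_setting \<A> X E F dx D m A "smooth_T \<A> X D E m Fj B \<Gamma>" \<omega>
  proof unfold_locales
    show "smooth_T \<A> X D E m Fj B \<Gamma> \<subseteq> smooth_closure_sections \<A> X D E" by (auto simp: smooth_T_def)
    show "sec_diff E v w \<in> smooth_T \<A> X D E m Fj B \<Gamma>"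
      if "v \<in> smooth_T \<A> X D E m Fj B \<Gamma>" "w \<in> smooth_T \<A> X D E m Fj B \<Gamma>" for v w
      by (rule smooth_T_diff[OF assms(1) E.vbundle_over_axioms assms(12,11) that])
  qed (use assms in auto)
  have DT: "DT = S.DT" using assms(13) by (simp add: S.DT_def)
  interpret T: tikhonov "L2 dx D E" "sec_diff E" "ip dx D E" "L2 dx D F" "sec_diff F" "ip dx D F" DT f u
  proof unfold_locales
    show "\<exists>l\<in>L2 dx D E. (\<lambda>k. E.nrm (sec_diff E (s k) l)) \<longlonglongrightarrow> 0"
      if "\<And>k. s k \<in> L2 dx D E" "\<And>e. e > 0 \<Longrightarrow> \<exists>N. \<forall>m\<ge>N. \<forall>n\<ge>N. E.nrm (sec_diff E (s m) (s n)) < e"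
      for s :: "nat \<Rightarrow> 'm \<Rightarrow> 'e"
      by (rule E.L2_complete[OF that])
    show "DT \<subseteq> L2 dx D E \<times> L2 dx D F" using S.DT_L2 unfolding DT by (force simp: mem_Times_iff)
    show "(sec_diff E (fst v) (fst w), sec_diff F (snd v) (snd w)) \<in> DT" if "v \<in> DT" "w \<in> DT" for v w
      using S.DT_diff that unfolding DT by blast
    show "(a, b) \<in> DT" if "\<And>k::nat. s k \<in> DT" "a \<in> L2 dx D E" "b \<in> L2 dx D F"
      "(\<lambda>k. E.nrm (sec_diff E (fst (s k)) a)) \<longlonglongrightarrow> 0" "(\<lambda>k. F.nrm (sec_diff F (snd (s k)) b)) \<longlonglongrightarrow> 0" for s a b
      unfolding DT by (rule S.DT_closed[OF that(1)[unfolded DT] that(2-5)])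
    show "f \<in> L2 dx D F" by (rule f)
    show "\<exists>v\<in>DT. F.nrm (sec_diff F (snd v) f) < \<delta>" if "\<delta> > 0" for \<delta>
      using assms(15) that by (simp add: F.L2norm_nrm)
    show "u \<epsilon> \<in> DT" if "\<epsilon> > 0" for \<epsilon>
      using assms(16) that by (simp add: is_u_eps_def)
    show "ip dx D F (snd (u \<epsilon>)) (snd v) + complex_of_real \<epsilon> * ip dx D E (fst (u \<epsilon>)) (fst v) = ip dx D F f (snd v)"
      if "\<epsilon> > 0" "v \<in> DT" for \<epsilon> v
      using assms(16) that by (simp add: is_u_eps_def)
  qed
  have solution: "F.nrm (sec_diff F (snd w) f) = 0" if "cauchy_solution dx D DT f w" for w
    using that by (intro F.nrm_diff_ae T.G_snd f) (auto simp: cauchy_solution_def F.ae_eq_MD)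
  have solutionI: "cauchy_solution dx D DT f (a, f)" if "(a, f) \<in> DT" for a
    using that by (simp add: cauchy_solution_def ae_eq_def)
  have weak: "fst v \<in> weak_solutions \<A> X dx D E F A \<longleftrightarrow> F.nrm (snd v) = 0" if "v \<in> DT" for v
    using S.weak_solution_iff that unfolding DT by blast
  have Dnorm: "Dnorm dx D E F v = sqrt ((E.nrm (fst v))\<^sup>2 + (F.nrm (snd v))\<^sup>2)" if "v \<in> DT" for v
    by (simp add: Dnorm_def Dip_def E.nrm_square F.nrm_square T.G_fst T.G_snd that)
  have bounded_if_solvable: "\<exists>C. \<forall>\<epsilon>>0. Dnorm dx D E F (u \<epsilon>) \<le> C"
    if w: "cauchy_solution dx D DT f w" for w
  proof (intro exI allI impI)
    fix \<epsilon> :: real assume \<epsilon>: "\<epsilon> > 0"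
    have "w \<in> DT" using w by (simp add: cauchy_solution_def)
    then have "(E.nrm (fst (u \<epsilon>)))\<^sup>2 \<le> (E.nrm (fst w))\<^sup>2"
      by (intro power_mono T.u_bounded_by_solution solution w \<epsilon> E.nrm_nonneg T.G_fst T.u_G)
    moreover have "(F.nrm (snd (u \<epsilon>)))\<^sup>2 \<le> (F.nrm f)\<^sup>2"
      by (intro power_mono T.image_bounded \<epsilon> F.nrm_nonneg T.G_snd T.u_G)
    ultimately show "Dnorm dx D E F (u \<epsilon>) \<le> sqrt ((E.nrm (fst w))\<^sup>2 + (F.nrm f)\<^sup>2)"
      by (simp add: Dnorm[OF T.u_G[OF \<epsilon>]])
  qed
  have limit: "\<exists>a. a \<in> L2 dx D E \<and> (a, f) \<in> DT \<and> ((\<lambda>\<epsilon>. E.nrm (sec_diff E (fst (u \<epsilon>)) a)) \<longlongrightarrow> 0) (at_right 0) \<and>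
      (\<forall>v\<in>DT. F.nrm (snd v) = 0 \<longrightarrow> ip dx D E a (fst v) = 0)"
    if bound: "\<forall>\<epsilon>>0. Dnorm dx D E F (u \<epsilon>) \<le> C" for C
  proof -
    have le: "E.nrm (fst (u \<epsilon>)) \<le> C" if \<epsilon>: "\<epsilon> > 0" for \<epsilon>
    proof -
      have "E.nrm (fst (u \<epsilon>)) \<le> Dnorm dx D E F (u \<epsilon>)"
        unfolding Dnorm[OF T.u_G[OF \<epsilon>]] by (rule real_le_rsqrt) simp
      then show ?thesis using bound \<epsilon> by fastforce
    qed
    show ?thesis
    proof (rule T.regularised_converges[OF le])
      fix a assume "a \<in> L2 dx D E" "(a, f) \<in> DT"
        "((\<lambda>\<epsilon>. E.nrm (sec_diff E (fst (u \<epsilon>)) a)) \<longlongrightarrow> 0) (at_right 0)"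
        "\<And>v. v \<in> DT \<Longrightarrow> F.nrm (snd v) = 0 \<Longrightarrow> ip dx D E a (fst v) = 0"
      then show ?thesis by (intro exI[of _ a] conjI ballI impI)
    qed
  qed
  have residual: "((\<lambda>\<epsilon>. L2norm dx D F (sec_diff F (snd (u \<epsilon>)) f)) \<longlongrightarrow> 0) (at_right 0)"
    unfolding F.L2norm_nrm by (rule T.residual_tendsto_0)
  have pos: "\<forall>\<^sub>F \<epsilon> in at_right (0::real). \<epsilon> > 0" by (rule eventually_at_right_less)
  have "\<exists>w. cauchy_solution dx D DT f w \<and>
        (\<forall>v\<in>DT. fst v \<in> weak_solutions \<A> X dx D E F A \<longrightarrow> ip dx D E (fst w) (fst v) = 0) \<and>
        (\<forall>w'. cauchy_solution dx D DT f w' \<and>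
           (\<forall>v\<in>DT. fst v \<in> weak_solutions \<A> X dx D E F A \<longrightarrow> ip dx D E (fst w') (fst v) = 0) \<longrightarrow>
           ae_eq dx D (fst w') (fst w) \<and> ae_eq dx D (snd w') (snd w)) \<and>
        (\<forall>v\<in>DT. ((\<lambda>\<epsilon>. Dip dx D E F (u \<epsilon>) v) \<longlongrightarrow> Dip dx D E F w v) (at_right 0))"
    if w0: "cauchy_solution dx D DT f w0" for w0
  proof -
    obtain C where "\<forall>\<epsilon>>0. Dnorm dx D E F (u \<epsilon>) \<le> C" using bounded_if_solvable[OF w0] by blast
    then obtain a where a: "a \<in> L2 dx D E" "(a, f) \<in> DT"
      "((\<lambda>\<epsilon>. E.nrm (sec_diff E (fst (u \<epsilon>)) a)) \<longlongrightarrow> 0) (at_right 0)"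
      and orth: "\<And>v. v \<in> DT \<Longrightarrow> F.nrm (snd v) = 0 \<Longrightarrow> ip dx D E a (fst v) = 0"
      using limit by blast
    show ?thesis
    proof (intro exI[of _ "(a, f)"] conjI ballI allI impI solutionI a(2))
      fix v assume "v \<in> DT" "fst v \<in> weak_solutions \<A> X dx D E F A"
      then show "ip dx D E (fst (a, f)) (fst v) = 0" using orth weak by simp
    next
      fix v assume v: "v \<in> DT"
      have "((\<lambda>\<epsilon>. ip dx D E (fst (u \<epsilon>)) (fst v)) \<longlongrightarrow> ip dx D E a (fst v)) (at_right 0)"
        by (rule E.tendsto_inn[OF _ a(1,3) T.G_fst[OF v]])
          (rule eventually_mono[OF pos], rule T.G_fst[OF T.u_G])
      moreover have "((\<lambda>\<epsilon>. ip dx D F (snd (u \<epsilon>)) (snd v)) \<longlongrightarrow> ip dx D F f (snd v)) (at_right 0)"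
        by (rule F.tendsto_inn[OF _ f T.residual_tendsto_0 T.G_snd[OF v]])
          (rule eventually_mono[OF pos], rule T.G_snd[OF T.u_G])
      ultimately show "((\<lambda>\<epsilon>. Dip dx D E F (u \<epsilon>) v) \<longlongrightarrow> Dip dx D E F (a, f) v) (at_right 0)"
        unfolding Dip_def by (simp add: tendsto_add)
    next
      fix w' assume w': "cauchy_solution dx D DT f w' \<and>
        (\<forall>v\<in>DT. fst v \<in> weak_solutions \<A> X dx D E F A \<longrightarrow> ip dx D E (fst w') (fst v) = 0)"
      then have G: "w' \<in> DT" by (simp add: cauchy_solution_def)
      define d where "d = (sec_diff E (fst w') a, sec_diff F (snd w') f)"
      have d: "d \<in> DT" using T.G_dif[OF G a(2)] by (simp add: d_def)
      have d0: "F.nrm (snd d) = 0" using solution[of w'] w' by (simp add: d_def)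
      have "ip dx D E (fst w') (fst d) = 0" using w' d d0 weak by blast
      moreover have "ip dx D E a (fst d) = 0" by (rule orth[OF d d0])
      moreover have "ip dx D E (fst d) (fst d) = ip dx D E (fst w') (fst d) - ip dx D E a (fst d)"
        using E.inn_dif[OF T.G_fst[OF G] a(1) T.G_fst[OF d]] by (simp add: d_def)
      ultimately have "E.nrm (sec_diff E (fst w') a) = 0" by (simp add: E.nrm_def d_def)
      then show "ae_eq dx D (fst w') (fst (a, f))"
        unfolding E.ae_eq_MD fst_conv by (rule E.nrm_eq_0[OF T.G_fst[OF G] a(1)])
      show "ae_eq dx D (snd w') (snd (a, f))" using w' by (simp add: cauchy_solution_def)
    qed
  qed
  moreover have "(\<exists>C. \<forall>\<epsilon>>0. Dnorm dx D E F (u \<epsilon>) \<le> C) \<longleftrightarrow> (\<exists>w. cauchy_solution dx D DT f w)"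
    using bounded_if_solvable limit solutionI by blast
  ultimately show ?thesis using residual by blast
qed

end
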